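(* Let $X$ be a rearrangement invariant space on $[0,1]$ that is $p$-convex for some $1<p<\infty$ and whose upper Boyd index satisfies $q_X<\infty$. The following statements hold. (1) If $X$ is order continuous, then $X$ has the weak order Banach-Saks property ($w$-$oBSP$). (2) If $X$ is monotonically complete and admits a special modular, then $X$ has the order Banach-Saks property ($oBSP$).
   Context: $L^0$ is the vector lattice of real measurable functions on $[0,1]$ (Lebesgue measure), modulo a.e. equality; inequalities are a.e. A Banach function space $X$ on $[0,1]$ is a Banach space that is a linear subspace of $L^0$ such that $f\in X$ and $\|f\|_X\le\|g\|_X$ whenever $f \in L^0$, $g\in X$ and $|f|\le|g|$. $X_+=\{f\in X: f\ge 0\}$. For $h\in L^0$ the decreasing rearrangement is $h^*(t)=\inf\{\lambda: |\{|h|>\lambda\}|\le t\}$, $t\in(0,1]$. A rearrangement invariant (r.i.) space is a Banach function space $X\ne\{0\}$ such that whenever $h\in L^0$ satisfies $h^*=f^*$ for some $f\in X$, then $h\in X$ and $\|h\|_X=\|f\|_X$. $X$ is $p$-convex if there is a constant $C>0$ such that $\big\|(\sum_{i=1}^n|f_i|^p)^{1/p}\big\|_X\le C(\sum_{i=1}^n\|f_i\|_X^p)^{1/p}$ for any finitely many $f_1,\dots,f_n\in X$. For $s>0$, $D_s$ is the linear operator on $X$ with $(D_sf)(t)=f(t/s)$ for $t\le\min\{1,s\}$ and $(D_sf)(t)=0$ otherwise. The upper Boyd index is $q_X=\inf_{0<s<1}\frac{\log s}{\log\|D_s\|}$, where $\|D_s\|$ is the operator norm on $X$ and the quotient is read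 as $+\infty$ when $\|D_s\|=1$. A sequence $\{f_n\}$ in $X$ is dominated in $X$ if there is $h\in X_+$ with $|f_n|\le h$ for all $n$. It order converges to $f\in X$ (written $f_n\xrightarrow{o}f$) if there is a sequence $\{g_n\}$ in $X$ with $g_n\downarrow0$ and $|f_n-f|\le g_n$ for all $n$; equivalently, it is dominated in $X$ and $f_n\to f$ a.e. The Cesàro sequence of $\{f_n\}$ is $\{\frac1m\sum_{n=1}^m f_n\}_m$. $X$ is order continuous if $\|f_n\|_X\to0$ whenever $f_n\xrightarrow{o}0$ in $X$. $X$ is monotonically complete if the pointwise supremum of any increasing, norm bounded sequence in $X_+$ belongs to $X$. $X$ has $w$-$oBSP$ if every weakly null sequence in $X$ has a subsequence whose Cesàro sequence order converges in $X$. $X$ has $oBSP$ if every norm bounded sequence in $X$ has a subsequence whose Cesàro sequence order converges in $X$. A special modular on $X$ is a functional $\rho:X\to[0,\infty]$ such that: (M1) if $f\in X_+$ and $\rho(f)<\infty$, then $\rho(f_n)\to0$ whenever $f_n\xrightarrow{o}0$ and $0\le f_n\le f$; (M2) if $\{f_n\}$ is a sequence in $X$ with $\sum_{n=1}^\infty\rho(f_n)<\infty$, then a subsequence of $\{f_n\}$ is dominated in $X$; (M3) $\rho(f)<\infty$ for every $f$ in the closed unit ball of $X$. *)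

theory Defs
  imports "HOL-Analysis.Analysis"
begin

text \<open>
  Elements of \<open>L\<^sup>0\<close> are represented by Lebesgue measurable functions on \<open>[0,1]\<close>; a.e. equality
  takes the place of equality, and the values of a representative outside \<open>[0,1]\<close> are irrelevant.
  A space \<open>X\<close> of classes is the set of all representatives of its members (the ideal property makes
  this set closed under a.e. equality), with its norm given by a function \<open>N\<close> on representatives.
\<close>

abbreviation I01 :: "real measure" where
  "I01 \<equiv> lebesgue_on {0..1}"

abbreviation L0 :: "(real \<Rightarrow> real) set" where
  "L0 \<equiv> borel_measurable I01"

abbreviation ae_le :: "(real \<Rightarrow> real) \<Rightarrow> (real \<Rightarrow> real) \<Rightarrow> bool"  (infix "\<le>\<^sub>a" 50) where
  "f \<le>\<^sub>a g \<equiv> (AE t in I01. f t \<le> g t)"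

abbreviation ae_eq :: "(real \<Rightarrow> real) \<Rightarrow> (real \<Rightarrow> real) \<Rightarrow> bool"  (infix "=\<^sub>a" 50) where
  "f =\<^sub>a g \<equiv> (AE t in I01. f t = g t)"

locale banach_function_space =
  fixes X :: "(real \<Rightarrow> real) set" and N :: "(real \<Rightarrow> real) \<Rightarrow> real"
  assumes measurable: "X \<subseteq> L0"
    and zero: "(\<lambda>t. 0) \<in> X"
    and add: "\<lbrakk>f \<in> X; g \<in> X\<rbrakk> \<Longrightarrow> (\<lambda>t. f t + g t) \<in> X"
    and scale: "f \<in> X \<Longrightarrow> (\<lambda>t. c * f t) \<in> X"
    and norm_nonneg: "f \<in> X \<Longrightarrow> 0 \<le> N f"
    and norm_eq_0_iff: "f \<in> X \<Longrightarrow> N f = 0 \<longleftrightarrow> f =\<^sub>a (\<lambda>t. 0)"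
    and norm_scale: "f \<in> X \<Longrightarrow> N (\<lambda>t. c * f t) = \<bar>c\<bar> * N f"
    and norm_triangle: "\<lbrakk>f \<in> X; g \<in> X\<rbrakk> \<Longrightarrow> N (\<lambda>t. f t + g t) \<le> N f + N g"
    and complete:
      "\<lbrakk>\<And>n. F n \<in> X;
        \<And>e. 0 < e \<Longrightarrow> \<exists>n0. \<forall>m\<ge>n0. \<forall>n\<ge>n0. N (\<lambda>t. F m t - F n t) < e\<rbrakk>
       \<Longrightarrow> \<exists>f\<in>X. (\<lambda>n. N (\<lambda>t. F n t - f t)) \<longlonglongrightarrow> 0"
    and ideal: "\<lbrakk>f \<in> L0; g \<in> X; (\<lambda>t. \<bar>f t\<bar>) \<le>\<^sub>a (\<lambda>t. \<bar>g t\<bar>)\<rbrakk> \<Longrightarrow> f \<in> X \<and> N f \<le> N g"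

text \<open>
  The infimum is over levels \<open>c \<ge> 0\<close>: negative ones would matter only at \<open>t = 1\<close>, where they
  would make the infimum \<open>-\<infinity>\<close>.
\<close>

definition decr_rearrangement :: "(real \<Rightarrow> real) \<Rightarrow> real \<Rightarrow> real" where
  "decr_rearrangement h t =
     Inf {c. 0 \<le> c \<and> measure I01 {x \<in> {0..1}. c < \<bar>h x\<bar>} \<le> t}"

locale ri_space = banach_function_space +
  assumes nontrivial: "\<exists>f\<in>X. \<not> f =\<^sub>a (\<lambda>t. 0)"
    and rearrangement_invariant:
      "\<lbrakk>h \<in> L0; f \<in> X; \<forall>t\<in>{0<..1}. decr_rearrangement h t = decr_rearrangement f t\<rbrakk>
       \<Longrightarrow> h \<in> X \<and> N h = N f"

definition p_convex :: "real \<Rightarrow> (real \<Rightarrow> real) set \<Rightarrow> ((real \<Rightarrow> real) \<Rightarrow> real) \<Rightarrow> bool" where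
  "p_convex p X N \<longleftrightarrow>
     (\<exists>C>0. \<forall>(n::nat) f. (\<forall>i<n. f i \<in> X) \<longrightarrow>
        N (\<lambda>t. (\<Sum>i<n. \<bar>f i t\<bar> powr p) powr (1 / p)) \<le> C * (\<Sum>i<n. N (f i) powr p) powr (1 / p))"

definition dilation :: "real \<Rightarrow> (real \<Rightarrow> real) \<Rightarrow> real \<Rightarrow> real" where
  "dilation s f t = (if t \<le> min 1 s then f (t / s) else 0)"

text \<open>
  On an r.i. space every dilation is bounded, so the supremum below is over a nonempty bounded set.
\<close>

definition dilation_norm ::
  "(real \<Rightarrow> real) set \<Rightarrow> ((real \<Rightarrow> real) \<Rightarrow> real) \<Rightarrow> real \<Rightarrow> real" where
  "dilation_norm X N s = (SUP f\<in>{f \<in> X. N f \<le> 1}. N (dilation s f))"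

definition upper_boyd_index ::
  "(real \<Rightarrow> real) set \<Rightarrow> ((real \<Rightarrow> real) \<Rightarrow> real) \<Rightarrow> ereal" where
  "upper_boyd_index X N =
     (INF s\<in>{0<..<1}. if dilation_norm X N s = 1 then \<infinity>
                       else ereal (ln s / ln (dilation_norm X N s)))"

definition dominated_in :: "(real \<Rightarrow> real) set \<Rightarrow> (nat \<Rightarrow> real \<Rightarrow> real) \<Rightarrow> bool" where
  "dominated_in X f \<longleftrightarrow>
     (\<exists>h\<in>X. (\<lambda>t. 0) \<le>\<^sub>a h \<and> (\<forall>n. (\<lambda>t. \<bar>f n t\<bar>) \<le>\<^sub>a h))"

text \<open>
  In an ideal of \<open>L\<^sup>0\<close> the infimum of a decreasing positive sequence is its a.e. limit, so
  \<open>g\<^sub>n \<down> 0\<close> means that \<open>g\<^sub>n\<close> decreases to \<open>0\<close> almost everywhere.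
\<close>

definition order_converges ::
  "(real \<Rightarrow> real) set \<Rightarrow> (nat \<Rightarrow> real \<Rightarrow> real) \<Rightarrow> (real \<Rightarrow> real) \<Rightarrow> bool" where
  "order_converges X f l \<longleftrightarrow>
     (\<forall>n. f n \<in> X) \<and> l \<in> X \<and>
     (\<exists>g. (\<forall>n. g n \<in> X) \<and>
          (\<forall>n. g (Suc n) \<le>\<^sub>a g n) \<and> (AE t in I01. (\<lambda>n. g n t) \<longlonglongrightarrow> 0) \<and>
          (\<forall>n. (\<lambda>t. \<bar>f n t - l t\<bar>) \<le>\<^sub>a g n))"

text \<open>Sequences are indexed from \<open>0\<close>, so the \<open>m\<close>-th mean averages the first \<open>m + 1\<close> terms.\<close>

definition cesaro :: "(nat \<Rightarrow> real \<Rightarrow> real) \<Rightarrow> nat \<Rightarrow> real \<Rightarrow> real" where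
  "cesaro f m t = (\<Sum>n\<le>m. f n t) / real (Suc m)"

definition order_continuous ::
  "(real \<Rightarrow> real) set \<Rightarrow> ((real \<Rightarrow> real) \<Rightarrow> real) \<Rightarrow> bool" where
  "order_continuous X N \<longleftrightarrow>
     (\<forall>f. order_converges X f (\<lambda>t. 0) \<longrightarrow> (\<lambda>n. N (f n)) \<longlonglongrightarrow> 0)"

text \<open>
  The supremum is taken in the extended reals, so that membership in \<open>X\<close> includes its a.e. finiteness.
\<close>

definition monotonically_complete ::
  "(real \<Rightarrow> real) set \<Rightarrow> ((real \<Rightarrow> real) \<Rightarrow> real) \<Rightarrow> bool" where
  "monotonically_complete X N \<longleftrightarrow>
     (\<forall>f :: nat \<Rightarrow> real \<Rightarrow> real.
        (\<forall>n. f n \<in> X \<and> (\<lambda>t. 0) \<le>\<^sub>a f n) \<and> (\<forall>n. f n \<le>\<^sub>a f (Suc n)) \<and>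
        (\<exists>C. \<forall>n. N (f n) \<le> C) \<longrightarrow>
        (\<exists>g\<in>X. AE t in I01. (SUP n. ereal (f n t)) = ereal (g t)))"

text \<open>The bound forces a functional to respect a.e. equality.\<close>

definition dual_functional ::
  "(real \<Rightarrow> real) set \<Rightarrow> ((real \<Rightarrow> real) \<Rightarrow> real) \<Rightarrow> ((real \<Rightarrow> real) \<Rightarrow> real) \<Rightarrow> bool" where
  "dual_functional X N \<phi> \<longleftrightarrow>
     (\<forall>f\<in>X. \<forall>g\<in>X. \<phi> (\<lambda>t. f t + g t) = \<phi> f + \<phi> g) \<and>
     (\<forall>f\<in>X. \<forall>c. \<phi> (\<lambda>t. c * f t) = c * \<phi> f) \<and>
     (\<exists>C. \<forall>f\<in>X. \<bar>\<phi> f\<bar> \<le> C * N f)"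

definition weakly_null ::
  "(real \<Rightarrow> real) set \<Rightarrow> ((real \<Rightarrow> real) \<Rightarrow> real) \<Rightarrow> (nat \<Rightarrow> real \<Rightarrow> real) \<Rightarrow> bool" where
  "weakly_null X N f \<longleftrightarrow>
     (\<forall>n. f n \<in> X) \<and> (\<forall>\<phi>. dual_functional X N \<phi> \<longrightarrow> (\<lambda>n. \<phi> (f n)) \<longlonglongrightarrow> 0)"

definition weak_order_Banach_Saks ::
  "(real \<Rightarrow> real) set \<Rightarrow> ((real \<Rightarrow> real) \<Rightarrow> real) \<Rightarrow> bool" where
  "weak_order_Banach_Saks X N \<longleftrightarrow>
     (\<forall>f. weakly_null X N f \<longrightarrow>
        (\<exists>r l. strict_mono r \<and> order_converges X (cesaro (f \<circ> r)) l))"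

definition order_Banach_Saks ::
  "(real \<Rightarrow> real) set \<Rightarrow> ((real \<Rightarrow> real) \<Rightarrow> real) \<Rightarrow> bool" where
  "order_Banach_Saks X N \<longleftrightarrow>
     (\<forall>f :: nat \<Rightarrow> real \<Rightarrow> real. (\<forall>n. f n \<in> X) \<and> (\<exists>C. \<forall>n. N (f n) \<le> C) \<longrightarrow>
        (\<exists>r l. strict_mono r \<and> order_converges X (cesaro (f \<circ> r)) l))"

text \<open>The first condition makes \<open>\<rho>\<close> a functional on classes modulo a.e. equality.\<close>

definition special_modular ::
  "(real \<Rightarrow> real) set \<Rightarrow> ((real \<Rightarrow> real) \<Rightarrow> real) \<Rightarrow> ((real \<Rightarrow> real) \<Rightarrow> ennreal) \<Rightarrow> bool" where
  "special_modular X N \<rho> \<longleftrightarrow>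
     (\<forall>f\<in>X. \<forall>g\<in>X. f =\<^sub>a g \<longrightarrow> \<rho> f = \<rho> g) \<and>
     (\<forall>f F. f \<in> X \<and> (\<lambda>t. 0) \<le>\<^sub>a f \<and> \<rho> f < \<infinity> \<and> order_converges X F (\<lambda>t. 0) \<and>
            (\<forall>n. (\<lambda>t. 0) \<le>\<^sub>a F n \<and> F n \<le>\<^sub>a f) \<longrightarrow> (\<lambda>n. \<rho> (F n)) \<longlonglongrightarrow> 0) \<and>
     (\<forall>F. (\<forall>n. F n \<in> X) \<and> (\<Sum>n. \<rho> (F n)) < \<infinity> \<longrightarrow>
          (\<exists>r. strict_mono r \<and> dominated_in X (F \<circ> r))) \<and>
     (\<forall>f\<in>X. N f \<le> 1 \<longrightarrow> \<rho> f < \<infinity>)"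

end

theory Submission
  imports Defs "HOL-Library.Diagonal_Subsequence"
begin

text \<open>
  Both parts reduce to one fact about dyadic martingale differences \<open>d j\<close> that are bounded in \<open>X\<close>:
  the martingale \<open>\<Sum> d j / (j + 1)\<close> has a maximal function in \<open>X\<close> and converges almost everywhere,
  so that by summation by parts the means of \<open>d\<close> order converge to \<open>0\<close>. We may assume \<open>p \<le> 2\<close>.
  A good-\<open>\<lambda>\<close> inequality compares the maximal function with the \<open>p\<close>-function
  \<open>(\<Sum> \<bar>d j\<bar> powr p) powr (1 / p)\<close> and its predictable counterpart. Because \<open>q\<^sub>X < \<infinity>\<close> makes the norms
  of small dilations tend to \<open>0\<close>, it passes to the norm of \<open>X\<close>, and \<open>p\<close>-convexity bounds both
  \<open>p\<close>-functions: a conditional expectation over a finite dyadic algebra is an average of rearrangements.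

  A sequence that is weakly null, or whose weak limit has been subtracted, has a subsequence of the
  form \<open>d j + e j + r j\<close> with such \<open>d\<close>, norm summable \<open>e\<close>, and truncation remainders \<open>r j\<close> that are norm
  summable in the order continuous case, and dominated and eventually zero in the case of a special modular.
\<close>

section \<open>Banach function spaces\<close>

text \<open>The cap \<open>p \<le> 2\<close> comes from the moment estimate: the slope of
  \<open>|x| powr p\<close> is Hoelder continuous of order \<open>p - 1\<close> when that order is
  at most one, and this leaves an error of size \<open>|b| powr p\<close> once the linear term has
  averaged out. In the good-\<lambda> inequality the maximal function reappears on the right with a
  small coefficient \<open>r\<close>. In norm that term becomes a dilation by \<open>r\<close>, and
  it can be absorbed only if the dilation is small as an operator.

  The obstacle in the second statement is that \<open>X\<close> need not be order continuous: step
  functions need not be dense, and truncation remainders need not be small in norm. Approximation is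
  therefore confined to bounded functions, for which smallness of the norms of indicators suffices,
  and the modular takes over the control of the remainders. Weak convergence is likewise replaced by
  convergence of dyadic averages, which is all that the selection of differences uses.

  Martingales live on a grid of \<open>2 ^ K\<close> points, where exclusive-or with small numbers
  permutes the cells inside each coarser interval; this is the source of the rearrangements.\<close>

context banach_function_space
begin

lemma X_L0: "f \<in> X \<Longrightarrow> f \<in> L0"
  using measurable by auto

lemma idealD: "f \<in> L0 \<Longrightarrow> g \<in> X \<Longrightarrow> (AE t in I01. \<bar>f t\<bar> \<le> \<bar>g t\<bar>) \<Longrightarrow> f \<in> X"
  and norm_mono: "f \<in> L0 \<Longrightarrow> g \<in> X \<Longrightarrow> (AE t in I01. \<bar>f t\<bar> \<le> \<bar>g t\<bar>) \<Longrightarrow> N f \<le> N g"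
  using ideal by blast+

lemma norm_cong: "f \<in> X \<Longrightarrow> g \<in> L0 \<Longrightarrow> (AE t in I01. \<bar>f t\<bar> = \<bar>g t\<bar>) \<Longrightarrow> g \<in> X \<and> N g = N f"
proof -
  assume a: "f \<in> X" "g \<in> L0" "AE t in I01. \<bar>f t\<bar> = \<bar>g t\<bar>"
  have 1: "AE t in I01. \<bar>g t\<bar> \<le> \<bar>f t\<bar>" "AE t in I01. \<bar>f t\<bar> \<le> \<bar>g t\<bar>"
    using a(3) by auto
  have "g \<in> X" using idealD[OF a(2,1) 1(1)] .
  with norm_mono[OF a(2,1) 1(1)] norm_mono[OF X_L0[OF a(1)] _ 1(2)] show ?thesis by auto
qed

lemma abs_X: "f \<in> X \<Longrightarrow> (\<lambda>t. \<bar>f t\<bar>) \<in> X"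
  and norm_abs: "f \<in> X \<Longrightarrow> N (\<lambda>t. \<bar>f t\<bar>) = N f"
  using norm_cong[of f "\<lambda>t. \<bar>f t\<bar>"] X_L0[of f] by auto

lemma uminus_X: "f \<in> X \<Longrightarrow> (\<lambda>t. - f t) \<in> X"
  and norm_uminus: "f \<in> X \<Longrightarrow> N (\<lambda>t. - f t) = N f"
  using norm_cong[of f "\<lambda>t. - f t"] X_L0[of f] by auto

lemma diff_X: "f \<in> X \<Longrightarrow> g \<in> X \<Longrightarrow> (\<lambda>t. f t - g t) \<in> X"
  using add[OF _ uminus_X, of f g] by simp

lemma norm_diff: "f \<in> X \<Longrightarrow> g \<in> X \<Longrightarrow> N (\<lambda>t. f t - g t) \<le> N f + N g"
  using norm_triangle[OF _ uminus_X, of f g] norm_uminus[of g] by simp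

lemma norm_zero: "N (\<lambda>t. 0) = 0"
  using norm_eq_0_iff[OF zero] by simp

lemma sum_X: "(\<And>i. i \<in> A \<Longrightarrow> f i \<in> X) \<Longrightarrow> (\<lambda>t. \<Sum>i\<in>A. f i t) \<in> X"
  by (induction A rule: infinite_finite_induct) (auto intro!: add zero)

lemma norm_sum: "(\<And>i. i \<in> A \<Longrightarrow> f i \<in> X) \<Longrightarrow> N (\<lambda>t. \<Sum>i\<in>A. f i t) \<le> (\<Sum>i\<in>A. N (f i))"
proof (induction A rule: infinite_finite_induct)
  case (insert a A)
  have "N (\<lambda>t. f a t + (\<Sum>i\<in>A. f i t)) \<le> N (f a) + N (\<lambda>t. \<Sum>i\<in>A. f i t)"
    by (intro norm_triangle sum_X) (use insert in auto)
  also have "\<dots> \<le> N (f a) + (\<Sum>i\<in>A. N (f i))" using insert by auto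
  finally show ?case using insert by simp
qed (auto simp: norm_zero)

lemma norm_triangle_sub: "f \<in> X \<Longrightarrow> g \<in> X \<Longrightarrow> N f \<le> N g + N (\<lambda>t. f t - g t)"
  using norm_triangle[OF _ diff_X, of g f g] by simp

text \<open>The partial sums of absolute values are Cauchy, hence converge in norm to some
  \<open>S\<close>. The positive part of \<open>P n - S\<close> is dominated by
  \<open>|P m - S|\<close> for every \<open>m \<ge> n\<close>, so its norm is zero; the pointwise
  bound thus follows without passing to a subsequence.\<close>

lemma riesz_fischer:
  assumes f: "\<And>n. f n \<in> X" and s: "summable (\<lambda>n. N (f n))"
  shows "\<exists>S\<in>X. \<forall>n. AE t in I01. (\<Sum>i<n. \<bar>f i t\<bar>) \<le> S t"
proof -
  define P where "P n t = (\<Sum>i<n. \<bar>f i t\<bar>)" for n t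
  have PX: "P n \<in> X" for n unfolding P_def by (intro sum_X abs_X f)
  have PL: "P n \<in> L0" for n using X_L0[OF PX] .
  have Pd: "N (\<lambda>t. P m t - P n t) \<le> (\<Sum>i=n..<m. N (f i))" if "n \<le> m" for m n
  proof -
    have eq: "(\<lambda>t. P m t - P n t) = (\<lambda>t. \<Sum>i=n..<m. \<bar>f i t\<bar>)"
      using that by (simp add: P_def fun_eq_iff sum_diff_nat_ivl lessThan_atLeast0)
    have "N (\<lambda>t. \<Sum>i=n..<m. \<bar>f i t\<bar>) \<le> (\<Sum>i=n..<m. N (\<lambda>t. \<bar>f i t\<bar>))"
      by (intro norm_sum abs_X f)
    then show ?thesis unfolding eq norm_abs[OF f] .
  qed
  have cauchy: "\<exists>n0. \<forall>m\<ge>n0. \<forall>n\<ge>n0. N (\<lambda>t. P m t - P n t) < e" if "0 < e" for e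
  proof -
    have "\<exists>n0. \<forall>m\<ge>n0. \<forall>n. norm (\<Sum>i=m..<n. N (f i)) < e"
      using s that unfolding summable_Cauchy by blast
    then obtain n0 where n0: "\<And>m n. n0 \<le> m \<Longrightarrow> norm (\<Sum>i=m..<n. N (f i)) < e"
      by auto
    have "N (\<lambda>t. P m t - P n t) < e" if mn: "n0 \<le> m" "n0 \<le> n" for m n
    proof (cases "n \<le> m")
      case True
      then show ?thesis using Pd[OF True] n0[OF mn(2), of m] by auto
    next
      case False
      have "N (\<lambda>t. P m t - P n t) = N (\<lambda>t. P n t - P m t)"
        using norm_uminus[OF diff_X[OF PX PX], of m n] by simp
      then show ?thesis using Pd[of m n] n0[OF mn(1), of n] False by auto
    qed
    then show ?thesis by blast
  qed
  obtain S where S: "S \<in> X" "(\<lambda>n. N (\<lambda>t. P n t - S t)) \<longlonglongrightarrow> 0"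
    using complete[of P, OF PX cauchy] by blast
  have SL: "S \<in> L0" using X_L0[OF S(1)] .
  have "AE t in I01. P n t \<le> S t" for n
  proof -
    define g where "g t = max 0 (P n t - S t)" for t
    have gL: "g \<in> L0" unfolding g_def using PL SL by measurable
    have "\<bar>g t\<bar> \<le> \<bar>P m t - S t\<bar>" if "n \<le> m" for m t
    proof -
      have "P n t \<le> P m t" unfolding P_def using that by (intro sum_mono2) auto
      then show ?thesis by (auto simp: g_def)
    qed
    then have le: "g \<in> X \<and> N g \<le> N (\<lambda>t. P m t - S t)" if "n \<le> m" for m
      by (intro conjI idealD[OF gL diff_X[OF PX S(1), of m]] norm_mono[OF gL diff_X[OF PX S(1)]])
        (use that in auto)
    have "N g \<le> 0"
      by (rule LIMSEQ_le_const[OF S(2)]) (use le in auto)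
    then have "N g = 0" using le norm_nonneg[of g] by force
    then have "AE t in I01. g t = 0" using norm_eq_0_iff le by blast
    then show ?thesis by eventually_elim (auto simp: g_def split: if_splits)
  qed
  then show ?thesis using S(1) unfolding P_def by blast
qed

text \<open>The decreasing majorants that order convergence asks for are the tail suprema of
  \<open>|F k - l|\<close>; almost everywhere convergence sends them to zero.\<close>

lemma order_convergesI:
  assumes F: "\<And>n. F n \<in> X" and H: "H \<in> X" and dom: "\<And>n. AE t in I01. \<bar>F n t\<bar> \<le> H t"
    and l: "l \<in> L0" and lim: "AE t in I01. (\<lambda>n. F n t) \<longlonglongrightarrow> l t"
  shows "order_converges X F l"
proof -
  have FL: "F n \<in> L0" for n using X_L0[OF F] .
  have HL: "H \<in> L0" using X_L0[OF H] .
  have dom': "AE t in I01. \<forall>n. \<bar>F n t\<bar> \<le> H t" using dom by (simp add: AE_all_countable)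
  have lH: "AE t in I01. \<bar>l t\<bar> \<le> H t"
    using dom' lim
  proof eventually_elim
    case (elim t)
    then show ?case using LIMSEQ_le_const2[OF tendsto_rabs[OF elim(2)]] by auto
  qed
  have lX: "l \<in> X" by (rule idealD[OF l H]) (use lH in eventually_elim, auto)
  \<comment> \<open>The cap changes nothing almost everywhere, and it makes the suprema below
    bounded at every point, so that they are measurable and stay in \<open>X\<close>.\<close>
  define m where "m n t = min \<bar>F n t - l t\<bar> (2 * \<bar>H t\<bar>)" for n t
  define g where "g n t = (SUP k\<in>{n..}. m k t)" for n t
  have bdd: "bdd_above ((\<lambda>k. m k t) ` {n..})" for n t
    unfolding m_def by (rule bdd_aboveI[of _ "2 * \<bar>H t\<bar>"]) auto
  have mL: "m n \<in> L0" for n unfolding m_def using FL l HL by measurable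
  have gL: "g n \<in> L0" for n
    unfolding g_def by (intro borel_measurable_cSUP mL bdd) auto
  have m0: "0 \<le> m n t" for n t by (auto simp: m_def)
  have g0: "0 \<le> g n t" for n t
    unfolding g_def by (rule cSUP_upper2[OF bdd, of n]) (auto simp: m0)
  have g2: "g n t \<le> 2 * \<bar>H t\<bar>" for n t
    unfolding g_def by (rule cSUP_least) (auto simp: m_def)
  have gX: "g n \<in> X" for n
    by (rule idealD[OF gL scale[OF H, of 2]]) (use g0 g2 in \<open>auto simp: abs_mult\<close>)
  have dec: "g (Suc n) t \<le> g n t" for n t
    unfolding g_def by (rule cSUP_subset_mono[OF _ bdd]) auto
  have bound: "AE t in I01. \<bar>F n t - l t\<bar> \<le> g n t" for n
    using dom' lH
  proof eventually_elim
    case (elim t)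
    have "\<bar>F n t\<bar> \<le> H t" using elim by blast
    then have "\<bar>F n t - l t\<bar> \<le> 2 * H t" "H t \<le> \<bar>H t\<bar>" using elim by linarith+
    then have "\<bar>F n t - l t\<bar> \<le> m n t" by (auto simp: m_def)
    also have "\<dots> \<le> g n t" unfolding g_def by (rule cSUP_upper[OF _ bdd]) auto
    finally show ?case .
  qed
  have glim: "AE t in I01. (\<lambda>n. g n t) \<longlonglongrightarrow> 0"
    using lim
  proof eventually_elim
    case (elim t)
    show ?case
    proof (rule LIMSEQ_I)
      fix r :: real assume "0 < r"
      then obtain n0 where n0: "\<And>n. n0 \<le> n \<Longrightarrow> \<bar>F n t - l t\<bar> < r / 2"
        using LIMSEQ_D[OF elim, of "r / 2"] by auto
      have "norm (g n t - 0) < r" if "n0 \<le> n" for n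
      proof -
        have "m k t \<le> r / 2" if "k \<in> {n..}" for k
          using n0[of k] that \<open>n0 \<le> n\<close> unfolding m_def by (intro min.coboundedI1) auto
        then have "g n t \<le> r / 2" unfolding g_def by (intro cSUP_least) auto
        then show ?thesis using g0[of n t] \<open>0 < r\<close> by auto
      qed
      then show "\<exists>no. \<forall>n\<ge>no. norm (g n t - 0) < r" by blast
    qed
  qed
  show ?thesis unfolding order_converges_def
    using F lX gX dec glim bound by (intro conjI exI[of _ g]) auto
qed

text \<open>Equivalent to order convergence to zero.\<close>

definition order_null :: "(nat \<Rightarrow> real \<Rightarrow> real) \<Rightarrow> bool" where
  "order_null F \<longleftrightarrow> (\<forall>n. F n \<in> X) \<and> (\<exists>H\<in>X. \<forall>n. AE t in I01. \<bar>F n t\<bar> \<le> H t) \<and>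
     (AE t in I01. (\<lambda>n. F n t) \<longlonglongrightarrow> 0)"

lemma order_null_add:
  assumes "order_null F" "order_null G"
  shows "order_null (\<lambda>n t. F n t + G n t)"
proof -
  obtain H H' where H: "H \<in> X" "\<And>n. AE t in I01. \<bar>F n t\<bar> \<le> H t"
    "H' \<in> X" "\<And>n. AE t in I01. \<bar>G n t\<bar> \<le> H' t"
    using assms unfolding order_null_def by blast
  have "AE t in I01. \<bar>F n t + G n t\<bar> \<le> H t + H' t" for n
    using H(2)[of n] H(4)[of n] by eventually_elim auto
  moreover have "AE t in I01. (\<lambda>n. F n t + G n t) \<longlonglongrightarrow> 0"
  proof -
    have "AE t in I01. (\<lambda>n. F n t) \<longlonglongrightarrow> 0" "AE t in I01. (\<lambda>n. G n t) \<longlonglongrightarrow> 0"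
      using assms by (auto simp: order_null_def)
    then show ?thesis by eventually_elim (use tendsto_add_zero in blast)
  qed
  moreover have "\<forall>n. (\<lambda>t. F n t + G n t) \<in> X"
    using assms by (auto simp: order_null_def intro!: add)
  ultimately show ?thesis unfolding order_null_def
    by (intro conjI bexI[OF _ add[OF H(1,3)]] allI) auto
qed

lemma order_converges_order_null_add:
  assumes F: "order_null F" and l: "l \<in> X"
  shows "order_converges X (\<lambda>n t. c * F n t + l t) l"
proof -
  obtain H where H: "H \<in> X" "\<And>n. AE t in I01. \<bar>F n t\<bar> \<le> H t"
    using F unfolding order_null_def by blast
  show ?thesis
  proof (rule order_convergesI[of _ "\<lambda>t. \<bar>c\<bar> * H t + \<bar>l t\<bar>"])
    show "AE t in I01. \<bar>c * F n t + l t\<bar> \<le> \<bar>c\<bar> * H t + \<bar>l t\<bar>" for n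
      using H(2)[of n]
    proof eventually_elim
      case (elim t)
      then have "\<bar>c\<bar> * \<bar>F n t\<bar> \<le> \<bar>c\<bar> * H t" by (intro mult_left_mono) auto
      then show ?case using abs_triangle_ineq[of "c * F n t" "l t"] by (simp add: abs_mult)
    qed
    have "AE t in I01. (\<lambda>n. F n t) \<longlonglongrightarrow> 0" using F by (auto simp: order_null_def)
    then show "AE t in I01. (\<lambda>n. c * F n t + l t) \<longlonglongrightarrow> l t"
      by eventually_elim (auto intro!: tendsto_eq_intros)
  qed (use F H l in \<open>auto simp: order_null_def intro!: add scale abs_X X_L0\<close>)
qed

lemma cesaro_X: "(\<And>n. f n \<in> X) \<Longrightarrow> cesaro f m \<in> X"
  using scale[OF sum_X[of "{..m}" f], of "1 / real (Suc m)"]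
  by (simp add: cesaro_def[abs_def] field_simps)

text \<open>The majorant \<open>S\<close> of the partial sums of absolute values bounds the
  \<open>n\<close>-th mean by \<open>S / (n + 1)\<close>, which gives domination and convergence
  together.\<close>

lemma order_null_cesaro_summable:
  assumes f: "\<And>n. f n \<in> X" and s: "summable (\<lambda>n. N (f n))"
  shows "order_null (cesaro f)"
proof -
  obtain S where S: "S \<in> X" "\<And>n. AE t in I01. (\<Sum>i<n. \<bar>f i t\<bar>) \<le> S t"
    using riesz_fischer[OF assms] by blast
  have S': "AE t in I01. \<forall>n. (\<Sum>i<n. \<bar>f i t\<bar>) \<le> S t" using S(2) by (simp add: AE_all_countable)
  have b: "AE t in I01. \<forall>n. \<bar>cesaro f n t\<bar> \<le> S t / real (Suc n)"
    using S'
  proof eventually_elim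
    case (elim t)
    show ?case
    proof
      fix n
      have "\<bar>\<Sum>i\<le>n. f i t\<bar> \<le> (\<Sum>i<Suc n. \<bar>f i t\<bar>)"
        unfolding lessThan_Suc_atMost by (rule sum_abs)
      also have "\<dots> \<le> S t" using elim by blast
      finally show "\<bar>cesaro f n t\<bar> \<le> S t / real (Suc n)"
        by (simp add: cesaro_def abs_divide divide_right_mono)
    qed
  qed
  have "AE t in I01. \<bar>cesaro f n t\<bar> \<le> S t" for n
    using b
  proof eventually_elim
    case (elim t)
    have "\<bar>cesaro f 0 t\<bar> \<le> S t / real (Suc 0)" using elim by blast
    then have "0 \<le> S t" by simp
    then have "S t / real (Suc n) \<le> S t" by (simp add: field_simps)
    then show ?case using elim by (metis order_trans)
  qed
  moreover have "AE t in I01. (\<lambda>n. cesaro f n t) \<longlonglongrightarrow> 0"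
    using b
  proof eventually_elim
    case (elim t)
    have "(\<lambda>n. S t / real (Suc n)) \<longlonglongrightarrow> 0"
      using LIMSEQ_Suc[OF lim_const_over_n[of "S t"]] by simp
    then show ?case by (rule Lim_null_comparison[rotated]) (use elim in auto)
  qed
  ultimately show ?thesis unfolding order_null_def
    by (intro conjI bexI[OF _ S(1)] allI cesaro_X f) auto
qed

end

section \<open>Distribution functions and rearrangement invariant spaces\<close>

lemma space_I01 [simp]: "space I01 = {0..1}"
  by (simp add: space_restrict_space)

lemma sets_I01_iff: "A \<in> sets I01 \<longleftrightarrow> A \<in> sets lebesgue \<and> A \<subseteq> {0..1}"
  by (subst sets_restrict_space_iff) auto

lemma measure_I01: "A \<subseteq> {0..1} \<Longrightarrow> measure I01 A = measure lebesgue A"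
  by (rule measure_restrict_space) auto

interpretation I01: finite_measure I01
  by (rule finite_measure_lebesgue_on) auto

lemma measure_I01_space [simp]: "measure I01 {0..1} = 1"
  by (simp add: measure_I01)

lemma measure_Ioo_I01: "measure I01 ({0<..<d} \<inter> {0..1}) = max 0 (min 1 d)"
proof (cases "d \<le> 1")
  case True
  then have "{0<..<d} \<inter> {0..1} = {0<..<d}" by auto
  then show ?thesis using True by (subst measure_I01) (auto simp: max_def)
next
  case False
  then have "{0<..<d} \<inter> {0..1} = {0<..1}" by auto
  then show ?thesis using False by (subst measure_I01) auto
qed

section \<open>Distribution functions and quantiles\<close>

definition dist_fn :: "(real \<Rightarrow> real) \<Rightarrow> real \<Rightarrow> real" where
  "dist_fn f c = measure I01 {x \<in> {0..1}. c < \<bar>f x\<bar>}"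

lemma dist_fn_sets: "f \<in> L0 \<Longrightarrow> {x \<in> {0..1}. c < \<bar>f x\<bar>} \<in> sets I01"
proof -
  assume "f \<in> L0"
  then have "{x \<in> space I01. c < \<bar>f x\<bar>} \<in> sets I01" by measurable
  then show ?thesis by simp
qed

lemma dist_fn_nonneg: "0 \<le> dist_fn f c"
  and dist_fn_le_1: "dist_fn f c \<le> 1"
  using I01.bounded_measure[of "{x \<in> {0..1}. c < \<bar>f x\<bar>}"] by (auto simp: dist_fn_def)

lemma dist_fn_antimono: "f \<in> L0 \<Longrightarrow> c \<le> d \<Longrightarrow> dist_fn f d \<le> dist_fn f c"
  unfolding dist_fn_def by (intro I01.finite_measure_mono dist_fn_sets) auto

lemma dist_fn_tendsto_0:
  assumes "f \<in> L0" shows "(\<lambda>n. dist_fn f (real n)) \<longlonglongrightarrow> 0"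
proof -
  have "(\<lambda>n. measure I01 {x \<in> {0..1}. real n < \<bar>f x\<bar>}) \<longlonglongrightarrow> measure I01 (\<Inter>n. {x \<in> {0..1}. real n < \<bar>f x\<bar>})"
    by (rule I01.finite_Lim_measure_decseq) (use dist_fn_sets[OF assms] in \<open>auto simp del: atLeastAtMost_iff simp: decseq_def\<close>)
  moreover have "(\<Inter>n. {x \<in> {0..1}. real n < \<bar>f x\<bar>}) = {}"
    by auto (meson not_less reals_Archimedean2 order_less_asym)
  ultimately show ?thesis unfolding dist_fn_def by simp
qed

lemma dist_fn_right_cont:
  assumes "f \<in> L0" shows "(\<lambda>n. dist_fn f (c + 1 / real (Suc n))) \<longlonglongrightarrow> dist_fn f c"
proof -
  let ?A = "\<lambda>n. {x \<in> {0..1}. c + 1 / real (Suc n) < \<bar>f x\<bar>}"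
  have "(\<lambda>n. measure I01 (?A n)) \<longlonglongrightarrow> measure I01 (\<Union>n. ?A n)"
  proof (rule I01.finite_Lim_measure_incseq)
    show "incseq ?A"
    proof (rule incseq_SucI, rule subsetI)
      fix n x assume "x \<in> ?A n"
      moreover have "1 / real (Suc (Suc n)) \<le> 1 / real (Suc n)" by (simp add: field_simps)
      ultimately show "x \<in> ?A (Suc n)" by auto
    qed
  qed (use dist_fn_sets[OF assms] in \<open>auto simp del: atLeastAtMost_iff of_nat_Suc\<close>)
  moreover have "(\<Union>n. ?A n) = {x \<in> {0..1}. c < \<bar>f x\<bar>}"
  proof (intro equalityI subsetI)
    fix x assume x: "x \<in> {x \<in> {0..1}. c < \<bar>f x\<bar>}"
    then obtain n where "1 / real (Suc n) < \<bar>f x\<bar> - c"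
      using reals_Archimedean[of "\<bar>f x\<bar> - c"] by (auto simp: inverse_eq_divide)
    then show "x \<in> (\<Union>n. ?A n)" using x by (auto intro!: exI[of _ n])
  next
    fix x assume "x \<in> (\<Union>n. ?A n)"
    then obtain n where n: "x \<in> {0..1}" "c + 1 / real (Suc n) < \<bar>f x\<bar>" by auto
    moreover have "0 < 1 / real (Suc n)" by simp
    ultimately have "c < \<bar>f x\<bar>" by linarith
    then show "x \<in> {x \<in> {0..1}. c < \<bar>f x\<bar>}" using n by auto
  qed
  ultimately show ?thesis unfolding dist_fn_def by simp
qed

text \<open>The rearrangement is the generalized inverse of the distribution function. Right
  continuity makes the infimum attained, and \<open>0 < t\<close> makes the set of levels nonempty
  because \<open>dist_fn f\<close> tends to zero at infinity.\<close>

lemma decr_rearrangement_le_iff: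
  assumes f: "f \<in> L0" and t: "0 < t" and c: "0 \<le> c"
  shows "decr_rearrangement f t \<le> c \<longleftrightarrow> dist_fn f c \<le> t"
proof -
  define S where "S = {c. 0 \<le> c \<and> dist_fn f c \<le> t}"
  have D: "decr_rearrangement f t = Inf S" by (simp add: decr_rearrangement_def S_def dist_fn_def)
  have bdd: "bdd_below S" by (rule bdd_belowI[of _ 0]) (auto simp: S_def)
  have ne: "S \<noteq> {}"
  proof -
    have "\<forall>\<^sub>F n in sequentially. dist_fn f (real n) < t"
      using order_tendstoD(2)[OF dist_fn_tendsto_0[OF f] t] .
    then obtain n where "dist_fn f (real n) < t" by (auto simp: eventually_sequentially)
    then have "real n \<in> S" unfolding S_def mem_Collect_eq by (intro conjI) auto
    then show ?thesis by blast
  qed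
  show ?thesis
  proof
    assume "dist_fn f c \<le> t"
    then show "decr_rearrangement f t \<le> c" unfolding D using bdd c
      by (intro cInf_lower) (auto simp: S_def)
  next
    assume le: "decr_rearrangement f t \<le> c"
    have "dist_fn f (c + 1 / real (Suc n)) \<le> t" for n
    proof -
      have "0 < 1 / real (Suc n)" by simp
      then have "Inf S < c + 1 / real (Suc n)" using le unfolding D by linarith
      then obtain c' where c': "c' \<in> S" "c' < c + 1 / real (Suc n)"
        using cInf_lessD[OF ne] by blast
      then show ?thesis using dist_fn_antimono[OF f, of c' "c + 1 / real (Suc n)"]
        by (auto simp: S_def)
    qed
    then show "dist_fn f c \<le> t"
      by (intro LIMSEQ_le_const2[OF dist_fn_right_cont[OF f]]) auto
  qed
qed

lemma decr_rearrangement_nonneg: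
  assumes f: "f \<in> L0" and t: "0 < t" shows "0 \<le> decr_rearrangement f t"
proof -
  define S where "S = {c. 0 \<le> c \<and> dist_fn f c \<le> t}"
  have D: "decr_rearrangement f t = Inf S" by (simp add: decr_rearrangement_def S_def dist_fn_def)
  have "\<forall>\<^sub>F n in sequentially. dist_fn f (real n) < t"
    using order_tendstoD(2)[OF dist_fn_tendsto_0[OF f] t] .
  then obtain n where "dist_fn f (real n) < t" by (auto simp: eventually_sequentially)
  then have "real n \<in> S" by (auto simp: S_def)
  then have "S \<noteq> {}" by blast
  then show ?thesis unfolding D by (rule cInf_greatest) (auto simp: S_def)
qed

text \<open>At \<open>t = 0\<close> an essentially unbounded function leaves no admissible level, so
  the infimum says nothing there. The value zero keeps the function nonnegative without changing its
  distribution.\<close>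

definition quantile :: "(real \<Rightarrow> real) \<Rightarrow> real \<Rightarrow> real" where
  "quantile f t = (if 0 < t then decr_rearrangement f t else 0)"

lemma quantile_nonneg: "f \<in> L0 \<Longrightarrow> 0 \<le> quantile f t"
  by (auto simp: quantile_def decr_rearrangement_nonneg)

lemma quantile_level:
  assumes f: "f \<in> L0" and c: "0 \<le> c"
  shows "{x \<in> {0..1}. c < quantile f x} = {0<..<dist_fn f c} \<inter> {0..1}"
  using decr_rearrangement_le_iff[OF f _ c] c by (auto simp: quantile_def not_le[symmetric] split: if_splits)

lemma quantile_L0: assumes f: "f \<in> L0" shows "quantile f \<in> L0"
proof (rule borel_measurable_iff_greater[THEN iffD2], rule allI)
  fix c :: real
  have "{x \<in> {0..1}. c < quantile f x} \<in> sets I01"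
  proof (cases "0 \<le> c")
    case True
    then show ?thesis unfolding quantile_level[OF f True] by (auto simp: sets_I01_iff)
  next
    case False
    then have "{x \<in> {0..1}. c < quantile f x} = {0..1}"
      using quantile_nonneg[OF f] by (smt (verit, best) Collect_cong Collect_mem_eq)
    then show ?thesis by (auto simp: sets_I01_iff)
  qed
  then show "{w \<in> space I01. c < quantile f w} \<in> sets I01" by simp
qed

lemma dist_fn_quantile:
  assumes f: "f \<in> L0" and c: "0 \<le> c"
  shows "dist_fn (quantile f) c = dist_fn f c"
  unfolding dist_fn_def[of "quantile f"] abs_of_nonneg[OF quantile_nonneg[OF f]] quantile_level[OF f c]
  using measure_Ioo_I01[of "dist_fn f c"] dist_fn_nonneg[of f c] dist_fn_le_1[of f c] by simp

text \<open>Two functions compressed onto the two halves of the interval: their distribution functions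
  are averaged, which replaces the dilation by the factor two.\<close>

definition halves :: "(real \<Rightarrow> real) \<Rightarrow> (real \<Rightarrow> real) \<Rightarrow> real \<Rightarrow> real" where
  "halves f g t = (if t < 1 / 2 then f (2 * t) else g (2 * t - 1))"

lemma lebesgue_affine: 
  fixes m d :: real assumes "m \<noteq> 0" 
  shows "(\<lambda>x. m * x + d) \<in> lebesgue \<rightarrow>\<^sub>M lebesgue"
  using lebesgue_affine_measurable[where c="\<lambda>x::real. m" and t=d] assms
  by (simp add: add.commute[of d])

lemma L0_affine:
  assumes f: "f \<in> L0" and m: "m \<noteq> 0" and P: "\<And>x. P x \<Longrightarrow> m * x + d \<in> {0..1}" "{x. P x} \<in> sets lebesgue"
  shows "(\<lambda>x. if P x then f (m * x + d) else 0) \<in> borel_measurable lebesgue"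
proof -
  have "(\<lambda>x. if x \<in> {0..1} then f x else 0) \<in> borel_measurable lebesgue"
    by (rule borel_measurable_if_I[OF f]) auto
  from measurable_compose[OF lebesgue_affine[OF m, of d] this]
  have "(\<lambda>x. if m * x + d \<in> {0..1} then f (m * x + d) else 0) \<in> borel_measurable lebesgue" .
  moreover have "Measurable.pred lebesgue P" using P(2) by (simp add: pred_def)
  ultimately have "(\<lambda>x. if P x then (if m * x + d \<in> {0..1} then f (m * x + d) else 0) else 0) \<in> borel_measurable lebesgue"
    by measurable
  also have "(\<lambda>x. if P x then (if m * x + d \<in> {0..1} then f (m * x + d) else 0) else 0) = (\<lambda>x. if P x then f (m * x + d) else 0)"
    using P(1) by auto
  finally show ?thesis .
qed

lemma lebesgue_imp_L0: "f \<in> borel_measurable lebesgue \<Longrightarrow> f \<in> L0"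
  by (rule measurable_restrict_space1)

lemma L0_cong: "f \<in> L0 \<Longrightarrow> (\<And>t. 0 \<le> t \<Longrightarrow> t \<le> 1 \<Longrightarrow> f t = g t) \<Longrightarrow> g \<in> L0"
  by (subst measurable_cong[of _ g f]) auto

lemma halves_L0: assumes f: "f \<in> L0" and g: "g \<in> L0" shows "halves f g \<in> L0"
proof -
  have 1: "(\<lambda>x. if 0 \<le> x \<and> x < 1/2 then f (2 * x + 0) else 0) \<in> borel_measurable lebesgue"
    by (rule L0_affine[OF f]) auto
  have 2: "(\<lambda>x. if 1/2 \<le> x \<and> x \<le> 1 then g (2 * x + (-1)) else 0) \<in> borel_measurable lebesgue"
    by (rule L0_affine[OF g]) auto
  show ?thesis
    by (rule L0_cong[OF borel_measurable_add[OF lebesgue_imp_L0[OF 1] lebesgue_imp_L0[OF 2]]])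
      (auto simp: halves_def)
qed

lemma measure_affine_I01:
  assumes A: "A \<in> sets I01" and m: "0 < m" and d: "0 \<le> d" "m + d \<le> 1"
  shows "(\<lambda>x. m * x + d) ` A \<in> sets I01" "measure I01 ((\<lambda>x. m * x + d) ` A) = m * measure I01 A"
proof -
  have A': "A \<subseteq> {0..1}" "A \<in> sets lebesgue" using A by (auto simp: sets_I01_iff)
  have sub: "(\<lambda>x. m * x + d) ` A \<subseteq> {0..1}"
  proof
    fix y assume "y \<in> (\<lambda>x. m * x + d) ` A"
    then obtain x where x: "0 \<le> x" "x \<le> 1" "y = m * x + d" using A' by force
    have "m * x \<le> m * 1" using x m by (intro mult_left_mono) auto
    moreover have "0 \<le> m * x" using x m by simp
    ultimately show "y \<in> {0..1}" using x d by auto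
  qed
  have eq: "(\<lambda>x. m * x + d) ` A = (\<lambda>x. (1/m) * x + (- d / m)) -` A \<inter> space lebesgue"
  proof (intro equalityI subsetI)
    fix x assume "x \<in> (\<lambda>x. (1/m) * x + (- d / m)) -` A \<inter> space lebesgue"
    then show "x \<in> (\<lambda>x. m * x + d) ` A"
      by (intro image_eqI[of _ _ "(1/m) * x + (- d / m)"]) (use m in \<open>auto simp: field_simps\<close>)
  qed (use m in \<open>auto simp: field_simps\<close>)
  show "(\<lambda>x. m * x + d) ` A \<in> sets I01"
    unfolding sets_I01_iff using sub eq measurable_sets[OF lebesgue_affine A'(2), of "1/m" "-d/m"] m by auto
  show "measure I01 ((\<lambda>x. m * x + d) ` A) = m * measure I01 A"
    unfolding measure_I01[OF sub] measure_I01[OF A'(1)]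
    using measure_lebesgue_affine[of m d A] m by (simp add: add.commute)
qed

lemma dist_fn_halves:
  assumes f: "f \<in> L0" and g: "g \<in> L0"
  shows "dist_fn (halves f g) c = (dist_fn f c + dist_fn g c) / 2"
proof -
  let ?A = "{x \<in> {0..1}. c < \<bar>f x\<bar>}" and ?B = "{x \<in> {0..1}. c < \<bar>g x\<bar>}"
  let ?C = "{x \<in> {0..1}. c < \<bar>halves f g x\<bar>}"
  note A = measure_affine_I01[OF dist_fn_sets[OF f, of c], of "1/2" 0, simplified]
  note B = measure_affine_I01[OF dist_fn_sets[OF g, of c], of "1/2" "1/2", simplified]
  let ?A' = "(\<lambda>x. x / 2) ` ?A" and ?B' = "(\<lambda>x. x / 2 + 1 / 2) ` ?B"
  have half: "{1/2} \<in> sets I01" by (auto simp: sets_I01_iff)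
  \<comment> \<open>The compressed copies can meet only at \<open>1 / 2\<close>, the image of 1 from
    the left half and of 0 from the right half.\<close>
  have AE0: "AE x in I01. x \<noteq> 1/2"
  proof (rule AE_I'[of "{1/2}"])
    show "{1/2} \<in> null_sets I01" 
      by (subst null_sets_restrict_space) auto
  qed auto
  have eq: "x \<in> ?C \<longleftrightarrow> x \<in> ?A' \<union> ?B'" if "x \<noteq> 1/2" for x
  proof (cases "x < 1/2")
    case True
    have "x \<in> ?A' \<longleftrightarrow> 2 * x \<in> ?A" by (auto simp: image_iff mult.commute intro!: bexI[of _ "2*x"])
    then show ?thesis using True by (auto simp: halves_def)
  next
    case False
    have "x \<in> ?B' \<longleftrightarrow> 2 * x - 1 \<in> ?B" 
    proof
      assume "x \<in> ?B'"
      then obtain y where "y \<in> ?B" "x = y / 2 + 1 / 2" by blast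
      then show "2 * x - 1 \<in> ?B" by (simp add: field_simps)
    next
      assume "2 * x - 1 \<in> ?B"
      then show "x \<in> ?B'" by (rule rev_image_eqI) (simp add: field_simps)
    qed
    moreover have "x \<notin> ?A'" using False that by auto
    ultimately show ?thesis using False that by (auto simp: halves_def)
  qed
  have "measure I01 ?C = measure I01 (?A' \<union> ?B')"
    by (rule I01.finite_measure_eq_AE) (use AE0 eq A B dist_fn_sets[OF halves_L0[OF f g]] in \<open>auto elim!: eventually_mono\<close>)
  also have "\<dots> = measure I01 ((?A' - {1/2}) \<union> ?B')"
    by (rule I01.finite_measure_eq_AE) (use AE0 A B half in \<open>auto elim!: eventually_mono\<close>)
  also have "\<dots> = measure I01 (?A' - {1/2}) + measure I01 ?B'"
    by (rule I01.finite_measure_Union) (use A B half in auto)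
  also have "measure I01 (?A' - {1/2}) = measure I01 ?A'"
    by (rule I01.finite_measure_eq_AE) (use AE0 A half in \<open>auto elim!: eventually_mono\<close>)
  finally show ?thesis unfolding dist_fn_def using A(2) B(2) by (simp add: field_simps)
qed

section \<open>Dilations and indicators\<close>

lemma dilation_L0: 
  assumes s: "0 < s" "s \<le> 1" and f: "f \<in> L0" shows "dilation s f \<in> L0"
proof -
  have 1: "(\<lambda>x. if 0 \<le> x \<and> x \<le> s then f ((1/s) * x + 0) else 0) \<in> borel_measurable lebesgue"
    by (rule L0_affine[OF f]) (use s in auto)
  show ?thesis
    by (rule L0_cong[OF lebesgue_imp_L0[OF 1]]) (use s in \<open>auto simp: dilation_def min_def\<close>)
qed

lemma dist_fn_dilation:
  assumes s: "0 < s" "s \<le> 1" and f: "f \<in> L0" and c: "0 \<le> c"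
  shows "dist_fn (dilation s f) c = s * dist_fn f c"
proof -
  have "{x \<in> {0..1}. c < \<bar>dilation s f x\<bar>} = (\<lambda>x. s * x + 0) ` {x \<in> {0..1}. c < \<bar>f x\<bar>}"
  proof (intro equalityI subsetI)
    fix x assume "x \<in> {x \<in> {0..1}. c < \<bar>dilation s f x\<bar>}"
    then have "x / s \<in> {x \<in> {0..1}. c < \<bar>f x\<bar>}" using s c by (auto simp: dilation_def split: if_splits)
    then show "x \<in> (\<lambda>x. s * x + 0) ` {x \<in> {0..1}. c < \<bar>f x\<bar>}" 
      by (rule rev_image_eqI) (use s in auto)
  next
    fix x assume "x \<in> (\<lambda>x. s * x + 0) ` {x \<in> {0..1}. c < \<bar>f x\<bar>}"
    then obtain y where "0 \<le> y" "y \<le> 1" "c < \<bar>f y\<bar>" "x = s * y" by auto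
    moreover have "s * y \<le> s * 1" using s \<open>y \<le> 1\<close> by (intro mult_left_mono) auto
    moreover have "s * y \<le> 1" using calculation s by linarith
    ultimately show "x \<in> {x \<in> {0..1}. c < \<bar>dilation s f x\<bar>}" using s
      by (auto simp: dilation_def min_def)
  qed
  then show ?thesis unfolding dist_fn_def using measure_affine_I01(2)[OF dist_fn_sets[OF f], of s 0 c] s by simp
qed

lemma dilation_dilation:
  assumes "0 < s" "s \<le> 1" "0 < r" "r \<le> 1" "0 \<le> t"
  shows "dilation s (dilation r f) t = dilation (s * r) f t"
proof -
  have "t \<le> s * r \<Longrightarrow> t \<le> s" using mult_left_le[of r s] assms by linarith
  moreover have "s * r \<le> 1" using mult_left_le[of r s] assms by linarith
  ultimately show ?thesis using assms by (auto simp: dilation_def min_def field_simps)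
qed

lemma dist_fn_indicator:
  "0 < c \<Longrightarrow> A \<subseteq> {0..1} \<Longrightarrow> dist_fn (indicator A) c = (if c < 1 then measure I01 A else 0)"
proof -
  assume c: "0 < c" "A \<subseteq> {0..1}"
  have "{x \<in> {0..1}. c < \<bar>indicator A x :: real\<bar>} = (if c < 1 then A else {})"
    using c by (auto simp: indicator_def)
  then show ?thesis unfolding dist_fn_def by auto
qed

lemma dist_fn_scale: "0 < m \<Longrightarrow> dist_fn (\<lambda>t. m * f t) c = dist_fn f (c / m)"
  unfolding dist_fn_def by (simp add: abs_mult field_simps)

section \<open>Norm comparison through distribution functions\<close>

context ri_space
begin

lemma quantile_X: assumes f: "f \<in> X" shows "quantile f \<in> X" "N (quantile f) = N f"
proof -
  have fL: "f \<in> L0" using X_L0[OF f] .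
  have "decr_rearrangement (quantile f) t = decr_rearrangement f t" for t
    unfolding decr_rearrangement_def dist_fn_def[symmetric]
    by (rule arg_cong[of _ _ Inf]) (use dist_fn_quantile[OF fL] in auto)
  then show "quantile f \<in> X" "N (quantile f) = N f"
    using rearrangement_invariant[OF quantile_L0[OF fL] f] by auto
qed

text \<open>A smaller distribution function means a pointwise smaller quantile function. The ideal
  property compares the quantile functions, and rearrangement invariance carries the comparison back
  to \<open>f\<close> and \<open>g\<close>.\<close>

lemma norm_le_dist:
  assumes f: "f \<in> X" and g: "g \<in> L0" and le: "\<And>c. 0 < c \<Longrightarrow> dist_fn g c \<le> dist_fn f c"
  shows "g \<in> X" "N g \<le> N f"
proof -
  have fL: "f \<in> L0" using X_L0[OF f] .
  have "quantile g t \<le> quantile f t" for t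
  proof (cases "0 < t")
    case True
    show ?thesis
    proof (rule dense_ge)
      fix c assume c: "quantile f t < c"
      then have c0: "0 < c" using quantile_nonneg[OF fL, of t] by linarith
      have "dist_fn f c \<le> t"
        using decr_rearrangement_le_iff[OF fL True, of c] c c0 True by (auto simp: quantile_def)
      then have "dist_fn g c \<le> t" using le[OF c0] by linarith
      then show "quantile g t \<le> c"
        using decr_rearrangement_le_iff[OF g True, of c] c0 True by (auto simp: quantile_def)
    qed
  qed (auto simp: quantile_def)
  then have le': "AE t in I01. \<bar>quantile g t\<bar> \<le> \<bar>quantile f t\<bar>"
    using quantile_nonneg[OF fL] quantile_nonneg[OF g] by auto
  have qg: "quantile g \<in> X" "N (quantile g) \<le> N f"
    using idealD[OF quantile_L0[OF g] quantile_X(1)[OF f] le']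
      norm_mono[OF quantile_L0[OF g] quantile_X(1)[OF f] le'] quantile_X(2)[OF f] by auto
  have "decr_rearrangement g t = decr_rearrangement (quantile g) t" for t
    unfolding decr_rearrangement_def dist_fn_def[symmetric]
    by (rule arg_cong[of _ _ Inf]) (use dist_fn_quantile[OF g] in auto)
  then have "g \<in> X \<and> N g = N (quantile g)"
    using rearrangement_invariant[OF g qg(1)] by auto
  then show "g \<in> X" "N g \<le> N f" using qg by auto
qed

lemma norm_eq_dist:
  assumes "f \<in> X" "g \<in> L0" "\<And>c. 0 < c \<Longrightarrow> dist_fn g c = dist_fn f c"
  shows "g \<in> X" "N g = N f"
proof -
  show g: "g \<in> X" by (rule norm_le_dist(1)[OF assms(1,2)]) (use assms in auto)
  show "N g = N f"
    using norm_le_dist(2)[OF assms(1,2)] norm_le_dist(2)[OF g X_L0[OF assms(1)]] assms(3)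
    by (intro antisym) auto
qed

lemma halves_zero:
  assumes f: "f \<in> X"
  shows "halves f (\<lambda>t. 0) \<in> X" "halves (\<lambda>t. 0) f \<in> X"
    "N (halves (\<lambda>t. 0) f) = N (halves f (\<lambda>t. 0))" "N (halves f (\<lambda>t. 0)) \<le> N f"
proof -
  have fL: "f \<in> L0" "(\<lambda>t. 0) \<in> L0" using X_L0[OF f] by auto
  have d: "dist_fn (halves f (\<lambda>t. 0)) c \<le> dist_fn f c" if "0 < c" for c
    unfolding dist_fn_halves[OF fL] using that dist_fn_nonneg[of f c] by (simp add: dist_fn_def[of "\<lambda>t. 0"])
  show 1: "halves f (\<lambda>t. 0) \<in> X" and "N (halves f (\<lambda>t. 0)) \<le> N f"
    using norm_le_dist[OF f halves_L0[OF fL] d] by auto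
  show "halves (\<lambda>t. 0) f \<in> X" "N (halves (\<lambda>t. 0) f) = N (halves f (\<lambda>t. 0))"
    using norm_eq_dist[OF 1 halves_L0[OF fL(2,1)]] by (auto simp: dist_fn_halves fL)
qed

lemma halves_split: "halves f g = (\<lambda>t. halves f (\<lambda>t. 0) t + halves (\<lambda>t. 0) g t)"
  by (auto simp: halves_def fun_eq_iff)

lemma halves_X: "f \<in> X \<Longrightarrow> g \<in> X \<Longrightarrow> halves f g \<in> X"
  unfolding halves_split[of f g] by (intro add halves_zero)

lemma norm_halves: "f \<in> X \<Longrightarrow> g \<in> X \<Longrightarrow> N (halves f g) \<le> N f + N g"
  unfolding halves_split[of f g]
  using norm_triangle[OF halves_zero(1,2), of f g] halves_zero(3,4)[of f] halves_zero(3,4)[of g] by simp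

text \<open>\<open>halves f f\<close> has the distribution of \<open>f\<close> and is a sum of two
  functions distributed like \<open>halves f (\<lambda>t. 0)\<close>. Undoing a compression thus
  costs a factor of at most two.\<close>

lemma halves_zero_imp_X:
  assumes f: "f \<in> L0" and h: "halves f (\<lambda>t. 0) \<in> X"
  shows "f \<in> X" "N f \<le> 2 * N (halves f (\<lambda>t. 0))"
proof -
  have 0: "(\<lambda>t. 0) \<in> L0" by auto
  have h': "halves (\<lambda>t. 0) f \<in> X" "N (halves (\<lambda>t. 0) f) = N (halves f (\<lambda>t. 0))"
    using norm_eq_dist[OF h halves_L0[OF 0 f]] by (auto simp: dist_fn_halves f)
  have hh: "halves f f \<in> X" "N (halves f f) \<le> 2 * N (halves f (\<lambda>t. 0))"
    unfolding halves_split[of f f] using add[OF h h'(1)] norm_triangle[OF h h'(1)] h'(2) by auto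
  show "f \<in> X" "N f \<le> 2 * N (halves f (\<lambda>t. 0))"
    using norm_eq_dist[OF hh(1) f] hh(2) by (auto simp: dist_fn_halves f)
qed

text \<open>A nonzero function has a level set of positive measure, whose indicator lies in
  \<open>X\<close> by the ideal property. Halving the constant one often enough brings its
  distribution below that of the indicator, and \<open>halves_zero_imp_X\<close> undoes the halvings
  one at a time.\<close>

lemma one_X: "(\<lambda>t. 1) \<in> X"
proof -
  obtain f where f: "f \<in> X" "\<not> f =\<^sub>a (\<lambda>t. 0)" using nontrivial by blast
  have fL: "f \<in> L0" using X_L0[OF f(1)] .
  have "\<exists>c>0. 0 < dist_fn f c"
  proof (rule ccontr)
    assume "\<not> (\<exists>c>0. 0 < dist_fn f c)"
    then have z: "dist_fn f c = 0" if "0 < c" for c using dist_fn_nonneg[of f c] that by force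
    have "dist_fn f 0 = 0"
      by (rule LIMSEQ_unique[OF dist_fn_right_cont[OF fL]]) (simp add: z)
    then have "{x \<in> {0..1}. 0 < \<bar>f x\<bar>} \<in> null_sets I01"
      unfolding dist_fn_def by (intro null_setsI dist_fn_sets[OF fL]) (simp add: I01.emeasure_eq_measure)
    then have "AE x in I01. \<not> (0 < \<bar>f x\<bar>)"
      by (intro AE_I'[of "{x \<in> {0..1}. 0 < \<bar>f x\<bar>}"]) auto
    then show False using f(2) by auto
  qed
  then obtain c where c: "0 < c" "0 < dist_fn f c" by blast
  let ?A = "{x \<in> {0..1}. c < \<bar>f x\<bar>}"
  have AX: "indicator ?A \<in> X"
  proof (rule idealD[OF _ scale[OF f(1), of "1 / c"]])
    show "indicator ?A \<in> L0" using dist_fn_sets[OF fL] by simp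
    show "AE t in I01. \<bar>indicator ?A t\<bar> \<le> \<bar>1 / c * f t\<bar>"
      using c by (intro AE_I2) (auto simp: indicator_def abs_mult)
  qed
  define b where "b n = ((\<lambda>f. halves f (\<lambda>t. 0)) ^^ n) (\<lambda>t. 1)" for n
  have bL: "b n \<in> L0" for n unfolding b_def by (induction n) (auto intro: halves_L0)
  have bd: "dist_fn (b n) r = (if r < 1 then 1 / 2 ^ n else 0)" if "0 < r" for n r
  proof (induction n)
    case 0
    show ?case using that by (simp del: atLeastAtMost_iff add: b_def dist_fn_def)
  next
    case (Suc n)
    have "dist_fn (b (Suc n)) r = dist_fn (halves (b n) (\<lambda>t. 0)) r" by (simp add: b_def)
    also have "\<dots> = dist_fn (b n) r / 2"
      using that by (subst dist_fn_halves[OF bL]) (auto simp: dist_fn_def[of "\<lambda>t. 0"])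
    finally show ?case using Suc by auto
  qed
  obtain n where n: "1 / 2 ^ n < dist_fn f c"
    using real_arch_pow_inv[OF c(2), of "1/2"] by (auto simp: power_divide)
  have "b n \<in> X"
  proof (rule norm_le_dist(1)[OF AX bL])
    fix r :: real assume "0 < r"
    then show "dist_fn (b n) r \<le> dist_fn (indicator ?A) r"
      using n by (subst dist_fn_indicator) (auto simp: bd dist_fn_def[of f])
  qed
  then have "b (n - k) \<in> X" for k
  proof (induction k)
    case (Suc k)
    show ?case
    proof (cases "k < n")
      case True
      then have "b (n - k) = halves (b (n - Suc k)) (\<lambda>t. 0)"
        by (metis Suc_diff_Suc b_def comp_apply funpow.simps(2))
      then show ?thesis using halves_zero_imp_X(1)[OF bL] Suc by simp
    qed (use Suc in auto)
  qed simp
  from this[of n] show ?thesis by (simp add: b_def)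
qed

lemma const_X: "(\<lambda>t. c) \<in> X" and norm_const: "N (\<lambda>t. c) = \<bar>c\<bar> * N (\<lambda>t. 1)"
  using scale[OF one_X, of c] norm_scale[OF one_X, of c] by auto

lemma norm_one_pos: "0 < N (\<lambda>t. 1)"
proof -
  have "\<not> (AE t in I01. (1::real) = 0)"
  proof
    assume "AE t in I01. (1::real) = 0"
    then have "measure I01 {0..1} = measure I01 {}"
      by (intro I01.finite_measure_eq_AE) (auto simp: sets_I01_iff)
    then show False by simp
  qed
  then show ?thesis using norm_eq_0_iff[OF one_X] norm_nonneg[OF one_X] by (auto simp: less_le)
qed

lemma bounded_X: "f \<in> L0 \<Longrightarrow> (\<And>t. 0 \<le> t \<Longrightarrow> t \<le> 1 \<Longrightarrow> \<bar>f t\<bar> \<le> B) \<Longrightarrow> f \<in> X \<and> N f \<le> B * N (\<lambda>t. 1)"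
proof -
  assume a: "f \<in> L0" "\<And>t. 0 \<le> t \<Longrightarrow> t \<le> 1 \<Longrightarrow> \<bar>f t\<bar> \<le> B"
  have B: "0 \<le> B" using a(2)[of 0] by auto
  have "AE t in I01. \<bar>f t\<bar> \<le> \<bar>B\<bar>" using a(2) B by (intro AE_I2) auto
  then show ?thesis using idealD[OF a(1) const_X[of B]] norm_mono[OF a(1) const_X[of B]] norm_const[of B] B by auto
qed

lemma dilation_X:
  assumes s: "0 < s" "s \<le> 1" and f: "f \<in> X"
  shows "dilation s f \<in> X" "N (dilation s f) \<le> N f"
proof -
  have fL: "f \<in> L0" using X_L0[OF f] .
  have "dist_fn (dilation s f) c \<le> dist_fn f c" if "0 < c" for c
    using that s dist_fn_nonneg[of f c] by (subst dist_fn_dilation[OF s fL]) (auto intro: mult_left_le_one_le)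
  then show "dilation s f \<in> X" "N (dilation s f) \<le> N f"
    using norm_le_dist[OF f dilation_L0[OF s fL]] by auto
qed

lemma dilation_norm_bound:
  assumes s: "0 < s" "s \<le> 1"
  shows "0 \<le> dilation_norm X N s" "dilation_norm X N s \<le> 1"
    "f \<in> X \<Longrightarrow> N (dilation s f) \<le> dilation_norm X N s * N f"
proof -
  have bdd: "bdd_above ((\<lambda>f. N (dilation s f)) ` {f \<in> X. N f \<le> 1})"
    by (rule bdd_aboveI[of _ 1]) (use dilation_X(2)[OF s] in force)
  have z: "(\<lambda>t. 0) \<in> {f \<in> X. N f \<le> 1}" using zero norm_zero by auto
  have "dilation s (\<lambda>t. 0) = (\<lambda>t. 0)" by (auto simp: dilation_def)
  then show "0 \<le> dilation_norm X N s"
    unfolding dilation_norm_def using cSUP_upper[OF z bdd] norm_zero by simp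
  show "dilation_norm X N s \<le> 1" unfolding dilation_norm_def
    by (rule cSUP_least) (use z dilation_X(2)[OF s] in force)+
  show "N (dilation s f) \<le> dilation_norm X N s * N f" if f: "f \<in> X"
  proof (cases "N f = 0")
    case True
    then show ?thesis using dilation_X(2)[OF s f] by simp
  next
    case False
    then have pos: "0 < N f" using norm_nonneg[OF f] by simp
    let ?g = "\<lambda>t. 1 / N f * f t"
    have g: "?g \<in> X" "N ?g = 1"
      using scale[OF f, of "1 / N f"] norm_scale[OF f, of "1 / N f"] pos by auto
    have "dilation s ?g = (\<lambda>t. 1 / N f * dilation s f t)" by (auto simp: dilation_def)
    then have "N (dilation s ?g) = N (dilation s f) / N f"
      using norm_scale[OF dilation_X(1)[OF s f], of "1 / N f"] pos by simp
    moreover have "N (dilation s ?g) \<le> dilation_norm X N s"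
      unfolding dilation_norm_def by (rule cSUP_upper[OF _ bdd]) (use g in simp)
    ultimately have "N (dilation s f) / N f \<le> dilation_norm X N s" by simp
    then show ?thesis using pos by (simp only: pos_divide_le_eq)
  qed
qed

text \<open>A finite infimum supplies one \<open>s\<close> whose dilation norm is not 1, hence is
  below 1, as dilations with \<open>s \<le> 1\<close> are contractions. Its iterates are the
  dilations by \<open>s ^ n\<close>, with geometrically decreasing norms.\<close>

lemma dilation_small:
  assumes q: "upper_boyd_index X N < \<infinity>" and e: "0 < e"
  shows "\<exists>r. 0 < r \<and> r \<le> 1 \<and> (\<forall>f\<in>X. N (dilation r f) \<le> e * N f)"
proof -
  obtain s where s: "0 < s" "s < 1" "dilation_norm X N s \<noteq> 1"
    using q unfolding upper_boyd_index_def INF_less_iff by (auto split: if_splits)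
  define D where "D = dilation_norm X N s"
  have D: "0 \<le> D" "D < 1" using dilation_norm_bound[of s] s unfolding D_def by auto
  have pow: "N (dilation (s ^ n) f) \<le> D ^ n * N f" if f: "f \<in> X" for n f
  proof (induction n)
    case 0
    have "N (dilation (s ^ 0) f) = N f"
      by (rule norm_cong[THEN conjunct2, OF f dilation_L0])
        (use X_L0[OF f] in \<open>auto simp: dilation_def intro!: AE_I2\<close>)
    then show ?case by simp
  next
    case (Suc n)
    have sn: "0 < s ^ n" "s ^ n \<le> 1" "0 < s ^ Suc n" "s ^ Suc n \<le> 1" 
      using s power_le_one[of s n] power_le_one[of s "Suc n"] by auto
    have "N (dilation (s ^ Suc n) f) = N (dilation s (dilation (s ^ n) f))"
      by (rule norm_cong[THEN conjunct2])
        (use s sn dilation_dilation[of s "s ^ n" _ f] X_L0[OF f] dilation_X[OF _ _ f] f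
          in \<open>auto intro!: AE_I2 dilation_X dilation_L0 simp: power_Suc\<close>)
    also have "\<dots> \<le> D * N (dilation (s ^ n) f)"
      unfolding D_def using s sn f by (intro dilation_norm_bound dilation_X) auto
    also have "\<dots> \<le> D * (D ^ n * N f)" using Suc D by (intro mult_left_mono) auto
    finally show ?case by simp
  qed
  obtain n where n: "D ^ n < e" using real_arch_pow_inv[OF e D(2)] by blast
  show ?thesis
  proof (intro exI[of _ "s ^ n"] conjI ballI)
    fix f assume f: "f \<in> X"
    have "D ^ n * N f \<le> e * N f" using n norm_nonneg[OF f] by (intro mult_right_mono) auto
    then show "N (dilation (s ^ n) f) \<le> e * N f" using pow[OF f, of n] by linarith
  qed (use s power_le_one[of s n] in auto)
qed

text \<open>\<open>halves\<close> realizes the sum of the two distribution functions on the right as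
  that of a single function, at the price of a factor two. With the bound \<open>1 / (4 * b)\<close>
  the dilation term then amounts to half of \<open>N g / b\<close> and is absorbed on the
  left.\<close>

lemma norm_good_lambda:
  assumes g: "g \<in> X" and h: "h \<in> X" and b: "0 < b" and d: "0 < d"
    and r: "0 < r" "r \<le> 1" "\<forall>f\<in>X. N (dilation r f) \<le> 1 / (4 * b) * N f"
    and gl: "\<And>l. 0 < l \<Longrightarrow> dist_fn g (b * l) \<le> dist_fn h (d * l) + r * dist_fn g l"
  shows "N g \<le> 4 * b / d * N h"
proof -
  let ?G = "\<lambda>t. (1 / b) * g t" and ?H = "\<lambda>t. (1 / d) * h t"
  have GX: "?G \<in> X" "?H \<in> X" using scale g h by blast+
  have 0: "(\<lambda>t. 0) \<in> L0" by auto
  note L = X_L0[OF g] X_L0[OF h] X_L0[OF GX(1)] X_L0[OF GX(2)] dilation_L0[OF r(1,2) X_L0[OF g]]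
  have "N (halves ?G (\<lambda>t. 0)) \<le> N (halves ?H (dilation r g))"
  proof (rule norm_le_dist(2)[OF halves_X[OF GX(2) dilation_X(1)[OF r(1,2) g]] halves_L0[OF L(3) 0]])
    fix c :: real assume c: "0 < c"
    have "dist_fn ?G c = dist_fn g (b * c)" "dist_fn ?H c = dist_fn h (d * c)"
      using dist_fn_scale[of "1/b" g c] dist_fn_scale[of "1/d" h c] b d by (auto simp: mult.commute)
    then show "dist_fn (halves ?G (\<lambda>t. 0)) c \<le> dist_fn (halves ?H (dilation r g)) c"
      unfolding dist_fn_halves[OF L(3) 0] dist_fn_halves[OF L(4,5)]
      using gl[OF c] c dist_fn_dilation[OF r(1,2) L(1), of c] by (simp add: dist_fn_def[of "\<lambda>t. 0"])
  qed
  also have "\<dots> \<le> N ?H + N (dilation r g)"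
    by (intro norm_halves GX dilation_X r g)
  also have "\<dots> \<le> N h / d + N g / (4 * b)"
    using norm_scale[OF h, of "1/d"] d r(3) g by auto
  finally have "2 * N (halves ?G (\<lambda>t. 0)) \<le> 2 * (N h / d + N g / (4 * b))"
    by (rule mult_left_mono) simp
  then have "N ?G \<le> 2 * (N h / d + N g / (4 * b))"
    using halves_zero_imp_X(2)[OF L(3) halves_zero(1)[OF GX(1)]] by (rule order_trans[rotated])
  moreover have "N ?G = N g / b" using norm_scale[OF g, of "1/b"] b by simp
  ultimately have "N g / b \<le> 2 * (N h / d + N g / (4 * b))" by simp
  then have "N g / b \<le> 2 * (N h / d) + (N g / b) / 2" by (simp add: field_simps)
  moreover have "x \<le> 4 * y" if "x \<le> 2 * y + x / 2" for x y :: real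
    using that by linarith
  ultimately have "N g / b \<le> 4 * (N h / d)" by blast
  then show ?thesis using b by (simp add: field_simps)
qed

end

section \<open>A good-\<open>\<lambda>\<close> inequality for finite martingales\<close>

lemma powr_add_le:
  fixes u v q :: real
  assumes "0 \<le> u" "0 \<le> v" "0 < q" "q \<le> 1"
  shows "(u + v) powr q \<le> u powr q + v powr q"
proof (cases "u + v = 0")
  case False
  then have s: "0 < u + v" using assms by linarith
  have *: "w / (u + v) \<le> (w / (u + v)) powr q" if "0 \<le> w" "w \<le> u + v" for w
  proof (cases "w = 0")
    case False
    then have "(w / (u + v)) powr 1 \<le> (w / (u + v)) powr q"
      using that s assms by (intro powr_mono') auto
    then show ?thesis using that s False by simp
  qed auto
  have "1 = u / (u + v) + v / (u + v)" using s by (simp add: add_divide_distrib[symmetric])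
  also have "\<dots> \<le> (u / (u + v)) powr q + (v / (u + v)) powr q"
    using *[of u] *[of v] assms by linarith
  also have "\<dots> = (u powr q + v powr q) / (u + v) powr q"
    using assms s by (simp add: powr_divide add_divide_distrib)
  finally show ?thesis using s by (simp add: field_simps)
qed (use assms in auto)

text \<open>For \<open>q > 0\<close>, \<open>(q + 1) * signed_powr q\<close> is the derivative of
  \<open>|x| powr (q + 1)\<close>.\<close>

definition signed_powr :: "real \<Rightarrow> real \<Rightarrow> real" where
  "signed_powr q x = sgn x * \<bar>x\<bar> powr q"

text \<open>Hoelder continuity of order \<open>q\<close>. For equal signs the constant is one, by
  subadditivity of the power; for opposite signs both moduli are at most \<open>|x - y|\<close>,
  which accounts for the two.\<close>

lemma signed_powr_diff:
  fixes x y q :: real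
  assumes q: "0 < q" "q \<le> 1"
  shows "\<bar>signed_powr q x - signed_powr q y\<bar> \<le> 2 * \<bar>x - y\<bar> powr q"
proof -
  have sub: "\<bar>\<bar>x\<bar> powr q - \<bar>y\<bar> powr q\<bar> \<le> \<bar>x - y\<bar> powr q"
  proof -
    have 1: "\<bar>a\<bar> powr q \<le> \<bar>b\<bar> powr q + \<bar>a - b\<bar> powr q" for a b :: real
    proof -
      have "\<bar>a\<bar> powr q \<le> (\<bar>b\<bar> + \<bar>a - b\<bar>) powr q" using q by (intro powr_mono2) auto
      also have "\<dots> \<le> \<bar>b\<bar> powr q + \<bar>a - b\<bar> powr q" by (rule powr_add_le) (use q in auto)
      finally show ?thesis .
    qed
    show ?thesis using 1[of x y] 1[of y x] unfolding abs_minus_commute[of y x] abs_le_iff by linarith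
  qed
  have nn: "0 \<le> \<bar>x - y\<bar> powr q" "0 \<le> \<bar>x\<bar> powr q" "0 \<le> \<bar>y\<bar> powr q" by auto
  consider "x = 0" | "y = 0" | "sgn x = sgn y" "x \<noteq> 0" "y \<noteq> 0" | "sgn x = - sgn y" "x \<noteq> 0" "y \<noteq> 0"
    by (cases x "0::real" rule: linorder_cases; cases y "0::real" rule: linorder_cases) auto
  then show ?thesis
  proof cases
    case 3
    then have "\<bar>signed_powr q x - signed_powr q y\<bar> = \<bar>\<bar>x\<bar> powr q - \<bar>y\<bar> powr q\<bar>"
      by (auto simp: signed_powr_def sgn_if split: if_splits)
    then show ?thesis using sub nn by linarith
  next
    case 4
    then have "signed_powr q x - signed_powr q y = \<bar>x\<bar> powr q + \<bar>y\<bar> powr q \<or>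
        signed_powr q x - signed_powr q y = - (\<bar>x\<bar> powr q + \<bar>y\<bar> powr q)"
      by (auto simp: signed_powr_def sgn_if split: if_splits)
    moreover have "\<bar>x\<bar> \<le> \<bar>x - y\<bar>" "\<bar>y\<bar> \<le> \<bar>x - y\<bar>" using 4 by (auto simp: sgn_if split: if_splits)
    then have "\<bar>x\<bar> powr q \<le> \<bar>x - y\<bar> powr q" "\<bar>y\<bar> powr q \<le> \<bar>x - y\<bar> powr q"
      using q by (auto intro!: powr_mono2)
    ultimately show ?thesis using nn by linarith
  qed (auto simp: signed_powr_def abs_mult abs_sgn_eq)
qed

text \<open>Convexity, with the tangent taken at \<open>x\<close>. It is Young's inequality with the
  exponents \<open>p\<close> and \<open>p / (p - 1)\<close>.\<close>

lemma abs_powr_tangent: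
  fixes x y p :: real
  assumes p: "1 < p"
  shows "\<bar>x\<bar> powr p \<le> \<bar>y\<bar> powr p + p * signed_powr (p - 1) x * (x - y)"
proof (cases "x = 0")
  case False
  have "signed_powr (p - 1) x * y \<le> \<bar>signed_powr (p - 1) x * y\<bar>" by simp
  also have "\<dots> = \<bar>y\<bar> * \<bar>x\<bar> powr (p - 1)"
    using False by (simp add: signed_powr_def abs_mult abs_sgn_eq)
  also have "\<dots> \<le> \<bar>y\<bar> powr p / p + (\<bar>x\<bar> powr (p - 1)) powr (p / (p - 1)) / (p / (p - 1))"
    by (rule Youngs_inequality) (use p in \<open>auto simp: field_simps\<close>)
  also have "(\<bar>x\<bar> powr (p - 1)) powr (p / (p - 1)) = \<bar>x\<bar> powr p"
    using p by (simp add: powr_powr)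
  finally have "p * (signed_powr (p - 1) x * y) \<le> \<bar>y\<bar> powr p + (p - 1) * \<bar>x\<bar> powr p"
    using p by (simp add: field_simps)
  moreover have "signed_powr (p - 1) x * x = \<bar>x\<bar> powr p"
  proof -
    have "signed_powr (p - 1) x * x = \<bar>x\<bar> powr (p - 1) * \<bar>x\<bar>"
      unfolding signed_powr_def by (simp add: abs_sgn mult_ac)
    then show ?thesis using False by (simp add: powr_mult_base[of "\<bar>x\<bar>" "p - 1"] mult.commute)
  qed
  ultimately show ?thesis by (simp add: algebra_simps)
qed (use p in \<open>simp add: signed_powr_def\<close>)

text \<open>The tangent at \<open>a + b\<close> bounds the left side from above. Moving its slope
  back to \<open>a\<close> costs \<open>2 * p * |b| powr p\<close> by Hoelder continuity of order
  \<open>p - 1 \<le> 1\<close>, and \<open>p \<le> 2\<close> turns this into the factor four. The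
  middle term is linear in \<open>b\<close>, so it averages out when \<open>b\<close> is a
  martingale difference.\<close>

lemma abs_powr_add_le:
  fixes a b p :: real
  assumes p: "1 < p" "p \<le> 2"
  shows "\<bar>a + b\<bar> powr p \<le> \<bar>a\<bar> powr p + p * signed_powr (p - 1) a * b + 4 * \<bar>b\<bar> powr p"
proof -
  let ?G = "signed_powr (p - 1)"
  have "(?G (a + b) - ?G a) * b \<le> \<bar>?G (a + b) - ?G a\<bar> * \<bar>b\<bar>"
    by (metis abs_ge_self abs_mult)
  also have "\<dots> \<le> 2 * \<bar>a + b - a\<bar> powr (p - 1) * \<bar>b\<bar>"
    by (intro mult_right_mono signed_powr_diff) (use p in auto)
  also have "\<dots> = 2 * \<bar>b\<bar> powr p"
    using p by (cases "b = 0") (auto simp: powr_mult_base[of "\<bar>b\<bar>" "p - 1", symmetric] powr_diff)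
  finally have 1: "(?G (a + b) - ?G a) * b \<le> 2 * \<bar>b\<bar> powr p" .
  have "p * ((?G (a + b) - ?G a) * b) \<le> p * (2 * \<bar>b\<bar> powr p)"
    using 1 p by (intro mult_left_mono) auto
  also have "\<dots> \<le> 4 * \<bar>b\<bar> powr p" using p mult_right_mono[of p 2 "\<bar>b\<bar> powr p"] by auto
  finally have "p * (?G (a + b) * b) \<le> p * (?G a * b) + 4 * \<bar>b\<bar> powr p"
    by (simp add: algebra_simps)
  then show ?thesis using abs_powr_tangent[OF p(1), of "a + b" a] by (simp add: algebra_simps)
qed

text \<open>A finite uniform probability space filtered by labellings: the atoms of the \<open>j\<close>-th algebra
  are the fibres of \<open>\<pi> j\<close>. The differences \<open>d i\<close> with \<open>i < j\<close> are measurable at stage \<open>j\<close>,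
  and \<open>W j\<close> is the conditional expectation of \<open>\<bar>d j\<bar> powr p\<close> at stage \<open>j\<close>.\<close>

locale finite_martingale =
  fixes \<Omega> :: "'a set" and \<pi> :: "nat \<Rightarrow> 'a \<Rightarrow> 'b" and d W :: "nat \<Rightarrow> 'a \<Rightarrow> real" and p :: real
  assumes fin: "finite \<Omega>" and p: "1 < p" "p \<le> 2"
    and adapted: "\<And>i j x y. x \<in> \<Omega> \<Longrightarrow> y \<in> \<Omega> \<Longrightarrow> i < j \<Longrightarrow> \<pi> j x = \<pi> j y \<Longrightarrow> d i x = d i y"
    and W_predictable: "\<And>i j x y. x \<in> \<Omega> \<Longrightarrow> y \<in> \<Omega> \<Longrightarrow> i \<le> j \<Longrightarrow> \<pi> j x = \<pi> j y \<Longrightarrow> W i x = W i y"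
    and W_nonneg: "\<And>j x. x \<in> \<Omega> \<Longrightarrow> 0 \<le> W j x"
    and mean_zero: "\<And>j v. (\<And>x y. x \<in> \<Omega> \<Longrightarrow> y \<in> \<Omega> \<Longrightarrow> \<pi> j x = \<pi> j y \<Longrightarrow> v x = v y) \<Longrightarrow>
        (\<Sum>x\<in>\<Omega>. v x * d j x) = 0"
    and cond_W: "\<And>j v. (\<And>x y. x \<in> \<Omega> \<Longrightarrow> y \<in> \<Omega> \<Longrightarrow> \<pi> j x = \<pi> j y \<Longrightarrow> v x = v y) \<Longrightarrow>
        (\<Sum>x\<in>\<Omega>. v x * \<bar>d j x\<bar> powr p) = (\<Sum>x\<in>\<Omega>. v x * W j x)"
begin

definition S :: "nat \<Rightarrow> 'a \<Rightarrow> real" where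
  "S m x = (\<Sum>j<m. d j x)"

lemma S_adapted: "x \<in> \<Omega> \<Longrightarrow> y \<in> \<Omega> \<Longrightarrow> \<pi> j x = \<pi> j y \<Longrightarrow> i \<le> j \<Longrightarrow> S i x = S i y"
  unfolding S_def by (intro sum.cong adapted[of x y _ j]) auto

text \<open>The transform below runs from the first passage of \<open>\<bar>S\<bar>\<close> over \<open>l\<close> to its first passage
  over \<open>3 l\<close>, and stops before the predictable \<open>p\<close>-function exceeds \<open>e l\<close>.\<close>

definition V :: "real \<Rightarrow> real \<Rightarrow> nat \<Rightarrow> 'a \<Rightarrow> real" where
  "V l e j x = of_bool ((\<exists>i\<le>j. l < \<bar>S i x\<bar>) \<and> (\<forall>i\<le>j. \<bar>S i x\<bar> \<le> 3 * l) \<and>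
     (\<Sum>i\<le>j. W i x) \<le> (e * l) powr p)"

definition H :: "real \<Rightarrow> real \<Rightarrow> nat \<Rightarrow> 'a \<Rightarrow> real" where
  "H l e m x = (\<Sum>j<m. V l e j x * d j x)"

lemma V_adapted:
  assumes "x \<in> \<Omega>" "y \<in> \<Omega>" "\<pi> j x = \<pi> j y" "i \<le> j"
  shows "V l e i x = V l e i y"
proof -
  have 1: "S k x = S k y" if "k \<le> i" for k using S_adapted[OF assms(1-3)] that assms(4) by simp
  have 2: "(\<Sum>k\<le>i. W k x) = (\<Sum>k\<le>i. W k y)"
    by (intro sum.cong W_predictable[OF assms(1,2) _ assms(3)]) (use assms(4) in auto)
  show ?thesis unfolding V_def 2 using 1 by auto
qed

lemma H_adapted:
  assumes "x \<in> \<Omega>" "y \<in> \<Omega>" "\<pi> j x = \<pi> j y"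
  shows "H l e j x = H l e j y"
  unfolding H_def using V_adapted[OF assms] adapted[OF assms(1,2) _ assms(3)] by (intro sum.cong) auto

text \<open>Taking \<open>a = H l e m x\<close> and \<open>b = V l e m x * d m x\<close> in
  \<open>abs_powr_add_le\<close>, the coefficient of the linear term is known at stage
  \<open>m\<close>, so this term sums to zero. \<open>V\<close> has only the values 0 and 1 and
  comes out of the power; \<open>cond_W\<close> then replaces \<open>|d m x| powr p\<close> by
  \<open>W m x\<close>.\<close>

lemma H_moment:
  "(\<Sum>x\<in>\<Omega>. \<bar>H l e m x\<bar> powr p) \<le> 4 * (\<Sum>j<m. \<Sum>x\<in>\<Omega>. V l e j x * W j x)"
proof (induction m)
  case 0
  show ?case using p by (simp add: H_def)
next
  case (Suc m)
  have V01: "\<bar>V l e m x * d m x\<bar> powr p = V l e m x * \<bar>d m x\<bar> powr p" for x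
    by (auto simp: V_def)
  have "(\<Sum>x\<in>\<Omega>. \<bar>H l e (Suc m) x\<bar> powr p) \<le> (\<Sum>x\<in>\<Omega>. \<bar>H l e m x\<bar> powr p
      + p * signed_powr (p - 1) (H l e m x) * (V l e m x * d m x) + 4 * (V l e m x * \<bar>d m x\<bar> powr p))"
  proof (rule sum_mono)
    fix x
    show "\<bar>H l e (Suc m) x\<bar> powr p \<le> \<bar>H l e m x\<bar> powr p
      + p * signed_powr (p - 1) (H l e m x) * (V l e m x * d m x) + 4 * (V l e m x * \<bar>d m x\<bar> powr p)"
      using abs_powr_add_le[OF p, of "H l e m x" "V l e m x * d m x"] V01[of x] by (simp add: H_def)
  qed
  also have "\<dots> = (\<Sum>x\<in>\<Omega>. \<bar>H l e m x\<bar> powr p)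
      + (\<Sum>x\<in>\<Omega>. (p * signed_powr (p - 1) (H l e m x) * V l e m x) * d m x)
      + 4 * (\<Sum>x\<in>\<Omega>. V l e m x * \<bar>d m x\<bar> powr p)"
    by (simp add: sum.distrib sum_distrib_left mult.assoc)
  also have "(\<Sum>x\<in>\<Omega>. (p * signed_powr (p - 1) (H l e m x) * V l e m x) * d m x) = 0"
    
  proof (rule mean_zero)
    fix x y assume xy: "x \<in> \<Omega>" "y \<in> \<Omega>" "\<pi> m x = \<pi> m y"
    show "p * signed_powr (p - 1) (H l e m x) * V l e m x = p * signed_powr (p - 1) (H l e m y) * V l e m y"
      using H_adapted[OF xy] V_adapted[OF xy order_refl] by simp
  qed
  also have "(\<Sum>x\<in>\<Omega>. V l e m x * \<bar>d m x\<bar> powr p) = (\<Sum>x\<in>\<Omega>. V l e m x * W m x)"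
    by (rule cond_W) (rule V_adapted, auto)
  finally show ?case using Suc by simp
qed

text \<open>Nothing is added before the passage over \<open>l\<close>. Afterwards the condition in
  \<open>V\<close> at stage \<open>j\<close> already counts \<open>W j\<close>, the term about to be
  added, so the sum cannot overshoot \<open>(e * l) powr p\<close>.\<close>

lemma V_W_sum:
  assumes x: "x \<in> \<Omega>" and l: "0 < l" and e: "0 < e"
  shows "(\<Sum>j<n. V l e j x * W j x) \<le> of_bool (\<exists>i\<le>n. l < \<bar>S i x\<bar>) * (e * l) powr p"
proof (induction n)
  case (Suc n)
  show ?case
  proof (cases "V l e n x = 0")
    case True
    have "of_bool (\<exists>i\<le>n. l < \<bar>S i x\<bar>) \<le> (of_bool (\<exists>i\<le>Suc n. l < \<bar>S i x\<bar>) :: real)"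
      by (auto simp: le_Suc_eq)
    then have "of_bool (\<exists>i\<le>n. l < \<bar>S i x\<bar>) * (e * l) powr p
        \<le> of_bool (\<exists>i\<le>Suc n. l < \<bar>S i x\<bar>) * (e * l) powr p"
      by (rule mult_right_mono) simp
    then show ?thesis using Suc True by simp
  next
    case False
    then have V: "(\<exists>i\<le>n. l < \<bar>S i x\<bar>)" "(\<Sum>i\<le>n. W i x) \<le> (e * l) powr p"
      by (auto simp: V_def split: if_splits)
    have "(\<Sum>j<Suc n. V l e j x * W j x) \<le> (\<Sum>j<Suc n. 1 * W j x)"
      by (intro sum_mono mult_right_mono W_nonneg x) (auto simp: V_def)
    also have "\<dots> \<le> (e * l) powr p" using V(2) by (simp add: lessThan_Suc_atMost)
    finally show ?thesis using V(1) le_SucI by auto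
  qed
qed simp

text \<open>\<open>H\<close> is the increment of \<open>S\<close> between the two passage times. At
  the first one \<open>|S|\<close> is at most \<open>l\<close> plus one jump, hence at most
  \<open>2 * l\<close>; at the second it exceeds \<open>3 * l\<close>. This is why the upper level
  is three times the lower one.\<close>

lemma H_large:
  assumes x: "x \<in> \<Omega>" and l: "0 < l" and e: "0 < e" "e \<le> 1"
    and big: "\<exists>i\<le>n. 3 * l < \<bar>S i x\<bar>"
    and W: "(\<Sum>j<n. W j x) \<le> (e * l) powr p" and d: "\<And>j. j < n \<Longrightarrow> \<bar>d j x\<bar> \<le> e * l"
  shows "l \<le> \<bar>H l e n x\<bar>"
proof -
  define \<nu> where "\<nu> = (LEAST i. 3 * l < \<bar>S i x\<bar>)"
  define \<mu> where "\<mu> = (LEAST i. l < \<bar>S i x\<bar>)"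
  have nu: "3 * l < \<bar>S \<nu> x\<bar>" unfolding \<nu>_def using big by (metis (mono_tags, lifting) LeastI)
  have nu_min: "\<bar>S i x\<bar> \<le> 3 * l" if "i < \<nu>" for i
    using not_less_Least[of i "\<lambda>i. 3 * l < \<bar>S i x\<bar>"] that unfolding \<nu>_def by auto
  have nu_n: "\<nu> \<le> n"
  proof -
    obtain i where "i \<le> n" "3 * l < \<bar>S i x\<bar>" using big by blast
    then show ?thesis using nu_min[of i] by (cases "i < \<nu>") auto
  qed
  have mu: "l < \<bar>S \<mu> x\<bar>" unfolding \<mu>_def by (rule LeastI[of _ \<nu>]) (use nu l in linarith)
  have mu_min: "\<bar>S i x\<bar> \<le> l" if "i < \<mu>" for i
    using not_less_Least[of i "\<lambda>i. l < \<bar>S i x\<bar>"] that unfolding \<mu>_def by auto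
  have mn: "\<mu> \<le> \<nu>"
  proof (rule ccontr)
    assume "\<not> \<mu> \<le> \<nu>"
    then have "\<bar>S \<nu> x\<bar> \<le> l" by (intro mu_min) simp
    then show False using nu l by linarith
  qed
  \<comment> \<open>The bound on the total of \<open>W\<close> keeps the predictable stopping from
    taking effect. Since \<open>d j\<close> leads from \<open>S j\<close> to
    \<open>S (Suc j)\<close>, the indices from \<open>\<mu>\<close> up to but excluding
    \<open>\<nu>\<close> telescope to \<open>S \<nu> x - S \<mu> x\<close>.\<close>
  have V: "V l e j x = of_bool (\<mu> \<le> j \<and> j < \<nu>)" if "j < n" for j
  proof -
    have "(\<exists>i\<le>j. l < \<bar>S i x\<bar>) \<longleftrightarrow> \<mu> \<le> j" 
    proof
      assume "\<exists>i\<le>j. l < \<bar>S i x\<bar>"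
      then obtain i where "i \<le> j" "l < \<bar>S i x\<bar>" by blast
      then show "\<mu> \<le> j" using mu_min[of i] by (cases "i < \<mu>") auto
    qed (use mu in blast)
    moreover have "(\<forall>i\<le>j. \<bar>S i x\<bar> \<le> 3 * l) \<longleftrightarrow> j < \<nu>" 
    proof
      assume "\<forall>i\<le>j. \<bar>S i x\<bar> \<le> 3 * l"
      then show "j < \<nu>" using nu by (cases "\<nu> \<le> j") auto
    qed (use nu_min in auto)
    moreover have "(\<Sum>i\<le>j. W i x) \<le> (\<Sum>i<n. W i x)"
      by (intro sum_mono2) (use that W_nonneg[OF x] in auto)
    ultimately show ?thesis using W unfolding V_def by auto
  qed
  have "H l e n x = (\<Sum>j<n. of_bool (\<mu> \<le> j \<and> j < \<nu>) * d j x)"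
    unfolding H_def by (intro sum.cong) (auto simp: V)
  also have "\<dots> = (\<Sum>j=\<mu>..<\<nu>. d j x)"
    by (rule sum.mono_neutral_cong_right) (use nu_n in auto)
  also have "\<dots> = S \<nu> x - S \<mu> x"
    using mn by (simp add: S_def sum_diff_nat_ivl lessThan_atLeast0)
  finally have H: "H l e n x = S \<nu> x - S \<mu> x" .
  have "S 0 x = 0" by (simp add: S_def)
  then have "\<mu> \<noteq> 0" using mu l by (metis abs_zero less_asym)
  then obtain k where k: "\<mu> = Suc k" using not0_implies_Suc by blast
  have "\<bar>d k x\<bar> \<le> e * l" using d[of k] k mn nu_n by simp
  also have "e * l \<le> l" using e l by simp
  finally have "\<bar>S \<mu> x\<bar> \<le> 2 * l" using mu_min[of k] k by (simp add: S_def)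
  then show ?thesis using H nu by linarith
qed

text \<open>Points with \<open>h x > e * l\<close> are simply counted. At the others a passage over
  \<open>3 * l\<close> forces \<open>|H| \<ge> l\<close>, so Markov's inequality for the
  \<open>p\<close>-th moment of \<open>H\<close> bounds their number; \<open>V_W_sum\<close>
  confines this moment to the points that pass over \<open>l\<close>.\<close>

lemma good_lambda:
  assumes l: "0 < l" and e: "0 < e" "e \<le> 1"
    and h: "\<And>x. x \<in> \<Omega> \<Longrightarrow> (\<Sum>j<n. W j x) \<le> h x powr p"
      "\<And>x j. x \<in> \<Omega> \<Longrightarrow> j < n \<Longrightarrow> \<bar>d j x\<bar> \<le> h x" "\<And>x. x \<in> \<Omega> \<Longrightarrow> 0 \<le> h x"
  shows "real (card {x \<in> \<Omega>. \<exists>i\<le>n. 3 * l < \<bar>S i x\<bar>})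
     \<le> real (card {x \<in> \<Omega>. e * l < h x}) + 4 * e powr p * real (card {x \<in> \<Omega>. \<exists>i\<le>n. l < \<bar>S i x\<bar>})"
proof -
  let ?A = "{x \<in> \<Omega>. \<exists>i\<le>n. 3 * l < \<bar>S i x\<bar>}" and ?B = "{x \<in> \<Omega>. e * l < h x}"
  let ?G = "{x \<in> \<Omega>. \<exists>i\<le>n. l < \<bar>S i x\<bar>}"
  have "real (card (?A - ?B)) * l powr p = (\<Sum>x\<in>?A - ?B. l powr p)" by simp
  also have "\<dots> \<le> (\<Sum>x\<in>?A - ?B. \<bar>H l e n x\<bar> powr p)"
  proof (rule sum_mono)
    fix x assume x: "x \<in> ?A - ?B"
    then have hx: "h x \<le> e * l" "x \<in> \<Omega>" by auto
    have hxp: "h x powr p \<le> (e * l) powr p" using hx h(3) p by (intro powr_mono2) auto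
    then have "l \<le> \<bar>H l e n x\<bar>"
      by (intro H_large[OF hx(2) l e]) (use x hxp hx h(1,2)[OF hx(2)] in \<open>auto intro: order_trans\<close>)
    then show "l powr p \<le> \<bar>H l e n x\<bar> powr p" using l p by (intro powr_mono2) auto
  qed
  also have "\<dots> \<le> (\<Sum>x\<in>\<Omega>. \<bar>H l e n x\<bar> powr p)" by (intro sum_mono2 fin) auto
  also have "\<dots> \<le> 4 * (\<Sum>j<n. \<Sum>x\<in>\<Omega>. V l e j x * W j x)" by (rule H_moment)
  also have "(\<Sum>j<n. \<Sum>x\<in>\<Omega>. V l e j x * W j x) = (\<Sum>x\<in>\<Omega>. \<Sum>j<n. V l e j x * W j x)" by (rule sum.swap)
  also have "\<dots> \<le> (\<Sum>x\<in>\<Omega>. of_bool (\<exists>i\<le>n. l < \<bar>S i x\<bar>) * (e * l) powr p)"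
    by (intro sum_mono V_W_sum l e)
  also have "\<dots> = real (card ?G) * (e * l) powr p"
    unfolding sum_distrib_right[symmetric] using fin by (subst sum_of_bool_eq) (auto simp: Int_def)
  finally have "real (card (?A - ?B)) * l powr p \<le> (4 * e powr p * real (card ?G)) * l powr p"
    using e l by (simp add: powr_mult mult_ac)
  then have "real (card (?A - ?B)) \<le> 4 * e powr p * real (card ?G)" using l by simp
  moreover have "card ?A \<le> card (?A - ?B) + card ?B"
    using card_mono[of "(?A - ?B) \<union> ?B" ?A] card_Un_le[of "?A - ?B" ?B] fin by fastforce
  ultimately show ?thesis by linarith
qed

end

section \<open>Dyadic step functions and averages\<close>

text \<open>Step functions on the half-open dyadic intervals of the whole line, so that equality of
  floors is the only condition to check. The endpoint 1 belongs to an interval outside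
  \<open>[0,1)\<close>; it is a null set.\<close>

definition dyadic :: "nat \<Rightarrow> (real \<Rightarrow> real) \<Rightarrow> bool" where
  "dyadic k f \<longleftrightarrow> (\<forall>s t. \<lfloor>2 ^ k * s\<rfloor> = \<lfloor>2 ^ k * t\<rfloor> \<longrightarrow> f s = f t)"

lemma floor_dyadic_div:
  fixes s :: real
  assumes "k \<le> K" shows "\<lfloor>2 ^ k * s\<rfloor> = \<lfloor>2 ^ K * s\<rfloor> div 2 ^ (K - k)"
proof -
  have "2 ^ k * s = 2 ^ K * s / real_of_int (2 ^ (K - k))"
  proof -
    have "(2::real) ^ K = 2 ^ k * 2 ^ (K - k)" using assms by (simp flip: power_add)
    then show ?thesis by simp
  qed
  then have "\<lfloor>2 ^ k * s\<rfloor> = \<lfloor>2 ^ K * s / real_of_int (2 ^ (K - k))\<rfloor>" by (rule arg_cong)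
  also have "\<dots> = \<lfloor>2 ^ K * s\<rfloor> div 2 ^ (K - k)" by (rule floor_divide_real_eq_div) simp
  finally show ?thesis .
qed

lemma dyadicI: "(\<And>s t. \<lfloor>2 ^ k * s\<rfloor> = \<lfloor>2 ^ k * t\<rfloor> \<Longrightarrow> f s = f t) \<Longrightarrow> dyadic k f"
  unfolding dyadic_def by blast

lemma dyadic_eq: "dyadic k f \<Longrightarrow> \<lfloor>2 ^ k * s\<rfloor> = \<lfloor>2 ^ k * t\<rfloor> \<Longrightarrow> f s = f t"
  unfolding dyadic_def by blast

lemma floor_dyadic_mono:
  "k \<le> K \<Longrightarrow> \<lfloor>2 ^ K * s\<rfloor> = \<lfloor>2 ^ K * t\<rfloor> \<Longrightarrow> \<lfloor>2 ^ k * s\<rfloor> = \<lfloor>2 ^ k * t\<rfloor>" for s t :: real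
  using floor_dyadic_div[of k K s] floor_dyadic_div[of k K t] by simp

lemma dyadic_mono: "k \<le> K \<Longrightarrow> dyadic k f \<Longrightarrow> dyadic K f"
  by (rule dyadicI) (rule dyadic_eq[OF _ floor_dyadic_mono])

lemma dyadic_comp: "dyadic k f \<Longrightarrow> dyadic k (\<lambda>t. \<phi> (f t))"
  by (rule dyadicI) (rule arg_cong[of _ _ \<phi>], rule dyadic_eq)

lemma dyadic_comp2: "dyadic k f \<Longrightarrow> dyadic k g \<Longrightarrow> dyadic k (\<lambda>t. \<phi> (f t) (g t))"
  by (rule dyadicI) (rule arg_cong2[of _ _ _ _ \<phi>], (rule dyadic_eq, assumption+)+)

lemma dyadic_sum: "(\<And>i. i \<in> A \<Longrightarrow> dyadic k (f i)) \<Longrightarrow> dyadic k (\<lambda>t. \<Sum>i\<in>A. f i t)"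
  by (rule dyadicI) (rule sum.cong[OF refl], rule dyadic_eq)

lemma dyadic_grid: "dyadic k f \<Longrightarrow> f t = f (of_int \<lfloor>2 ^ k * t\<rfloor> / 2 ^ k)"
  by (rule dyadic_eq) auto

lemma floor_grid: "k \<le> K \<Longrightarrow> \<lfloor>2 ^ k * (real i / 2 ^ K)\<rfloor> = int (i div 2 ^ (K - k))"
proof -
  assume "k \<le> K"
  have "\<lfloor>2 ^ K * (real i / 2 ^ K)\<rfloor> = int i" by simp
  then show ?thesis unfolding floor_dyadic_div[OF \<open>k \<le> K\<close>] by (simp add: zdiv_int)
qed

lemma dyadic_borel: assumes "dyadic k f" shows "f \<in> borel_measurable borel"
proof -
  have "(\<lambda>t::real. f (of_int \<lfloor>2 ^ k * t\<rfloor> / 2 ^ k)) \<in> borel_measurable borel"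
    by (rule measurable_compose[of "\<lambda>t::real. \<lfloor>2 ^ k * t\<rfloor>" _ "count_space UNIV"])
      (auto intro!: measurable_compose[OF _ measurable_real_floor])
  moreover have "f = (\<lambda>t. f (of_int \<lfloor>2 ^ k * t\<rfloor> / 2 ^ k))"
    by (rule ext) (rule dyadic_grid[OF assms])
  ultimately show ?thesis by simp
qed

lemma dyadic_L0: "dyadic k f \<Longrightarrow> f \<in> L0"
  by (intro lebesgue_imp_L0 measurable_completion) (simp add: dyadic_borel)

lemma dyadic_bounded: "dyadic k f \<Longrightarrow> \<exists>B. \<forall>t. 0 \<le> t \<longrightarrow> t \<le> 1 \<longrightarrow> \<bar>f t\<bar> \<le> B"
proof (intro exI allI impI)
  fix t :: real assume f: "dyadic k f" and t: "0 \<le> t" "t \<le> 1"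
  define i where "i = nat \<lfloor>2 ^ k * t\<rfloor>"
  have "2 ^ k * t \<le> 2 ^ k" using t by simp
  then have "\<lfloor>2 ^ k * t\<rfloor> \<le> \<lfloor>2 ^ k :: real\<rfloor>" by (rule floor_mono)
  also have "\<lfloor>2 ^ k :: real\<rfloor> = 2 ^ k" by (metis floor_of_int of_int_numeral of_int_power)
  finally have "\<lfloor>2 ^ k * t\<rfloor> \<le> 2 ^ k" .
  then have i: "i \<le> 2 ^ k" unfolding i_def by simp
  have "real i = of_int \<lfloor>2 ^ k * t\<rfloor>" using t by (simp add: i_def)
  then have "\<bar>f t\<bar> = \<bar>f (real i / 2 ^ k)\<bar>" using arg_cong[OF dyadic_grid[OF f, of t], of abs] by (simp only:)
  also have "\<dots> \<le> (\<Sum>i\<le>2 ^ k. \<bar>f (real i / 2 ^ k)\<bar>)" by (rule member_le_sum) (use i in auto)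
  finally show "\<bar>f t\<bar> \<le> (\<Sum>i\<le>2 ^ k. \<bar>f (real i / 2 ^ k)\<bar>)" .
qed

lemma integrable_bounded:
  "f \<in> L0 \<Longrightarrow> (\<And>t. 0 \<le> t \<Longrightarrow> t \<le> 1 \<Longrightarrow> \<bar>f t\<bar> \<le> B) \<Longrightarrow> integrable I01 f"
  by (rule I01.integrable_const_bound[of _ B]) (auto intro!: AE_I2)

lemma dyadic_integrable: "dyadic k f \<Longrightarrow> integrable I01 f"
  using dyadic_bounded[of k f] integrable_bounded[OF dyadic_L0] by metis

lemma AE_I01_less_1: "AE t in I01. 0 \<le> t \<and> t < 1"
proof -
  have "{1} \<in> null_sets I01" by (subst null_sets_restrict_space) auto
  then have "AE t in I01. t \<noteq> 1" by (rule AE_I') auto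
  then show ?thesis using AE_space by eventually_elim auto
qed

lemma grid_index: 
  assumes t: "0 \<le> t" "t < 1" 
  shows "nat \<lfloor>2 ^ k * t\<rfloor> < 2 ^ k" "\<lfloor>2 ^ k * t\<rfloor> = \<lfloor>2 ^ k * (real (nat \<lfloor>2 ^ k * t\<rfloor>) / 2 ^ k)\<rfloor>"
proof -
  have "\<lfloor>2 ^ k * t\<rfloor> < 2 ^ k" using t by (simp add: floor_less_iff)
  then show "nat \<lfloor>2 ^ k * t\<rfloor> < 2 ^ k" using t by (simp add: nat_less_iff)
qed (use t in simp)

lemma dyadic_integral:
  assumes f: "dyadic K f"
  shows "(LINT t|I01. f t) = (\<Sum>i<2 ^ K. f (real i / 2 ^ K)) / 2 ^ K"
proof -
  let ?J = "\<lambda>i::nat. {real i / 2 ^ K..<(real i + 1) / 2 ^ K}"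
  have J: "?J i \<subseteq> {0..1}" if "i < 2 ^ K" for i
  proof -
    have "real i + 1 \<le> 2 ^ K" using that by (metis Suc_leI add.commute of_nat_Suc of_nat_le_iff of_nat_numeral of_nat_power)
    then have le: "(real i + 1) / 2 ^ K \<le> 1" by simp
    have ge: "0 \<le> real i / 2 ^ K" by simp
    show ?thesis using le ge by (intro subsetI) (unfold atLeastAtMost_iff atLeastLessThan_iff, linarith)
  qed
  then have Js: "?J i \<in> sets I01" "measure I01 (?J i) = 1 / 2 ^ K" if "i < 2 ^ K" for i
    subgoal using that by (auto simp: sets_I01_iff)
    subgoal unfolding measure_I01[OF J[OF that]] by (simp add: field_simps)
    done
  have "(LINT t|I01. f t) = (LINT t|I01. (\<Sum>i<2 ^ K. f (real i / 2 ^ K) * indicator (?J i) t))"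
  proof (rule integral_cong_AE)
    show "AE t in I01. f t = (\<Sum>i<2 ^ K. f (real i / 2 ^ K) * indicator (?J i) t)"
      using AE_I01_less_1
    proof eventually_elim
      case (elim t)
      define j where "j = nat \<lfloor>2 ^ K * t\<rfloor>"
      have j: "j < 2 ^ K" using grid_index(1)[of t K] elim by (auto simp: j_def)
      have iff: "t \<in> ?J i \<longleftrightarrow> i = j" for i
      proof -
        have "t \<in> ?J i \<longleftrightarrow> \<lfloor>2 ^ K * t\<rfloor> = int i"
          by (auto simp: floor_eq_iff field_simps)
        then show ?thesis using elim by (auto simp: j_def)
      qed
      have "(\<Sum>i<2 ^ K. f (real i / 2 ^ K) * indicator (?J i) t) = (\<Sum>i<2 ^ K. if i = j then f (real j / 2 ^ K) else 0)"
        by (intro sum.cong) (use iff in \<open>auto simp: indicator_def\<close>)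
      also have "\<dots> = f (real j / 2 ^ K)" using j by simp
      also have "\<dots> = f t" by (rule dyadic_eq[OF f]) (use grid_index(2)[of t K] elim in \<open>auto simp: j_def\<close>)
      finally show ?case by simp
    qed
    show "(\<lambda>t. \<Sum>i<2 ^ K. f (real i / 2 ^ K) * indicator (?J i) t) \<in> L0"
      by (intro borel_measurable_sum borel_measurable_times borel_measurable_indicator borel_measurable_const)
        (use Js in auto)
  qed (use dyadic_L0[OF f] in auto)
  also have "\<dots> = (\<Sum>i<2 ^ K. f (real i / 2 ^ K) * (1 / 2 ^ K))"
    by (subst Bochner_Integration.integral_sum)
      (use Js J in \<open>auto simp: I01.emeasure_eq_measure Int_absorb2 intro!: integrable_mult_right sum.cong\<close>)
  finally show ?thesis by (simp add: sum_divide_distrib)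
qed

text \<open>The passage between norms, which see distribution functions, and the counting statements
  of \<open>finite_martingale\<close>.\<close>

lemma dyadic_dist_fn:
  assumes f: "dyadic K f"
  shows "dist_fn f c = real (card {i. i < 2 ^ K \<and> c < \<bar>f (real i / 2 ^ K)\<bar>}) / 2 ^ K"
proof -
  let ?g = "\<lambda>t. of_bool (c < \<bar>f t\<bar>) :: real"
  have g: "dyadic K ?g" by (rule dyadic_comp[OF f])
  have "dist_fn f c = (LINT t|I01. indicator {x \<in> {0..1}. c < \<bar>f x\<bar>} t)"
    unfolding dist_fn_def Bochner_Integration.integral_indicator
    by (rule arg_cong[of _ _ "measure I01"]) auto
  also have "\<dots> = (LINT t|I01. ?g t)" by (rule Bochner_Integration.integral_cong) (auto simp: indicator_def)
  also have "\<dots> = (\<Sum>i<2 ^ K. ?g (real i / 2 ^ K)) / 2 ^ K" by (rule dyadic_integral[OF g])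
  also have "(\<Sum>i<2 ^ K. ?g (real i / 2 ^ K)) = real (card {i. i < 2 ^ K \<and> c < \<bar>f (real i / 2 ^ K)\<bar>})"
    by (subst sum_of_bool_eq) (auto intro!: arg_cong[of _ _ card])
  finally show ?thesis .
qed

text \<open>The conditional expectation given the dyadic algebra of level \<open>k\<close>. At
  \<open>t = 1\<close> the integral is over a null set and the value is 0, so identities are stated
  for \<open>0 \<le> t < 1\<close>.\<close>

definition avg :: "nat \<Rightarrow> (real \<Rightarrow> real) \<Rightarrow> real \<Rightarrow> real" where
  "avg k f t = 2 ^ k * (LINT s|I01. of_bool (\<lfloor>2 ^ k * s\<rfloor> = \<lfloor>2 ^ k * t\<rfloor>) * f s)"

lemma dyadic_avg: "dyadic k (avg k f)"
  by (rule dyadicI) (simp only: avg_def)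

lemma xor_div_pow2: "r < 2 ^ m \<Longrightarrow> m \<le> n \<Longrightarrow> (xor i r) div 2 ^ n = i div 2 ^ n" for i r :: nat
proof -
  assume a: "r < 2 ^ m" "m \<le> n"
  have "(2::nat) ^ m \<le> 2 ^ n" using a(2) by simp
  then have "r < 2 ^ n" using a(1) by (rule order_less_le_trans[rotated])
  then have "drop_bit n r = 0" by (simp add: drop_bit_eq_div)
  then have "drop_bit n (xor i r) = drop_bit n i" by simp
  then show ?thesis by (simp only: drop_bit_eq_div)
qed

text \<open>Exclusive-or with numbers below \<open>2 ^ m\<close> changes the lowest \<open>m\<close>
  bits only and runs once through the block of \<open>i\<close>. One \<open>r\<close> acts on all
  blocks at once and, unlike a translation, leaves each of them invariant.\<close>

lemma bij_betw_xor:
  fixes i :: nat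
  shows "bij_betw (\<lambda>r. xor i r) {..<2 ^ m} {j. j div 2 ^ m = i div 2 ^ m}"
proof (rule bij_betw_byWitness[where f'="\<lambda>j. xor i j"])
  have inv: "xor i (xor i r) = r" for r
    by (simp add: xor.assoc[symmetric])
  show "\<forall>r\<in>{..<2 ^ m}. xor i (xor i r) = r" "\<forall>r\<in>{j. j div 2 ^ m = i div 2 ^ m}. xor i (xor i r) = r"
    using inv by auto
  show "xor i ` {..<2 ^ m} \<subseteq> {j. j div 2 ^ m = i div 2 ^ m}" using xor_div_pow2[of _ m m i] by auto
  show "xor i ` {j. j div 2 ^ m = i div 2 ^ m} \<subseteq> {..<2 ^ m}"
  proof (intro subsetI, elim imageE)
    fix y j assume "y = xor i j" "j \<in> {j. j div 2 ^ m = i div 2 ^ m}"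
    then have "drop_bit m j = drop_bit m i" by (simp only: drop_bit_eq_div mem_Collect_eq)
    then have "drop_bit m (xor i j) = 0" by simp
    then have "xor i j div 2 ^ m = 0" by (simp only: drop_bit_eq_div)
    then show "y \<in> {..<2 ^ m}" using \<open>y = xor i j\<close> by (simp add: div_eq_0_iff)
  qed
qed

lemma avg_grid:
  assumes f: "dyadic K f" and k: "k \<le> K" and i: "i < 2 ^ K"
  shows "avg k f (real i / 2 ^ K) = (\<Sum>r<2 ^ (K - k). f (real (xor i r) / 2 ^ K)) / 2 ^ (K - k)"
proof -
  let ?M = "2 ^ (K - k) :: nat"
  let ?g = "\<lambda>s. of_bool (\<lfloor>2 ^ k * s\<rfloor> = \<lfloor>2 ^ k * (real i / 2 ^ K)\<rfloor>) * f s"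
  have "dyadic K ?g"
  proof (rule dyadicI)
    fix s t :: real assume st: "\<lfloor>2 ^ K * s\<rfloor> = \<lfloor>2 ^ K * t\<rfloor>"
    show "?g s = ?g t" unfolding floor_dyadic_mono[OF k st] dyadic_eq[OF f st] ..
  qed
  then have "avg k f (real i / 2 ^ K) = 2 ^ k * ((\<Sum>j<2 ^ K. ?g (real j / 2 ^ K)) / 2 ^ K)"
    unfolding avg_def by (simp only: dyadic_integral)
  also have "(\<Sum>j<2 ^ K. ?g (real j / 2 ^ K)) = (\<Sum>j | j div ?M = i div ?M. f (real j / 2 ^ K))"
  proof (rule sum.mono_neutral_cong_right)
    have M: "?M * 2 ^ k = 2 ^ K" using k by (simp flip: power_add)
    show "{j. j div ?M = i div ?M} \<subseteq> {..<2 ^ K}"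
    proof
      fix j assume "j \<in> {j. j div ?M = i div ?M}"
      then have "j div ?M = i div ?M" by simp
      moreover have "i div ?M < 2 ^ k"
        by (rule less_mult_imp_div_less) (use i M in \<open>simp only: mult.commute\<close>)
      ultimately have "j div ?M < 2 ^ k" by (simp only:)
      then have "j < 2 ^ k * ?M" using div_less_iff_less_mult[of ?M j "2 ^ k"] by simp
      then show "j \<in> {..<2 ^ K}" using M by (simp add: mult.commute)
    qed
  qed (simp_all only: floor_grid[OF k], auto)
  also have "\<dots> = (\<Sum>r<?M. f (real (xor i r) / 2 ^ K))"
    by (rule sum.reindex_bij_betw[OF bij_betw_xor, symmetric])
  finally show ?thesis using k by (simp add: power_diff field_simps)
qed

text \<open>Exclusive-or with \<open>r < 2 ^ (K - k)\<close> permutes the grid and preserves the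
  values of \<open>v\<close>, so each of the terms being averaged contributes the same sum.\<close>

lemma sum_avg_grid:
  assumes f: "dyadic K f" and k: "k \<le> K" and v: "dyadic k v"
  shows "(\<Sum>i<2 ^ K. v (real i / 2 ^ K) * avg k f (real i / 2 ^ K)) = (\<Sum>i<2 ^ K. v (real i / 2 ^ K) * f (real i / 2 ^ K))"
proof -
  let ?M = "2 ^ (K - k) :: nat" and ?x = "\<lambda>i::nat. real i / 2 ^ K"
  have bij: "bij_betw (\<lambda>i. xor i r) {..<2 ^ K} {..<2 ^ K}" if "r < ?M" for r :: nat
  proof (rule bij_betw_byWitness[where f'="\<lambda>i. xor i r"])
    have le: "(2::nat) ^ (K - k) \<le> 2 ^ K" by simp
    have "xor i r < 2 ^ K" if "i < 2 ^ K" for i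
      using xor_div_pow2[of r "K - k" K i] \<open>r < ?M\<close> that by (simp add: div_eq_0_iff)
    then show "(\<lambda>i. xor i r) ` {..<2 ^ K} \<subseteq> {..<2 ^ K}" "(\<lambda>i. xor i r) ` {..<2 ^ K} \<subseteq> {..<2 ^ K}" by auto
  qed (auto simp: xor.assoc)
  have vx: "v (?x (xor i r)) = v (?x i)" if "r < ?M" for i r
    by (rule dyadic_eq[OF v]) (simp only: floor_grid[OF k] xor_div_pow2[OF that order_refl])
  have "(\<Sum>i<2 ^ K. v (?x i) * avg k f (?x i)) = (\<Sum>i<2 ^ K. \<Sum>r<?M. v (?x i) * f (?x (xor i r)) / ?M)"
    by (intro sum.cong) (auto simp: avg_grid[OF f k] sum_distrib_left sum_divide_distrib)
  also have "\<dots> = (\<Sum>r<?M. \<Sum>i<2 ^ K. v (?x i) * f (?x (xor i r)) / ?M)" by (rule sum.swap)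
  also have "\<dots> = (\<Sum>r<?M. \<Sum>i<2 ^ K. v (?x (xor i r)) * f (?x (xor i r)) / ?M)"
    by (intro sum.cong) (auto simp: vx)
  also have "\<dots> = (\<Sum>r<?M. \<Sum>i<2 ^ K. v (?x i) * f (?x i) / ?M)"
    by (rule sum.cong[OF refl], rule sum.reindex_bij_betw, rule bij) simp
  finally show ?thesis by (simp add: sum_divide_distrib[symmetric])
qed

text \<open>A rearrangement that permutes the cells of level \<open>K\<close>; for
  \<open>r < 2 ^ (K - k)\<close> each interval of level \<open>k\<close> in \<open>[0,1)\<close> is
  mapped to itself.\<close>

definition shift :: "nat \<Rightarrow> nat \<Rightarrow> (real \<Rightarrow> real) \<Rightarrow> real \<Rightarrow> real" where
  "shift K r f t = f (real (xor (nat \<lfloor>2 ^ K * t\<rfloor>) r) / 2 ^ K)"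

lemma dyadic_shift: "dyadic K (shift K r f)"
  by (rule dyadicI) (simp only: shift_def)

lemma dist_fn_shift:
  assumes f: "dyadic K f" and r: "r < 2 ^ K"
  shows "dist_fn (shift K r f) c = dist_fn f c"
proof -
  have lt: "xor i r < 2 ^ K" if "i < 2 ^ K" for i
    using xor_div_pow2[of r K K i] r that by (simp add: div_eq_0_iff)
  have "bij_betw (\<lambda>i. xor i r) {i. i < 2 ^ K \<and> c < \<bar>shift K r f (real i / 2 ^ K)\<bar>} {i. i < 2 ^ K \<and> c < \<bar>f (real i / 2 ^ K)\<bar>}"
    by (rule bij_betw_byWitness[where f'="\<lambda>i. xor i r"]) (use lt in \<open>auto simp: xor.assoc shift_def\<close>)
  then show ?thesis unfolding dyadic_dist_fn[OF f] dyadic_dist_fn[OF dyadic_shift]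
    using bij_betw_same_card by fastforce
qed

text \<open>The conditional expectation as an average of equimeasurable functions, which makes norm
  estimates possible. The function \<open>\<phi>\<close> lets the same shifts of \<open>f\<close>
  serve for powers of \<open>f\<close>.\<close>

lemma avg_shift:
  assumes f: "dyadic K f" and k: "k \<le> K" and t: "0 \<le> t" "t < 1"
  shows "avg k (\<lambda>s. \<phi> (f s)) t = (\<Sum>r<2 ^ (K - k). \<phi> (shift K r f t)) / 2 ^ (K - k)"
proof -
  let ?i = "nat \<lfloor>2 ^ K * t\<rfloor>"
  have d: "dyadic K (\<lambda>s. \<phi> (f s))" by (rule dyadic_comp[OF f])
  have "avg k (\<lambda>s. \<phi> (f s)) t = avg k (\<lambda>s. \<phi> (f s)) (real ?i / 2 ^ K)"
    by (rule dyadic_eq[OF dyadic_mono[OF k dyadic_avg]]) (rule grid_index(2)[OF t])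
  also have "\<dots> = (\<Sum>r<2 ^ (K - k). \<phi> (f (real (xor ?i r) / 2 ^ K))) / 2 ^ (K - k)"
    by (rule avg_grid[OF d k grid_index(1)[OF t]])
  finally show ?thesis by (simp add: shift_def)
qed

section \<open>The maximal inequality\<close>

lemma powr_sum_le:
  fixes b :: "'a \<Rightarrow> real"
  assumes "\<And>i. i \<in> A \<Longrightarrow> 0 \<le> b i" "0 < q" "q \<le> 1"
  shows "(\<Sum>i\<in>A. b i) powr q \<le> (\<Sum>i\<in>A. b i powr q)"
  using assms(1)
proof (induction A rule: infinite_finite_induct)
  case (insert a A)
  have "(b a + (\<Sum>i\<in>A. b i)) powr q \<le> b a powr q + (\<Sum>i\<in>A. b i) powr q"
    by (rule powr_add_le) (use insert assms in \<open>auto intro: sum_nonneg\<close>)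
  then show ?case using insert by fastforce
qed auto

context ri_space
begin

lemma dyadic_X: "dyadic k f \<Longrightarrow> f \<in> X"
  using dyadic_bounded[of k f] bounded_X[OF dyadic_L0] by metis

lemma norm_shift:
  assumes f: "dyadic K f" and r: "r < 2 ^ K"
  shows "N (shift K r f) = N f"
  by (rule norm_eq_dist(2)[OF dyadic_X[OF f] dyadic_L0[OF dyadic_shift]]) (rule dist_fn_shift[OF f r])

lemma norm_cong_01:
  assumes "f \<in> X" "g \<in> L0" "\<And>t. 0 \<le> t \<Longrightarrow> t < 1 \<Longrightarrow> f t = g t"
  shows "N g = N f"
  by (rule norm_cong[THEN conjunct2, OF assms(1,2)])
    (use eventually_mono[OF AE_I01_less_1] assms(3) in \<open>simp\<close>)

lemma norm_avg_dyadic: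
  assumes f: "dyadic K f" and k: "k \<le> K"
  shows "N (avg k f) \<le> N f"
proof -
  let ?M = "2 ^ (K - k) :: nat"
  have M: "?M \<le> 2 ^ K" by simp
  have sX: "shift K r f \<in> X" for r by (rule dyadic_X[OF dyadic_shift])
  have s'X: "(\<lambda>t. (1 / ?M) * shift K r f t) \<in> X" for r by (rule scale[OF sX])
  have "N (avg k f) = N (\<lambda>t. \<Sum>r<?M. (1 / ?M) * shift K r f t)"
    by (rule norm_cong_01[OF sum_X[OF s'X] dyadic_L0[OF dyadic_avg]])
      (simp add: avg_shift[OF f k, of _ "\<lambda>x. x"] sum_divide_distrib)
  also have "\<dots> \<le> (\<Sum>r<?M. N (\<lambda>t. (1 / ?M) * shift K r f t))" by (rule norm_sum[OF s'X])
  also have "\<dots> = (\<Sum>r<?M. N f / ?M)"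
  proof (rule sum.cong[OF refl])
    fix r assume "r \<in> {..<?M}"
    then have "r < 2 ^ K" using M by (auto intro: order_less_le_trans)
    then show "N (\<lambda>t. (1 / ?M) * shift K r f t) = N f / ?M"
      using norm_scale[OF sX, of "1 / ?M" r] norm_shift[OF f] by simp
  qed
  finally show ?thesis by simp
qed

lemma p_function_X:
  fixes p :: real
  assumes p: "1 \<le> p" and f: "\<And>i. i < n \<Longrightarrow> f i \<in> X"
  shows "(\<lambda>t. (\<Sum>i<(n::nat). \<bar>f i t\<bar> powr p) powr (1 / p)) \<in> X"
proof (rule idealD[OF _ sum_X[of "{..<n}" "\<lambda>i t. \<bar>f i t\<bar>"]])
  have "f i \<in> L0" if "i < n" for i using X_L0[OF f[OF that]] .
  then have "(\<lambda>t. \<Sum>i<n. \<bar>f i t\<bar> powr p) \<in> L0"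
    by (intro borel_measurable_sum) auto
  then show "(\<lambda>t. (\<Sum>i<n. \<bar>f i t\<bar> powr p) powr (1 / p)) \<in> L0" by measurable
  have "(\<Sum>i<n. \<bar>f i t\<bar> powr p) powr (1 / p) \<le> (\<Sum>i<n. \<bar>f i t\<bar>)" for t
  proof -
    have "(\<Sum>i<n. \<bar>f i t\<bar> powr p) powr (1 / p) \<le> (\<Sum>i<n. (\<bar>f i t\<bar> powr p) powr (1 / p))"
      by (rule powr_sum_le) (use p in auto)
    then show ?thesis using p by (simp add: powr_powr)
  qed
  then show "AE t in I01. \<bar>(\<Sum>i<n. \<bar>f i t\<bar> powr p) powr (1 / p)\<bar> \<le> \<bar>\<Sum>i<n. \<bar>f i t\<bar>\<bar>"
    by (intro AE_I2) (simp add: sum_nonneg)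
qed (use f abs_X in auto)

end

text \<open>The last condition says that \<open>d j\<close> has conditional mean zero given the dyadic algebra of level \<open>a j\<close>.\<close>

definition dyadic_differences :: "(nat \<Rightarrow> nat) \<Rightarrow> (nat \<Rightarrow> nat) \<Rightarrow> (nat \<Rightarrow> real \<Rightarrow> real) \<Rightarrow> bool" where
  "dyadic_differences a b d \<longleftrightarrow> (\<forall>j. a j \<le> b j \<and> b j \<le> a (Suc j) \<and> dyadic (b j) (d j) \<and>
     (\<forall>w. dyadic (a j) w \<longrightarrow> (LINT t|I01. w t * d j t) = 0))"

text \<open>The Boyd index acts from here on only through \<open>small_dilation\<close>; the cap on
  \<open>p\<close> is justified by \<open>p_convex_mono\<close>.\<close>

locale boyd_convex_space = ri_space +
  fixes p C :: real
  assumes p: "1 < p" "p \<le> 2" and C: "0 < C"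
    and p_convexity: "\<And>(n::nat) f. (\<And>i. i < n \<Longrightarrow> f i \<in> X) \<Longrightarrow>
        N (\<lambda>t. (\<Sum>i<n. \<bar>f i t\<bar> powr p) powr (1 / p)) \<le> C * (\<Sum>i<n. N (f i) powr p) powr (1 / p)"
    and small_dilation: "\<And>e. 0 < e \<Longrightarrow> \<exists>r. 0 < r \<and> r \<le> 1 \<and> (\<forall>f\<in>X. N (dilation r f) \<le> e * N f)"
begin

text \<open>A conditional expectation over a finite dyadic algebra is an average of rearrangements,
  so \<open>p\<close>-convexity bounds the conditional \<open>p\<close>-function.\<close>

lemma norm_cond_p_function:
  assumes f: "dyadic K f" and k: "k \<le> K"
  shows "N (\<lambda>t. avg k (\<lambda>s. \<bar>f s\<bar> powr p) t powr (1 / p)) \<le> C * N f"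
proof -
  let ?M = "2 ^ (K - k) :: nat"
  have M: "?M \<le> 2 ^ K" "0 < ?M" by auto
  \<comment> \<open>With \<open>m powr p = 1 / 2 ^ (K - k)\<close> the \<open>p\<close>-function of
    the scaled shifts is the \<open>p\<close>-th root of their average, that is, of the conditional
    expectation.\<close>
  define m where "m = real ?M powr (- (1 / p))"
  have "m powr p = real ?M powr (- 1)" unfolding m_def powr_powr using p by simp
  then have m: "0 < m" "m powr p = 1 / ?M" by (auto simp: m_def powr_neg_one)
  have sX: "shift K r f \<in> X" for r by (rule dyadic_X[OF dyadic_shift])
  have s'X: "(\<lambda>t. m * shift K r f t) \<in> X" for r by (rule scale[OF sX])
  have eq: "(\<Sum>r<?M. \<bar>m * shift K r f t\<bar> powr p) powr (1 / p) = avg k (\<lambda>s. \<bar>f s\<bar> powr p) t powr (1 / p)"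
    if "0 \<le> t" "t < 1" for t
  proof -
    have "\<bar>m * shift K r f t\<bar> powr p = \<bar>shift K r f t\<bar> powr p / ?M" for r
      using m by (simp add: abs_mult powr_mult)
    then show ?thesis unfolding avg_shift[OF f k that, of "\<lambda>x. \<bar>x\<bar> powr p"]
      by (simp add: sum_divide_distrib)
  qed
  have L: "(\<lambda>t. avg k (\<lambda>s. \<bar>f s\<bar> powr p) t powr (1 / p)) \<in> L0"
    using dyadic_L0[OF dyadic_avg] by measurable
  have "N (\<lambda>t. avg k (\<lambda>s. \<bar>f s\<bar> powr p) t powr (1 / p)) = N (\<lambda>t. (\<Sum>r<?M. \<bar>m * shift K r f t\<bar> powr p) powr (1 / p))"
    by (rule norm_cong_01[OF p_function_X[OF _ s'X] L eq]) (use p in simp)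
  also have "\<dots> \<le> C * (\<Sum>r<?M. N (\<lambda>t. m * shift K r f t) powr p) powr (1 / p)"
    by (rule p_convexity[OF s'X])
  also have "(\<Sum>r<?M. N (\<lambda>t. m * shift K r f t) powr p) = (\<Sum>r<?M. N f powr p / ?M)"
  proof (rule sum.cong[OF refl])
    fix r assume "r \<in> {..<?M}"
    then have "r < 2 ^ K" using M by (auto intro: order_less_le_trans)
    then show "N (\<lambda>t. m * shift K r f t) powr p = N f powr p / ?M"
      using norm_scale[OF sX, of m r] norm_shift[OF f, of r] m norm_nonneg[OF dyadic_X[OF f]]
      by (simp add: powr_mult)
  qed
  also have "\<dots> powr (1 / p) = N f"
    using p norm_nonneg[OF dyadic_X[OF f]] by (simp add: powr_powr)
  finally show ?thesis .
qed

text \<open>The constant \<open>D\<close> is fixed before everything else, and bounds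
  \<open>\<kappa>\<close> stand in for the norms, so that one constant serves all weighted blocks of
  a martingale.\<close>

lemma maximal_inequality:
  "\<exists>D>0. \<forall>(n::nat) a b d \<kappa>. dyadic_differences a b d \<longrightarrow> (\<forall>j. N (d j) \<le> \<kappa> j) \<longrightarrow>
    N (\<lambda>t. MAX m\<in>{..n}. \<bar>\<Sum>j<m. d j t\<bar>) \<le> D * (\<Sum>j<n. \<kappa> j powr p) powr (1 / p)"
proof -
  \<comment> \<open>The value for \<open>b = 3\<close> in \<open>norm_good_lambda\<close>, the ratio
    of the two levels in \<open>good_lambda\<close>.\<close>
  obtain r where r: "0 < r" "r \<le> 1" "\<forall>f\<in>X. N (dilation r f) \<le> 1 / (4 * 3) * N f"
    using small_dilation[of "1 / (4 * 3)"] by auto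
  \<comment> \<open>As \<open>e \<le> 1 < p\<close>, the coefficient \<open>4 * e powr p\<close> is
    at most \<open>4 * e = r\<close>.\<close>
  define e where "e = r / 4"
  have e: "0 < e" "e \<le> 1" using r by (auto simp: e_def)
  have er: "4 * e powr p \<le> r"
  proof -
    have "e powr p \<le> e powr 1" by (rule powr_mono') (use e p in auto)
    then show ?thesis using e by (simp add: e_def)
  qed
  \<comment> \<open>\<open>4 * 3 / e\<close> is the factor from \<open>norm_good_lambda\<close>. For
    the predictable \<open>p\<close>-function, p-convexity is used once for the sum and once for
    each conditional expectation, giving \<open>C * C\<close>; the other \<open>p\<close>-function
    costs \<open>C\<close>.\<close>
  define D where "D = 4 * 3 / e * (C * C + C)"
  have D: "0 < D" using e C unfolding D_def by (intro mult_pos_pos add_pos_pos) auto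
  have main: "N (\<lambda>t. MAX m\<in>{..n}. \<bar>\<Sum>j<m. d j t\<bar>) \<le> D * (\<Sum>j<n. \<kappa> j powr p) powr (1 / p)"
    if dd: "dyadic_differences a b d" and \<kappa>: "\<And>j. N (d j) \<le> \<kappa> j"
    for n :: nat and a b :: "nat \<Rightarrow> nat" and d :: "nat \<Rightarrow> real \<Rightarrow> real" and \<kappa>
  proof -
    have ab: "\<And>j. a j \<le> b j" "\<And>j. b j \<le> a (Suc j)" and d: "\<And>j. dyadic (b j) (d j)"
      and mz: "\<And>j w. dyadic (a j) w \<Longrightarrow> (LINT t|I01. w t * d j t) = 0"
      using dd unfolding dyadic_differences_def by blast+
    have a_mono: "a i \<le> a j" if "i \<le> j" for i j
      by (rule lift_Suc_mono_le[OF _ that]) (use ab order_trans in blast)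
    have ba: "b i \<le> a j" if "i < j" for i j using ab(2)[of i] a_mono[of "Suc i" j] that by simp
    define K where "K = a n"
    have bK: "b j \<le> K" if "j < n" for j using ba[OF that] by (simp add: K_def)
    have aK: "a j \<le> K" if "j < n" for j using bK[OF that] ab(1)[of j] by simp
    define W where "W j = avg (a j) (\<lambda>s. \<bar>d j s\<bar> powr p)" for j
    have Wd: "dyadic (a j) (W j)" for j unfolding W_def by (rule dyadic_avg)
    have W0: "0 \<le> W j t" for j t unfolding W_def avg_def by (intro mult_nonneg_nonneg Bochner_Integration.integral_nonneg) auto
    let ?x = "\<lambda>i::nat. real i / 2 ^ K"
    \<comment> \<open>The grid resolves the first \<open>n\<close> differences only, while the
      locale speaks of all indices; the later ones are set to zero.\<close>
    define dn where "dn j i = (if j < n then d j (?x i) else 0)" for j i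
    define Wn where "Wn j i = (if j < n then W j (?x i) else 0)" for j i
    define pj where "pj j i = \<lfloor>2 ^ a j * ?x i\<rfloor>" for j and i :: nat
    \<comment> \<open>A grid function that is constant on the atoms of stage \<open>j\<close> is
      extended to a step function by its value at the left end of each atom, so that the hypothesis
      on integrals applies to it.\<close>
    have ext: "\<exists>w. dyadic (a j) w \<and> (\<forall>i<2 ^ K. w (?x i) = v i)"
      if v: "\<And>x y. x \<in> {..<2 ^ K} \<Longrightarrow> y \<in> {..<2 ^ K} \<Longrightarrow> pj j x = pj j y \<Longrightarrow> v x = v y" and j: "j < n"
      for v :: "nat \<Rightarrow> real" and j
    proof (intro exI[of _ "\<lambda>t. v (nat \<lfloor>2 ^ a j * t\<rfloor> * 2 ^ (K - a j))"] conjI allI impI)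
      show "dyadic (a j) (\<lambda>t. v (nat \<lfloor>2 ^ a j * t\<rfloor> * 2 ^ (K - a j)))" by (rule dyadicI) (simp only:)
    next
      fix i :: nat assume i: "i < 2 ^ K"
      let ?i = "i div 2 ^ (K - a j) * 2 ^ (K - a j)"
      have le: "?i \<le> i" by (rule div_times_less_eq_dividend)
      have "v ?i = v i"
        by (rule v) (use i le order_le_less_trans in \<open>auto simp only: pj_def floor_grid[OF aK[OF j]] lessThan_iff nonzero_mult_div_cancel_right power_not_zero\<close>, simp_all)
      then show "v (nat \<lfloor>2 ^ a j * ?x i\<rfloor> * 2 ^ (K - a j)) = v i"
        by (simp only: floor_grid[OF aK[OF j]] nat_int)
    qed
    have int0: "(\<Sum>i<2 ^ K. f (?x i)) = 0" if "dyadic K f" "(LINT t|I01. f t) = 0" for f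
      using dyadic_integral[OF that(1)] that(2) by simp
    interpret finite_martingale "{..<2 ^ K :: nat}" pj dn Wn p
    proof
      fix i j x y :: nat assume "i < j" "pj j x = pj j y"
      then show "dn i x = dn i y"
        unfolding dn_def pj_def by (auto intro: dyadic_eq[OF dyadic_mono[OF ba d]])
    next
      fix i j x y :: nat assume "i \<le> j" "pj j x = pj j y"
      then show "Wn i x = Wn i y"
        unfolding Wn_def pj_def by (auto intro: dyadic_eq[OF dyadic_mono[OF a_mono Wd]])
    next
      fix j and v :: "nat \<Rightarrow> real"
      assume v: "\<And>x y. x \<in> {..<2 ^ K} \<Longrightarrow> y \<in> {..<2 ^ K} \<Longrightarrow> pj j x = pj j y \<Longrightarrow> v x = v y"
      show "(\<Sum>x\<in>{..<2 ^ K}. v x * dn j x) = 0"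
      proof (cases "j < n")
        case True
        obtain w where w: "dyadic (a j) w" "\<forall>i<2 ^ K. w (?x i) = v i" using ext[where v=v and j=j, OF v True] by blast
        have "(\<Sum>i<2 ^ K. w (?x i) * d j (?x i)) = 0"
          by (rule int0[OF dyadic_comp2[OF dyadic_mono[OF aK[OF True] w(1)] dyadic_mono[OF bK[OF True] d]] mz[OF w(1)]])
        moreover have "(\<Sum>x\<in>{..<2 ^ K}. v x * dn j x) = (\<Sum>i<2 ^ K. w (?x i) * d j (?x i))"
          by (rule sum.cong) (use w True in \<open>auto simp: dn_def\<close>)
        ultimately show ?thesis by simp
      qed (simp add: dn_def)
      show "(\<Sum>x\<in>{..<2 ^ K}. v x * \<bar>dn j x\<bar> powr p) = (\<Sum>x\<in>{..<2 ^ K}. v x * Wn j x)"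
      proof (cases "j < n")
        case True
        obtain w where w: "dyadic (a j) w" "\<forall>i<2 ^ K. w (?x i) = v i" using ext[where v=v and j=j, OF v True] by blast
        have "(\<Sum>i<2 ^ K. w (?x i) * W j (?x i)) = (\<Sum>i<2 ^ K. w (?x i) * \<bar>d j (?x i)\<bar> powr p)"
          unfolding W_def by (rule sum_avg_grid[OF dyadic_comp[OF dyadic_mono[OF bK[OF True] d]] aK[OF True] w(1)])
        moreover have "(\<Sum>x\<in>{..<2 ^ K}. v x * \<bar>dn j x\<bar> powr p) = (\<Sum>i<2 ^ K. w (?x i) * \<bar>d j (?x i)\<bar> powr p)"
          by (rule sum.cong) (use w True in \<open>auto simp: dn_def\<close>)
        moreover have "(\<Sum>x\<in>{..<2 ^ K}. v x * Wn j x) = (\<Sum>i<2 ^ K. w (?x i) * W j (?x i))"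
          by (rule sum.cong) (use w True in \<open>auto simp: Wn_def\<close>)
        ultimately show ?thesis by simp
      qed (use p in \<open>simp add: dn_def Wn_def\<close>)
    qed (use p W0 in \<open>auto simp: Wn_def\<close>)
    define g where "g t = (MAX m\<in>{..n}. \<bar>\<Sum>j<m. d j t\<bar>)" for t
    define h1 where "h1 t = (\<Sum>j<n. \<bar>W j t powr (1 / p)\<bar> powr p) powr (1 / p)" for t
    define h2 where "h2 t = (\<Sum>j<n. \<bar>d j t\<bar> powr p) powr (1 / p)" for t
    \<comment> \<open>\<open>h1\<close> controls the sums of \<open>W\<close> and \<open>h2\<close>
      the individual jumps; \<open>good_lambda\<close> needs a single function that controls
      both.\<close>
    define h where "h t = h1 t + h2 t" for t
    have dK: "dyadic K (d j)" if "j < n" for j by (rule dyadic_mono[OF bK[OF that] d])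
    have WK: "dyadic K (W j)" if "j < n" for j by (rule dyadic_mono[OF aK[OF that] Wd])
    have h1K: "dyadic K h1" unfolding h1_def[abs_def]
      by (rule dyadic_comp[where \<phi>="\<lambda>x. x powr (1/p)"], rule dyadic_sum, rule dyadic_comp[OF WK]) simp
    have h2K: "dyadic K h2" unfolding h2_def[abs_def]
      by (rule dyadic_comp[where \<phi>="\<lambda>x. x powr (1/p)"], rule dyadic_sum, rule dyadic_comp[OF dK]) simp
    have hK: "dyadic K h" unfolding h_def[abs_def] by (rule dyadic_comp2[OF h1K h2K])
    have SK: "dyadic K (\<lambda>t. \<Sum>j<m. d j t)" if "m \<le> n" for m
      by (rule dyadic_sum) (use dK that in auto)
    have gK: "dyadic K g"
    proof (rule dyadicI)
      fix s t :: real assume "\<lfloor>2 ^ K * s\<rfloor> = \<lfloor>2 ^ K * t\<rfloor>"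
      then show "g s = g t" unfolding g_def
        by (intro arg_cong[of _ _ Max] image_cong refl arg_cong[of _ _ abs] dyadic_eq[OF SK]) auto
    qed
    have g_gt: "c < \<bar>g t\<bar> \<longleftrightarrow> (\<exists>i\<le>n. c < \<bar>\<Sum>j<i. d j t\<bar>)" for c t
    proof -
      have "0 \<le> g t" unfolding g_def
        by (rule order_trans[OF abs_ge_zero[of "\<Sum>j<0. d j t"] Max_ge]) (auto intro: image_eqI[of _ _ 0])
      then have "c < \<bar>g t\<bar> \<longleftrightarrow> c < g t" by simp
      also have "\<dots> \<longleftrightarrow> (\<exists>i\<le>n. c < \<bar>\<Sum>j<i. d j t\<bar>)"
        unfolding g_def by (subst Max_gr_iff) auto
      finally show ?thesis .
    qed
    have h0: "0 \<le> h t" for t unfolding h_def h1_def h2_def by simp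
    have Sn: "S m i = (\<Sum>j<m. d j (?x i))" if "m \<le> n" for m i
      unfolding S_def dn_def by (rule sum.cong) (use that in auto)
    have gl: "dist_fn g (3 * l) \<le> dist_fn h (e * l) + r * dist_fn g l" if l: "0 < l" for l
    proof -
      have "real (card {x \<in> {..<2 ^ K}. \<exists>i\<le>n. 3 * l < \<bar>S i x\<bar>})
        \<le> real (card {x \<in> {..<2 ^ K}. e * l < h (?x x)}) + 4 * e powr p * real (card {x \<in> {..<2 ^ K}. \<exists>i\<le>n. l < \<bar>S i x\<bar>})"
      proof (rule good_lambda[OF l e])
        fix x
        show "0 \<le> h (?x x)" by (rule h0)
        have "(\<Sum>j<n. Wn j x) = (\<Sum>j<n. \<bar>W j (?x x) powr (1 / p)\<bar> powr p)"
          using p W0 by (auto simp: Wn_def powr_powr intro!: sum.cong)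
        also have "\<dots> = h1 (?x x) powr p"
          unfolding h1_def using p by (simp add: powr_powr sum_nonneg)
        also have "\<dots> \<le> h (?x x) powr p"
          using p by (intro powr_mono2) (auto simp: h_def h1_def h2_def)
        finally show "(\<Sum>j<n. Wn j x) \<le> h (?x x) powr p" .
        fix j assume j: "j < n"
        have "\<bar>dn j x\<bar> = (\<bar>d j (?x x)\<bar> powr p) powr (1 / p)" using p j by (simp add: dn_def powr_powr)
        also have "\<dots> \<le> h2 (?x x)" unfolding h2_def
          by (intro powr_mono2 member_le_sum) (use p j in auto)
        also have "\<dots> \<le> h (?x x)" by (simp add: h_def h1_def)
        finally show "\<bar>dn j x\<bar> \<le> h (?x x)" .
      qed
      also have "{x \<in> {..<2 ^ K}. \<exists>i\<le>n. 3 * l < \<bar>S i x\<bar>} = {i. i < 2 ^ K \<and> 3 * l < \<bar>g (?x i)\<bar>}"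
        unfolding g_gt using Sn by auto
      also have "{x \<in> {..<2 ^ K}. \<exists>i\<le>n. l < \<bar>S i x\<bar>} = {i. i < 2 ^ K \<and> l < \<bar>g (?x i)\<bar>}"
        unfolding g_gt using Sn by auto
      also have "{x \<in> {..<2 ^ K}. e * l < h (?x x)} = {i. i < 2 ^ K \<and> e * l < \<bar>h (?x i)\<bar>}"
        using h0 by auto
      also have "4 * e powr p * real (card {i. i < 2 ^ K \<and> l < \<bar>g (?x i)\<bar>}) \<le> r * real (card {i. i < 2 ^ K \<and> l < \<bar>g (?x i)\<bar>})"
        using er by (intro mult_right_mono) auto
      finally show ?thesis
        unfolding dyadic_dist_fn[OF gK] dyadic_dist_fn[OF hK] by (simp add: field_simps)
    qed
    have hX: "h1 \<in> X" "h2 \<in> X" "h \<in> X" using dyadic_X h1K h2K hK by blast+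
    let ?s = "(\<Sum>j<n. \<kappa> j powr p) powr (1 / p)"
    have kap: "(\<Sum>j<n. (m * N (d j)) powr p) powr (1 / p) \<le> m * ?s" if m: "0 \<le> m" for m
    proof -
      have "(\<Sum>j<n. (m * N (d j)) powr p) \<le> (\<Sum>j<n. (m * \<kappa> j) powr p)"
        using p m \<kappa> norm_nonneg[OF dyadic_X[OF d]] by (intro sum_mono powr_mono2 mult_left_mono) auto
      also have "\<dots> = (\<Sum>j<n. m powr p * \<kappa> j powr p)" 
        using m order_trans[OF norm_nonneg[OF dyadic_X[OF d]] \<kappa>] by (simp add: powr_mult)
      also have "\<dots> = m powr p * (\<Sum>j<n. \<kappa> j powr p)" by (simp add: sum_distrib_left)
      finally have "(\<Sum>j<n. (m * N (d j)) powr p) powr (1 / p) \<le> (m powr p * (\<Sum>j<n. \<kappa> j powr p)) powr (1 / p)"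
        using p by (intro powr_mono2) (auto intro: sum_nonneg)
      also have "\<dots> = m * ?s" using m p by (simp add: powr_mult sum_nonneg powr_powr)
      finally show ?thesis .
    qed
    have "N h2 \<le> C * (\<Sum>j<n. N (d j) powr p) powr (1 / p)"
      unfolding h2_def[abs_def] by (rule p_convexity) (use dyadic_X[OF d] in auto)
    also have "\<dots> \<le> C * ?s" using kap[of 1] C by simp
    finally have N2: "N h2 \<le> C * ?s" .
    have WX: "(\<lambda>t. W j t powr (1 / p)) \<in> X" for j by (rule dyadic_X[OF dyadic_comp[OF Wd]])
    have "N h1 \<le> C * (\<Sum>j<n. N (\<lambda>t. W j t powr (1 / p)) powr p) powr (1 / p)"
      unfolding h1_def[abs_def] by (rule p_convexity) (rule WX)
    also have "(\<Sum>j<n. N (\<lambda>t. W j t powr (1 / p)) powr p) \<le> (\<Sum>j<n. (C * N (d j)) powr p)"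
      unfolding W_def by (intro sum_mono powr_mono2 norm_cond_p_function[OF d ab(1)])
        (use p norm_nonneg[OF WX] in \<open>auto simp: W_def\<close>)
    then have "C * (\<Sum>j<n. N (\<lambda>t. W j t powr (1 / p)) powr p) powr (1 / p) \<le> C * (\<Sum>j<n. (C * N (d j)) powr p) powr (1 / p)"
      using C p by (intro mult_left_mono powr_mono2) (auto intro: sum_nonneg)
    also have "\<dots> \<le> C * (C * ?s)" using kap[of C] C by (intro mult_left_mono) auto
    finally have N1: "N h1 \<le> C * (C * ?s)" .
    have "N g \<le> 4 * 3 / e * N h"
      by (rule norm_good_lambda[OF dyadic_X[OF gK] hX(3) _ e(1) r]) (use gl in auto)
    also have "\<dots> \<le> 4 * 3 / e * (C * (C * ?s) + C * ?s)"
    proof (rule mult_left_mono)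
      have "N h \<le> N h1 + N h2" unfolding h_def[abs_def] by (rule norm_triangle[OF hX(1,2)])
      then show "N h \<le> C * (C * ?s) + C * ?s" using N1 N2 by linarith
    qed (use e in simp)
    finally show ?thesis unfolding g_def[abs_def] D_def by (simp add: algebra_simps add_divide_distrib)
  qed
  show ?thesis
    by (rule exI[of _ D], intro conjI allI impI, rule D, rule main) auto
qed

end

section \<open>Dyadic approximation and integrability\<close>

text \<open>A measurable function is almost everywhere a limit of continuous ones. These are clipped
  to \<open>[-B,B]\<close>, which does not disturb the limit, and sampled at left grid points;
  uniform continuity on \<open>[0,1]\<close> tells how fine the grid must be for an error below
  \<open>1 / (n + 1)\<close>.\<close>

lemma dyadic_approximation:
  assumes u: "u \<in> L0" and B: "\<And>t. 0 \<le> t \<Longrightarrow> t \<le> 1 \<Longrightarrow> \<bar>u t\<bar> \<le> B"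
  shows "\<exists>v K. (\<forall>n. dyadic (K n) (v n) \<and> (\<forall>t. 0 \<le> t \<longrightarrow> t \<le> 1 \<longrightarrow> \<bar>v n t\<bar> \<le> B)) \<and> (AE t in I01. (\<lambda>n. v n t) \<longlonglongrightarrow> u t)"
proof -
  have B0: "0 \<le> B" using B[of 0] by auto
  have "u measurable_on {0..1}" using u by (subst measurable_on_iff_borel_measurable) auto
  then obtain Z g where Z: "negligible Z" and g: "\<And>n. continuous_on UNIV (g n)"
    and lim: "\<And>t. t \<notin> Z \<Longrightarrow> (\<lambda>n. g n t) \<longlonglongrightarrow> (if t \<in> {0..1} then u t else 0)"
    unfolding measurable_on_def by blast
  define c where "c n t = max (- B) (min B (g n t))" for n t
  have c_cont: "continuous_on {0..1} (c n)" for n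
    unfolding c_def[abs_def] by (intro continuous_intros continuous_on_subset[OF g]) auto
  have cB: "\<bar>c n t\<bar> \<le> B" for n t using B0 by (auto simp: c_def)
  have "\<exists>k. \<forall>s\<in>{0..1}. \<forall>t\<in>{0..1}. \<bar>s - t\<bar> \<le> 1 / 2 ^ k \<longrightarrow> \<bar>c n s - c n t\<bar> < 1 / real (Suc n)" for n
  proof -
    have "uniformly_continuous_on {0..1} (c n)"
      by (rule compact_uniformly_continuous[OF c_cont]) simp
    then obtain \<delta> where \<delta>: "0 < \<delta>"
      "\<And>s t. s \<in> {0..1} \<Longrightarrow> t \<in> {0..1} \<Longrightarrow> dist s t < \<delta> \<Longrightarrow> dist (c n s) (c n t) < 1 / real (Suc n)"
      unfolding uniformly_continuous_on_def by (metis dist_commute of_nat_0_less_iff zero_less_Suc zero_less_divide_1_iff)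
    obtain k where "(1/2) ^ k < \<delta>" using real_arch_pow_inv[OF \<delta>(1), of "1/2"] by auto
    then show ?thesis using \<delta>(2) by (intro exI[of _ k]) (auto simp: dist_real_def power_divide)
  qed
  then obtain K where K: "\<And>n s t. s \<in> {0..1} \<Longrightarrow> t \<in> {0..1} \<Longrightarrow> \<bar>s - t\<bar> \<le> 1 / 2 ^ K n \<Longrightarrow> \<bar>c n s - c n t\<bar> < 1 / real (Suc n)"
    by metis
  define v :: "nat \<Rightarrow> real \<Rightarrow> real" where "v n t = c n (of_int \<lfloor>2 ^ K n * t\<rfloor> / 2 ^ K n)" for n t
  have "dyadic (K n) (v n)" for n by (rule dyadicI) (simp only: v_def)
  moreover have "\<bar>v n t\<bar> \<le> B" for n t unfolding v_def by (rule cB)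
  moreover have "AE t in I01. (\<lambda>n. v n t) \<longlonglongrightarrow> u t"
  proof (rule AE_I')
    show "Z \<inter> {0..1} \<in> null_sets I01"
      using Z by (subst null_sets_restrict_space) (auto simp: negligible_iff_null_sets intro: null_set_Int2)
    show "{t \<in> space I01. \<not> (\<lambda>n. v n t) \<longlonglongrightarrow> u t} \<subseteq> Z \<inter> {0..1}"
    proof (rule subsetI, rule ccontr)
      fix t assume t: "t \<in> {t \<in> space I01. \<not> (\<lambda>n. v n t) \<longlonglongrightarrow> u t}" "t \<notin> Z \<inter> {0..1}"
      then have t01: "t \<in> {0..1}" "t \<notin> Z" by auto
      have "(\<lambda>n. g n t) \<longlonglongrightarrow> u t" using lim[OF t01(2)] t01(1) by simp
      then have "(\<lambda>n. c n t) \<longlonglongrightarrow> max (- B) (min B (u t))" unfolding c_def by (intro tendsto_intros)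
      also have "max (- B) (min B (u t)) = u t" using B[of t] t01(1) by auto
      finally have ct: "(\<lambda>n. c n t) \<longlonglongrightarrow> u t" .
      have "\<bar>v n t - c n t\<bar> \<le> 1 / real (Suc n)" for n
      proof -
        let ?s = "of_int \<lfloor>2 ^ K n * t\<rfloor> / 2 ^ K n :: real"
        have fl: "of_int \<lfloor>2 ^ K n * t\<rfloor> \<le> 2 ^ K n * t" "2 ^ K n * t < of_int \<lfloor>2 ^ K n * t\<rfloor> + 1" by linarith+
        then have s: "?s \<le> t" "t \<le> ?s + 1 / 2 ^ K n" by (auto simp: field_simps)
        have "0 \<le> ?s" using t01 by simp
        then have "?s \<in> {0..1}" using s t01(1) unfolding atLeastAtMost_iff by linarith
        moreover have "\<bar>?s - t\<bar> \<le> 1 / 2 ^ K n" using s by linarith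
        ultimately have "\<bar>c n ?s - c n t\<bar> < 1 / real (Suc n)" using K t01(1) by blast
        then show ?thesis unfolding v_def by linarith
      qed
      then have "(\<lambda>n. v n t - c n t) \<longlonglongrightarrow> 0"
        by (intro Lim_null_comparison[OF _ LIMSEQ_Suc[OF lim_1_over_n]]) auto
      then have "(\<lambda>n. (v n t - c n t) + c n t) \<longlonglongrightarrow> 0 + u t" using ct by (intro tendsto_add)
      then show False using t by simp
    qed
  qed
  ultimately show ?thesis by blast
qed

lemma integrable_avg_one_interval:
  fixes f :: "real \<Rightarrow> real"
  assumes "integrable I01 f"
  shows "integrable I01 (\<lambda>s. of_bool (\<lfloor>2 ^ k * s\<rfloor> = \<lfloor>2 ^ k * t\<rfloor>) * f s)"
proof (rule Bochner_Integration.integrable_bound[OF assms])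
  have "(\<lambda>s. of_bool (\<lfloor>2 ^ k * s\<rfloor> = \<lfloor>2 ^ k * t\<rfloor>) :: real) \<in> L0"
    by (rule dyadic_L0[of k], rule dyadicI) simp
  then show "(\<lambda>s. of_bool (\<lfloor>2 ^ k * s\<rfloor> = \<lfloor>2 ^ k * t\<rfloor>) * f s) \<in> L0"
    using borel_measurable_integrable[OF assms] by (rule borel_measurable_times)
qed auto

lemma avg_diff:
  fixes f g :: "real \<Rightarrow> real"
  assumes "integrable I01 f" "integrable I01 g"
  shows "avg k (\<lambda>t. f t - g t) t = avg k f t - avg k g t"
  unfolding avg_def right_diff_distrib
    Bochner_Integration.integral_diff[OF integrable_avg_one_interval[OF assms(1), of k t]
      integrable_avg_one_interval[OF assms(2), of k t]] ..

lemma avg_abs_le: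
  fixes f :: "real \<Rightarrow> real"
  assumes "integrable I01 f"
  shows "\<bar>avg k f t\<bar> \<le> 2 ^ k * (LINT s|I01. \<bar>f s\<bar>)"
proof -
  have "\<bar>LINT s|I01. of_bool (\<lfloor>2 ^ k * s\<rfloor> = \<lfloor>2 ^ k * t\<rfloor>) * f s\<bar>
      \<le> (LINT s|I01. \<bar>of_bool (\<lfloor>2 ^ k * s\<rfloor> = \<lfloor>2 ^ k * t\<rfloor>) * f s\<bar>)"
    by (rule integral_abs_bound)
  also have "\<dots> \<le> (LINT s|I01. \<bar>f s\<bar>)"
    using assms by (intro integral_mono integrable_abs integrable_avg_one_interval) auto
  finally show ?thesis unfolding avg_def by (simp add: abs_mult)
qed

lemma integral_mult_avg:
  fixes w :: "real \<Rightarrow> real"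
  assumes v: "dyadic k v" and w: "integrable I01 w"
  shows "(LINT t|I01. v t * avg k w t) = (LINT t|I01. v t * w t)"
proof -
  let ?x = "\<lambda>i::nat. real i / 2 ^ k"
  let ?w = "\<lambda>i t. of_bool (\<lfloor>2 ^ k * t\<rfloor> = \<lfloor>2 ^ k * ?x i\<rfloor>) * w t"
  have int: "integrable I01 (\<lambda>t. v (?x i) * ?w i t)" for i
    by (rule integrable_mult_right) (rule integrable_avg_one_interval[OF w])
  have "(LINT t|I01. v t * w t) = (LINT t|I01. (\<Sum>i<2 ^ k. v (?x i) * ?w i t))"
  proof (rule integral_cong_AE)
    show "(\<lambda>t. v t * w t) \<in> L0"
      using dyadic_L0[OF v] borel_measurable_integrable[OF w] by (rule borel_measurable_times)
    show "(\<lambda>t. \<Sum>i<2 ^ k. v (?x i) * ?w i t) \<in> L0"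
      by (rule borel_measurable_integrable, rule Bochner_Integration.integrable_sum, rule int)
    show "AE t in I01. v t * w t = (\<Sum>i<2 ^ k. v (?x i) * ?w i t)"
      using AE_I01_less_1
    proof eventually_elim
      case (elim t)
      define j where "j = nat \<lfloor>2 ^ k * t\<rfloor>"
      have t: "0 \<le> t" "t < 1" using elim by auto
      have j: "j < 2 ^ k" "\<lfloor>2 ^ k * t\<rfloor> = int j"
        using grid_index(1)[OF t, of k] t by (auto simp: j_def)
      have "(\<Sum>i<2 ^ k. v (?x i) * ?w i t) = (\<Sum>i<2 ^ k. if i = j then v (?x j) * w t else 0)"
        by (rule sum.cong) (auto simp: j(2) floor_grid[of k k, simplified])
      also have "\<dots> = v (?x j) * w t" using j(1) by simp
      also have "v (?x j) = v t" by (rule dyadic_eq[OF v]) (simp add: j(2))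
      finally show ?case ..
    qed
  qed
  also have "\<dots> = (\<Sum>i<2 ^ k. v (?x i) * (LINT t|I01. ?w i t))"
    by (subst Bochner_Integration.integral_sum[OF int]) simp
  also have "\<dots> = (\<Sum>i<2 ^ k. v (?x i) * avg k w (?x i)) / 2 ^ k"
    unfolding sum_divide_distrib by (rule sum.cong) (simp_all add: avg_def)
  also have "\<dots> = (LINT t|I01. v t * avg k w t)"
    by (rule dyadic_integral[OF dyadic_comp2[OF v dyadic_avg], symmetric])
  finally show ?thesis ..
qed

section \<open>Bounded convergence in norm and the embedding into Lp\<close>

context boyd_convex_space
begin

text \<open>The indicator of a set of measure at most \<open>r\<close> has a smaller distribution
  than the constant one dilated by \<open>r\<close>, and \<open>small_dilation\<close> makes the
  norm of the latter as small as desired.\<close>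

lemma norm_small_set:
  assumes e: "0 < e"
  shows "\<exists>d>0. \<forall>A\<in>sets I01. measure I01 A \<le> d \<longrightarrow> N (indicator A) \<le> e"
proof -
  obtain r where r: "0 < r" "r \<le> 1" "\<forall>f\<in>X. N (dilation r f) \<le> e / N (\<lambda>t. 1) * N f"
    using small_dilation[of "e / N (\<lambda>t. 1)"] e norm_one_pos by auto
  have N1: "N (dilation r (\<lambda>t. 1)) \<le> e" using r(3) one_X norm_one_pos by auto
  show ?thesis
  proof (intro exI[of _ r] conjI ballI impI)
    fix A assume A: "A \<in> sets I01" "measure I01 A \<le> r"
    have "N (indicator A) \<le> N (dilation r (\<lambda>t. 1))"
    proof (rule norm_le_dist(2)[OF dilation_X(1)[OF r(1,2) one_X]])
      fix c :: real assume c: "0 < c"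
      have "dist_fn (dilation r (\<lambda>t. 1)) c = r * dist_fn (\<lambda>t. 1) c"
        using c by (intro dist_fn_dilation r) auto
      also have "dist_fn (\<lambda>t. 1) c = (if c < 1 then 1 else 0)"
        by (simp del: atLeastAtMost_iff add: dist_fn_def)
      finally show "dist_fn (indicator A) c \<le> dist_fn (dilation r (\<lambda>t. 1)) c"
        using A c by (subst dist_fn_indicator) (auto simp: sets_I01_iff)
    qed (use A in simp)
    then show "N (indicator A) \<le> e" using N1 by linarith
  qed (use r in auto)
qed

text \<open>A form of order continuity for uniformly bounded sequences, available in both parts of
  the theorem: outside \<open>{\<eta> < |g n|}\<close> the function is small, and the measure of
  this set tends to zero by dominated convergence.\<close>

lemma norm_bounded_tendsto_0:
  assumes g: "\<And>n. g n \<in> L0" and B: "\<And>n t. 0 \<le> t \<Longrightarrow> t \<le> 1 \<Longrightarrow> \<bar>g n t\<bar> \<le> B"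
    and lim: "AE t in I01. (\<lambda>n. g n t) \<longlonglongrightarrow> 0"
  shows "(\<lambda>n. N (g n)) \<longlonglongrightarrow> 0"
proof (rule LIMSEQ_I)
  fix e :: real assume e: "0 < e"
  have B0: "0 \<le> B" using B[of 0 0] by auto
  \<comment> \<open>The constant part contributes \<open>e / 3\<close> and the exceptional set at
    most \<open>e / 3\<close>; \<open>B + 1\<close> below avoids a division by zero.\<close>
  define \<eta> where "\<eta> = e / (3 * N (\<lambda>t. 1))"
  have \<eta>: "0 < \<eta>" using e norm_one_pos by (simp add: \<eta>_def)
  obtain d where d: "0 < d" "\<And>A. A \<in> sets I01 \<Longrightarrow> measure I01 A \<le> d \<Longrightarrow> N (indicator A) \<le> e / (3 * (B + 1))"
    using norm_small_set[of "e / (3 * (B + 1))"] e B0 by auto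
  let ?A = "\<lambda>n. {x \<in> {0..1}. \<eta> < \<bar>g n x\<bar>}"
  have As: "?A n \<in> sets I01" for n by (rule dist_fn_sets[OF g])
  have "(\<lambda>n. LINT t|I01. indicator (?A n) t) \<longlonglongrightarrow> (LINT t|I01. (0::real))"
  proof (rule integral_dominated_convergence[where w="\<lambda>t. 1"])
    show "AE t in I01. (\<lambda>n. indicator (?A n) t) \<longlonglongrightarrow> (0::real)"
      using lim
    proof eventually_elim
      case (elim t)
      have "\<forall>\<^sub>F n in sequentially. \<bar>g n t\<bar> < \<eta>"
        using tendstoD[OF elim \<eta>] by (simp add: dist_real_def)
      then have "\<forall>\<^sub>F n in sequentially. indicator (?A n) t = (0::real)"
        by eventually_elim (auto simp: indicator_def)
      then show ?case by (rule tendsto_eventually)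
    qed
  qed (use As in \<open>auto intro!: AE_I2 borel_measurable_indicator simp: indicator_le_1\<close>)
  then have "(\<lambda>n. measure I01 (?A n)) \<longlonglongrightarrow> 0" using As by (simp add: Int_absorb2 subset_iff)
  then have "\<forall>\<^sub>F n in sequentially. measure I01 (?A n) < d" using d(1) by (rule order_tendstoD)
  then obtain n0 where n0: "\<And>n. n0 \<le> n \<Longrightarrow> measure I01 (?A n) < d" by (auto simp: eventually_sequentially)
  have "norm (N (g n) - 0) < e" if "n0 \<le> n" for n
  proof -
    have iX: "indicator (?A n) \<in> X"
      by (rule bounded_X[THEN conjunct1, of _ 1]) (use As in \<open>auto simp: indicator_def\<close>)
    have gX: "g n \<in> X" using bounded_X[OF g B] by blast
    have "N (g n) \<le> N (\<lambda>t. \<eta> + B * indicator (?A n) t)"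
    proof (rule norm_mono[OF g add[OF const_X scale[OF iX]]], rule AE_I2)
      fix t assume "t \<in> space I01"
      then show "\<bar>g n t\<bar> \<le> \<bar>\<eta> + B * indicator (?A n) t\<bar>"
        using B[of t n] \<eta> B0 by (auto simp: indicator_def)
    qed
    also have "\<dots> \<le> N (\<lambda>t. \<eta>) + N (\<lambda>t. B * indicator (?A n) t)"
      by (rule norm_triangle[OF const_X scale[OF iX]])
    also have "\<dots> = \<eta> * N (\<lambda>t. 1) + B * N (indicator (?A n))"
      using norm_const[of \<eta>] norm_scale[OF iX, of B] \<eta> B0 by simp
    also have "\<eta> * N (\<lambda>t. 1) = e / 3" using norm_one_pos by (simp add: \<eta>_def)
    also have "B * N (indicator (?A n)) \<le> B * (e / (3 * (B + 1)))"
      using d(2)[OF As] n0[OF that] B0 by (intro mult_left_mono) auto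
    also have "B * (e / (3 * (B + 1))) \<le> e / 3" using B0 e by (simp add: field_simps)
    finally show ?thesis using e norm_nonneg[OF gX] by simp
  qed
  then show "\<exists>no. \<forall>n\<ge>no. norm (N (g n) - 0) < e" by blast
qed

lemma integral_bounded_tendsto:
  assumes g: "\<And>n. g n \<in> L0" "h \<in> L0" and B: "\<And>n t. 0 \<le> t \<Longrightarrow> t \<le> 1 \<Longrightarrow> \<bar>g n t\<bar> \<le> B"
    and lim: "AE t in I01. (\<lambda>n. g n t) \<longlonglongrightarrow> h t"
  shows "(\<lambda>n. LINT t|I01. g n t) \<longlonglongrightarrow> (LINT t|I01. h t)"
  by (rule integral_dominated_convergence[where w="\<lambda>t. B"]) (use assms in \<open>auto intro!: AE_I2\<close>)

text \<open>Restricted to bounded functions, since step functions need not be dense in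
  \<open>X\<close>. The integral error keeps averages close, the norm error keeps the perturbation
  summable.\<close>

lemma dyadic_density:
  assumes u: "u \<in> L0" and B: "\<And>t. 0 \<le> t \<Longrightarrow> t \<le> 1 \<Longrightarrow> \<bar>u t\<bar> \<le> B" and e: "0 < e"
  shows "\<exists>K\<ge>k. \<exists>v. dyadic K v \<and> N (\<lambda>t. u t - v t) < e \<and> (LINT t|I01. \<bar>u t - v t\<bar>) < e"
proof -
  obtain v K where v: "\<And>n. dyadic (K n) (v n)" "\<And>n t. 0 \<le> t \<Longrightarrow> t \<le> 1 \<Longrightarrow> \<bar>v n t\<bar> \<le> B"
    "AE t in I01. (\<lambda>n. v n t) \<longlonglongrightarrow> u t"
    using dyadic_approximation[OF u B] by blast
  have L: "(\<lambda>t. u t - v n t) \<in> L0" for n using u dyadic_L0[OF v(1)] by measurable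
  have b: "\<bar>u t - v n t\<bar> \<le> 2 * B" if "0 \<le> t" "t \<le> 1" for n t
    using B[OF that] v(2)[OF that, of n] by linarith
  have lim: "AE t in I01. (\<lambda>n. u t - v n t) \<longlonglongrightarrow> 0"
    using v(3) by eventually_elim (auto intro!: tendsto_eq_intros)
  have "(\<lambda>n. N (\<lambda>t. u t - v n t)) \<longlonglongrightarrow> 0"
    by (rule norm_bounded_tendsto_0[OF L b lim])
  then have 1: "\<forall>\<^sub>F n in sequentially. N (\<lambda>t. u t - v n t) < e" using e by (rule order_tendstoD)
  have lim': "AE t in I01. (\<lambda>n. \<bar>u t - v n t\<bar>) \<longlonglongrightarrow> 0"
    using lim by eventually_elim (rule tendsto_rabs_zero)
  have "(\<lambda>n. LINT t|I01. \<bar>u t - v n t\<bar>) \<longlonglongrightarrow> (LINT t|I01. 0)"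
    by (rule integral_bounded_tendsto[OF _ _ _ lim', of "2 * B"]) (use L b in auto)
  then have 2: "\<forall>\<^sub>F n in sequentially. (LINT t|I01. \<bar>u t - v n t\<bar>) < e"
    using e by (intro order_tendstoD(2)[where y="LINT t|I01. (0::real)"]) auto
  obtain n where "N (\<lambda>t. u t - v n t) < e" "(LINT t|I01. \<bar>u t - v n t\<bar>) < e"
    using eventually_conj[OF 1 2] eventually_happens'[OF sequentially_bot] by blast
  then show ?thesis using dyadic_mono[OF _ v(1)[of n], of "max k (K n)"]
    by (intro exI[of _ "max k (K n)"] conjI exI[of _ "v n"]) auto
qed

definition Lp_const :: real where "Lp_const = C / N (\<lambda>t. 1)"

lemma Lp_const_pos: "0 < Lp_const"
  using C norm_one_pos by (simp add: Lp_const_def)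

text \<open>At level 0 the conditional \<open>p\<close>-function is constant on
  \<open>[0,1)\<close>, namely the \<open>p\<close>-norm of \<open>f\<close>. Its norm in
  \<open>X\<close> is therefore that number times the norm of the constant one, and
  \<open>norm_cond_p_function\<close> becomes an embedding into Lp.\<close>

lemma integral_powr_dyadic:
  assumes f: "dyadic K f"
  shows "(LINT t|I01. \<bar>f t\<bar> powr p) \<le> (Lp_const * N f) powr p"
proof -
  let ?I = "LINT t|I01. \<bar>f t\<bar> powr p"
  have I0: "0 \<le> ?I" by (intro Bochner_Integration.integral_nonneg) auto
  have eq: "avg 0 (\<lambda>s. \<bar>f s\<bar> powr p) t = ?I" if "0 \<le> t" "t < 1" for t
  proof -
    let ?F = "\<lambda>s. \<bar>f s\<bar> powr p"
    have F: "dyadic K ?F" by (rule dyadic_comp[OF f])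
    have i: "dyadic K (\<lambda>s. of_bool (\<lfloor>2 ^ 0 * s\<rfloor> = \<lfloor>2 ^ 0 * t\<rfloor>))"
      by (rule dyadic_mono[of 0], simp, rule dyadicI) simp
    have "(LINT s|I01. of_bool (\<lfloor>2 ^ 0 * s\<rfloor> = \<lfloor>2 ^ 0 * t\<rfloor>) * ?F s) = (LINT s|I01. ?F s)"
    proof (rule integral_cong_AE)
      show "(\<lambda>s. of_bool (\<lfloor>2 ^ 0 * s\<rfloor> = \<lfloor>2 ^ 0 * t\<rfloor>) * ?F s) \<in> L0"
        by (rule dyadic_L0[OF dyadic_comp2[OF i F]])
      show "AE s in I01. of_bool (\<lfloor>2 ^ 0 * s\<rfloor> = \<lfloor>2 ^ 0 * t\<rfloor>) * ?F s = ?F s"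
        using AE_I01_less_1
      proof eventually_elim
        case (elim s)
        then have "\<lfloor>s\<rfloor> = 0" "\<lfloor>t\<rfloor> = 0" using that by (simp_all add: floor_eq_iff)
        then show ?case by simp
      qed
    qed (rule dyadic_L0[OF F])
    then show ?thesis unfolding avg_def by simp
  qed
  have "?I powr (1 / p) * N (\<lambda>t. 1) = N (\<lambda>t. ?I powr (1 / p))" using norm_const[of "?I powr (1 / p)"] by simp
  also have "\<dots> = N (\<lambda>t. avg 0 (\<lambda>s. \<bar>f s\<bar> powr p) t powr (1 / p))"
    by (rule norm_cong_01[OF dyadic_X[OF dyadic_comp[OF dyadic_avg]]]) (auto simp: eq)
  also have "\<dots> \<le> C * N f" by (rule norm_cond_p_function[OF f]) simp
  finally have "?I powr (1 / p) \<le> Lp_const * N f"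
    using norm_one_pos by (simp add: Lp_const_def field_simps)
  then have "(?I powr (1 / p)) powr p \<le> (Lp_const * N f) powr p" using p by (intro powr_mono2) auto
  then show ?thesis using p I0 by (simp add: powr_powr)
qed

lemma integral_powr_bounded:
  assumes u: "u \<in> L0" and B: "\<And>t. 0 \<le> t \<Longrightarrow> t \<le> 1 \<Longrightarrow> \<bar>u t\<bar> \<le> B"
  shows "(LINT t|I01. \<bar>u t\<bar> powr p) \<le> (Lp_const * N u) powr p"
proof -
  obtain v K where v: "\<And>n. dyadic (K n) (v n)" "\<And>n t. 0 \<le> t \<Longrightarrow> t \<le> 1 \<Longrightarrow> \<bar>v n t\<bar> \<le> B"
    "AE t in I01. (\<lambda>n. v n t) \<longlonglongrightarrow> u t"
    using dyadic_approximation[OF u B] by blast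
  have uX: "u \<in> X" using bounded_X[OF u B] by blast
  have vX: "v n \<in> X" for n by (rule dyadic_X[OF v(1)])
  have L: "(\<lambda>t. v n t - u t) \<in> L0" for n using u dyadic_L0[OF v(1)] by measurable
  have b: "\<bar>v n t - u t\<bar> \<le> 2 * B" if "0 \<le> t" "t \<le> 1" for n t
    using B[OF that] v(2)[OF that, of n] by linarith
  have lim: "AE t in I01. (\<lambda>n. v n t - u t) \<longlonglongrightarrow> 0"
    using v(3) by eventually_elim (auto intro!: tendsto_eq_intros)
  have d0: "(\<lambda>n. N (\<lambda>t. v n t - u t)) \<longlonglongrightarrow> 0"
    by (rule norm_bounded_tendsto_0[OF L b lim])
  have "(\<lambda>n. N u + N (\<lambda>t. v n t - u t)) \<longlonglongrightarrow> N u + 0" using d0 by (intro tendsto_intros)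
  then have R: "(\<lambda>n. (Lp_const * (N u + N (\<lambda>t. v n t - u t))) powr p) \<longlonglongrightarrow> (Lp_const * (N u + 0)) powr p"
    using p Lp_const_pos norm_nonneg[OF uX] norm_nonneg[OF diff_X[OF vX uX]]
    by (intro tendsto_powr2 tendsto_mult tendsto_const) auto
  have I: "(\<lambda>n. LINT t|I01. \<bar>v n t\<bar> powr p) \<longlonglongrightarrow> (LINT t|I01. \<bar>u t\<bar> powr p)"
  proof (rule integral_bounded_tendsto)
    show "AE t in I01. (\<lambda>n. \<bar>v n t\<bar> powr p) \<longlonglongrightarrow> \<bar>u t\<bar> powr p"
      using v(3) by eventually_elim (use p in \<open>auto intro!: tendsto_powr2 tendsto_rabs\<close>)
    show "\<bar>\<bar>v n t\<bar> powr p\<bar> \<le> B powr p" if "0 \<le> t" "t \<le> 1" for n t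
      using v(2)[OF that, of n] p by (auto intro: powr_mono2)
    show "(\<lambda>t. \<bar>v n t\<bar> powr p) \<in> L0" for n by (rule dyadic_L0[OF dyadic_comp[OF v(1)]])
  qed (use u in measurable)
  have "(LINT t|I01. \<bar>u t\<bar> powr p) \<le> (Lp_const * (N u + 0)) powr p"
  proof (rule LIMSEQ_le[OF I R], intro exI allI impI)
    fix n
    have "(Lp_const * N (v n)) powr p \<le> (Lp_const * (N u + N (\<lambda>t. v n t - u t))) powr p"
      using p Lp_const_pos norm_nonneg[OF vX] norm_triangle_sub[OF vX uX]
      by (intro powr_mono2 mult_left_mono) auto
    then show "(LINT t|I01. \<bar>v n t\<bar> powr p) \<le> (Lp_const * (N u + N (\<lambda>t. v n t - u t))) powr p"
      using integral_powr_dyadic[OF v(1)[of n]] by linarith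
  qed
  then show ?thesis by simp
qed

text \<open>Truncation and monotone convergence replace an approximation in norm, which may fail for
  unbounded \<open>f\<close>.\<close>

lemma integral_powr:
  assumes f: "f \<in> X"
  shows "integrable I01 (\<lambda>t. \<bar>f t\<bar> powr p)" "(LINT t|I01. \<bar>f t\<bar> powr p) \<le> (Lp_const * N f) powr p"
proof -
  have fL[measurable]: "f \<in> L0" by (rule X_L0[OF f])
  define u where "u m t = min \<bar>f t\<bar> (real m)" for m t
  have uL: "u m \<in> L0" for m unfolding u_def[abs_def] by measurable
  have ub: "\<bar>u m t\<bar> \<le> real m" for m t by (auto simp: u_def)
  have "N (u m) \<le> N f" for m by (rule norm_mono[OF uL f]) (auto simp: u_def)
  moreover have "0 \<le> N (u m)" for m using bounded_X[OF uL ub] norm_nonneg by blast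
  ultimately have le: "(LINT t|I01. \<bar>u m t\<bar> powr p) \<le> (Lp_const * N f) powr p" for m
    using integral_powr_bounded[OF uL ub, of m] p Lp_const_pos
    by (intro order_trans[OF integral_powr_bounded[OF uL ub]] powr_mono2 mult_left_mono) auto
  have int: "integrable I01 (\<lambda>t. \<bar>u m t\<bar> powr p)" for m
  proof (rule integrable_bounded[of _ "real m powr p"])
    show "\<bar>\<bar>u m t\<bar> powr p\<bar> \<le> real m powr p" for t using ub[of m t] p by (auto intro: powr_mono2)
  qed (use uL in measurable)
  have umono: "\<bar>u m t\<bar> powr p \<le> \<bar>u n t\<bar> powr p" if "m \<le> n" for m n t
    using that p by (intro powr_mono2) (auto simp: u_def)
  have inc: "incseq (\<lambda>m. LINT t|I01. \<bar>u m t\<bar> powr p)"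
    by (intro incseq_SucI integral_mono int umono) auto
  obtain x where x: "(\<lambda>m. LINT t|I01. \<bar>u m t\<bar> powr p) \<longlonglongrightarrow> x"
    using incseq_convergent[OF inc] le by blast
  have lim: "(\<lambda>m. \<bar>u m t\<bar> powr p) \<longlonglongrightarrow> \<bar>f t\<bar> powr p" for t
  proof (rule tendsto_eventually)
    obtain m0 where "\<bar>f t\<bar> \<le> real m0" using real_arch_simple by blast
    then show "\<forall>\<^sub>F m in sequentially. \<bar>u m t\<bar> powr p = \<bar>f t\<bar> powr p"
      by (intro eventually_sequentiallyI[of m0]) (auto simp: u_def)
  qed
  have m: "AE t in I01. mono (\<lambda>m. \<bar>u m t\<bar> powr p)"
    by (intro AE_I2 monoI umono)
  show "integrable I01 (\<lambda>t. \<bar>f t\<bar> powr p)"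
    by (rule integrable_monotone_convergence[OF int m _ x]) (use lim in auto)
  have "(LINT t|I01. \<bar>f t\<bar> powr p) = x"
    by (rule integral_monotone_convergence[OF int m _ x]) (use lim in auto)
  also have "x \<le> (Lp_const * N f) powr p" by (rule LIMSEQ_le_const2[OF x]) (use le in auto)
  finally show "(LINT t|I01. \<bar>f t\<bar> powr p) \<le> (Lp_const * N f) powr p" .
qed

lemma le_one_plus_powr: "0 \<le> x \<Longrightarrow> x \<le> 1 + x powr p" for x :: real
proof (cases "x \<le> 1")
  case False
  then have "x powr 1 \<le> x powr p" using p by (intro powr_mono) auto
  then show ?thesis using False by simp
qed (simp add: add_increasing2)

lemma integrable_X:
  assumes f: "f \<in> X"
  shows "integrable I01 f"
proof (rule Bochner_Integration.integrable_bound[of _ "\<lambda>t. 1 + \<bar>f t\<bar> powr p"])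
  show "AE t in I01. norm (f t) \<le> norm (1 + \<bar>f t\<bar> powr p)"
    using le_one_plus_powr by (intro AE_I2) auto
qed (use integral_powr(1)[OF f] X_L0[OF f] in auto)

text \<open>After normalization to \<open>N f = 1\<close> the bound
  \<open>x \<le> 1 + x powr p\<close> reduces the claim to the embedding into Lp. The linear
  dependence on \<open>N f\<close> makes dyadic averages bounded functionals.\<close>

lemma integral_abs_le: "\<exists>L>0. \<forall>f\<in>X. (LINT t|I01. \<bar>f t\<bar>) \<le> L * N f"
proof (intro exI[of _ "1 + Lp_const powr p"] conjI ballI)
  fix f assume f: "f \<in> X"
  show "(LINT t|I01. \<bar>f t\<bar>) \<le> (1 + Lp_const powr p) * N f"
  proof (cases "N f = 0")
    case True
    then have "AE t in I01. f t = 0" using norm_eq_0_iff[OF f] by simp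
    then have "(LINT t|I01. \<bar>f t\<bar>) = (LINT t|I01. 0)"
      by (intro integral_cong_AE) (use X_L0[OF f] in \<open>auto elim: eventually_mono\<close>)
    then show ?thesis using True by simp
  next
    case False
    then have pos: "0 < N f" using norm_nonneg[OF f] by simp
    let ?g = "\<lambda>t. 1 / N f * f t"
    have g: "?g \<in> X" "N ?g = 1"
      using scale[OF f, of "1 / N f"] norm_scale[OF f, of "1 / N f"] pos by auto
    have "(LINT t|I01. \<bar>?g t\<bar>) \<le> (LINT t|I01. 1 + \<bar>?g t\<bar> powr p)"
    proof (rule integral_mono)
      show "integrable I01 (\<lambda>t. 1 + \<bar>?g t\<bar> powr p)"
        using integral_powr(1)[OF g(1)] by (intro Bochner_Integration.integrable_add) auto
      show "integrable I01 (\<lambda>t. \<bar>?g t\<bar>)" by (rule integrable_abs[OF integrable_X[OF g(1)]])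
    qed (rule le_one_plus_powr, simp)
    also have "\<dots> = 1 + (LINT t|I01. \<bar>?g t\<bar> powr p)"
      using integral_powr(1)[OF g(1)] by (subst Bochner_Integration.integral_add) auto
    also have "\<dots> \<le> 1 + Lp_const powr p" using integral_powr(2)[OF g(1)] g(2) by simp
    also have "(LINT t|I01. \<bar>?g t\<bar>) = (LINT t|I01. \<bar>f t\<bar>) / N f"
      using pos by (simp add: abs_mult)
    finally show ?thesis using pos by (simp add: field_simps)
  qed
qed (simp add: add_pos_nonneg)

text \<open>Where \<open>|f|\<close> exceeds \<open>B\<close>, it is at most
  \<open>B powr (1 - p) * |f| powr p\<close>; as \<open>p > 1\<close>, the bound vanishes for large
  \<open>B\<close> uniformly over norm bounded sets.\<close>

lemma uniformly_integrable:
  assumes f: "f \<in> X" and k: "N f \<le> \<kappa>" and B: "0 < B"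
  shows "(LINT t|I01. \<bar>f t\<bar> * of_bool (B < \<bar>f t\<bar>)) \<le> B powr (1 - p) * (Lp_const * \<kappa>) powr p"
proof -
  have fL[measurable]: "f \<in> L0" by (rule X_L0[OF f])
  have "(LINT t|I01. \<bar>f t\<bar> * of_bool (B < \<bar>f t\<bar>)) \<le> (LINT t|I01. B powr (1 - p) * \<bar>f t\<bar> powr p)"
  proof (rule integral_mono)
    show "integrable I01 (\<lambda>t. \<bar>f t\<bar> * of_bool (B < \<bar>f t\<bar>))"
      by (rule Bochner_Integration.integrable_bound[OF integrable_X[OF f]]) auto
    show "integrable I01 (\<lambda>t. B powr (1 - p) * \<bar>f t\<bar> powr p)"
      using integral_powr(1)[OF f] by simp
    fix t
    show "\<bar>f t\<bar> * of_bool (B < \<bar>f t\<bar>) \<le> B powr (1 - p) * \<bar>f t\<bar> powr p"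
    proof (cases "B < \<bar>f t\<bar>")
      case True
      have "\<bar>f t\<bar> = \<bar>f t\<bar> powr (1 - p) * \<bar>f t\<bar> powr p" using True B by (simp flip: powr_add)
      also have "\<dots> \<le> B powr (1 - p) * \<bar>f t\<bar> powr p"
        using True B p by (intro mult_right_mono powr_mono2') auto
      finally show ?thesis using True by simp
    qed simp
  qed
  also have "\<dots> = B powr (1 - p) * (LINT t|I01. \<bar>f t\<bar> powr p)" by simp
  also have "\<dots> \<le> B powr (1 - p) * (Lp_const * \<kappa>) powr p"
  proof (rule mult_left_mono)
    have "(Lp_const * N f) powr p \<le> (Lp_const * \<kappa>) powr p"
      using p Lp_const_pos k norm_nonneg[OF f] by (intro powr_mono2 mult_left_mono) auto
    then show "(LINT t|I01. \<bar>f t\<bar> powr p) \<le> (Lp_const * \<kappa>) powr p" using integral_powr(2)[OF f] by linarith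
  qed simp
  finally show ?thesis .
qed

end

section \<open>Arithmetic means of martingale differences\<close>

lemma cesaro_tendsto_0:
  fixes x :: "nat \<Rightarrow> real"
  assumes x: "x \<longlonglongrightarrow> 0"
  shows "(\<lambda>m. (\<Sum>j\<le>m. x j) / real (Suc m)) \<longlonglongrightarrow> 0"
proof (rule LIMSEQ_I)
  fix e :: real assume e: "0 < e"
  obtain n0 where n0: "\<And>n. n0 \<le> n \<Longrightarrow> \<bar>x n\<bar> < e / 2"
    using LIMSEQ_D[OF x, of "e / 2"] e by auto
  define M where "M = (\<Sum>j<n0. \<bar>x j\<bar>)"
  obtain n1 where n1: "\<And>n. n1 \<le> n \<Longrightarrow> \<bar>M / real (Suc n)\<bar> < e / 2"
    using LIMSEQ_D[OF LIMSEQ_Suc[OF lim_const_over_n[of M]], of "e / 2"] e by auto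
  have "norm ((\<Sum>j\<le>m. x j) / real (Suc m) - 0) < e" if m: "max n0 n1 \<le> m" for m
  proof -
    have "\<bar>\<Sum>j\<le>m. x j\<bar> \<le> (\<Sum>j\<le>m. \<bar>x j\<bar>)" by (rule sum_abs)
    also have "\<dots> \<le> (\<Sum>j\<le>m. (if j < n0 then \<bar>x j\<bar> else 0) + e / 2)"
      by (rule sum_mono) (use n0 e in \<open>auto simp: not_less intro: less_imp_le\<close>)
    also have "\<dots> = (\<Sum>j\<le>m. if j < n0 then \<bar>x j\<bar> else 0) + real (Suc m) * (e / 2)"
      by (simp add: sum.distrib)
    also have "(\<Sum>j\<le>m. if j < n0 then \<bar>x j\<bar> else 0) = M"
      unfolding M_def by (rule sum.mono_neutral_cong_right) (use m in auto)
    finally have "\<bar>\<Sum>j\<le>m. x j\<bar> / real (Suc m) \<le> (M + real (Suc m) * (e / 2)) / real (Suc m)"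
      by (rule divide_right_mono) simp
    also have "\<dots> = M / real (Suc m) + e / 2" by (simp add: field_simps del: of_nat_Suc)
    also have "\<dots> < e" using n1[of m] m abs_ge_self[of "M / real (Suc m)"] by linarith
    finally show ?thesis by (simp add: abs_divide)
  qed
  then show "\<exists>no. \<forall>m\<ge>no. norm ((\<Sum>j\<le>m. x j) / real (Suc m) - 0) < e" by blast
qed

lemma cesaro_tendsto:
  fixes x :: "nat \<Rightarrow> real"
  assumes x: "x \<longlonglongrightarrow> l"
  shows "(\<lambda>m. (\<Sum>j\<le>m. x j) / real (Suc m)) \<longlonglongrightarrow> l"
proof -
  have "(\<lambda>n. x n - l) \<longlonglongrightarrow> 0" using x by (simp add: LIM_zero_iff)
  from cesaro_tendsto_0[OF this]
  have "(\<lambda>m. (\<Sum>j\<le>m. x j) / real (Suc m) - l) \<longlonglongrightarrow> 0"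
    by (simp add: sum_subtractf diff_divide_distrib del: of_nat_Suc)
  then show ?thesis by (simp add: LIM_zero_iff)
qed

lemma dyadic_differencesD:
  assumes "dyadic_differences a b d"
  shows "a j \<le> b j" "b j \<le> a (Suc j)" "dyadic (b j) (d j)"
    "dyadic (a j) w \<Longrightarrow> (LINT t|I01. w t * d j t) = 0"
  using assms unfolding dyadic_differences_def by blast+

text \<open>Levels are increasing, so omitting terms only widens the gaps between them. The factors
  \<open>c j\<close> admit the weights of \<open>weighted_martingale\<close>.\<close>

lemma dyadic_differences_subseq:
  assumes dd: "dyadic_differences a b d" and r: "strict_mono r"
  shows "dyadic_differences (a \<circ> r) (b \<circ> r) (\<lambda>j t. c j * d (r j) t)"
  unfolding dyadic_differences_def
proof (intro allI conjI impI)
  fix j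
  have a_mono: "a i \<le> a k" if "i \<le> k" for i k
    by (rule lift_Suc_mono_le[OF _ that]) (use dyadic_differencesD(1,2)[OF dd] order_trans in blast)
  show "(a \<circ> r) j \<le> (b \<circ> r) j" using dyadic_differencesD(1)[OF dd] by simp
  have "Suc (r j) \<le> r (Suc j)" using r by (simp add: strict_mono_Suc_iff Suc_le_eq)
  then show "(b \<circ> r) j \<le> (a \<circ> r) (Suc j)"
    using dyadic_differencesD(2)[OF dd, of "r j"] a_mono[of "Suc (r j)" "r (Suc j)"] by simp
  show "dyadic ((b \<circ> r) j) (\<lambda>t. c j * d (r j) t)"
    using dyadic_comp[OF dyadic_differencesD(3)[OF dd]] by simp
  fix w assume "dyadic ((a \<circ> r) j) w"
  then have "(LINT t|I01. w t * d (r j) t) = 0" using dyadic_differencesD(4)[OF dd] by simp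
  then have "(LINT t|I01. c j * (w t * d (r j) t)) = 0" by simp
  then show "(LINT t|I01. w t * (c j * d (r j) t)) = 0" by (simp add: mult.left_commute)
qed

context boyd_convex_space
begin

text \<open>Since \<open>\<Sum> 1 / (j + 1) powr p\<close> converges, the maximal inequality makes the maximal functions
  of suitable blocks \<open>{q i..q (i + 1)}\<close> norm summable.\<close>

lemma weighted_martingale:
  assumes dd: "dyadic_differences a b d" and \<kappa>: "\<And>j. N (d j) \<le> \<kappa>"
  defines "f \<equiv> \<lambda>m t. \<Sum>j<m. d j t / real (Suc j)"
  shows "\<exists>H\<in>X. AE t in I01. (\<forall>m. \<bar>f m t\<bar> \<le> H t) \<and> convergent (\<lambda>m. f m t)"
proof -
  obtain D where D: "0 < D" and mx: "\<And>(n::nat) a b d \<kappa>. dyadic_differences a b d \<Longrightarrow> (\<forall>j. N (d j) \<le> \<kappa> j) \<Longrightarrow>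
    N (\<lambda>t. MAX m\<in>{..n}. \<bar>\<Sum>j<m. d j t\<bar>) \<le> D * (\<Sum>j<n. \<kappa> j powr p) powr (1 / p)"
    using maximal_inequality by blast
  have dX: "d j \<in> X" for j by (rule dyadic_X[OF dyadic_differencesD(3)[OF dd]])
  have k0: "0 \<le> \<kappa>" using \<kappa>[of 0] norm_nonneg[OF dX[of 0]] by linarith
  define s where "s j = (\<kappa> / real (Suc j)) powr p" for j
  have "summable (\<lambda>j. \<kappa> powr p * real (Suc j) powr (- p))"
    using p by (intro summable_mult) (simp add: summable_Suc_iff[of "\<lambda>j. real j powr (- p)"] summable_real_powr_iff del: of_nat_Suc)
  moreover have "s j = \<kappa> powr p * real (Suc j) powr (- p)" for j
    unfolding s_def using k0 by (simp add: powr_divide powr_minus_divide del: of_nat_Suc)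
  ultimately have s_sum: "summable s" by presburger
  \<comment> \<open>Chosen so that the bound \<open>D * \<epsilon> i powr (1 / p)\<close> for the
    \<open>i\<close>-th block equals \<open>(1 / 2) ^ i\<close>.\<close>
  define \<epsilon> where "\<epsilon> i = ((1 / 2) ^ i / D) powr p" for i :: nat
  have \<epsilon>: "0 < \<epsilon> i" for i using D by (simp add: \<epsilon>_def)
  have "\<exists>n0. \<forall>m\<ge>n0. \<forall>n. norm (sum s {m..<n}) < \<epsilon> i" for i
    using s_sum \<epsilon>[of i] unfolding summable_Cauchy by blast
  then obtain n0 where n0: "\<And>i m n. n0 i \<le> m \<Longrightarrow> \<bar>sum s {m..<n}\<bar> < \<epsilon> i" by (metis real_norm_def)
  obtain q where q: "\<And>i. n0 i \<le> q i" "\<And>i. q i < q (Suc i)"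
    using dependent_nat_choice[of "\<lambda>i m. n0 i \<le> m" "\<lambda>i m m'. m < m'"]
    by (metis less_add_one max.cobounded1 max.strict_coboundedI2 order_refl)
  have qm: "strict_mono q" using q(2) by (simp add: strict_mono_Suc_iff)
  define G where "G i t = (MAX m\<in>{..q (Suc i) - q i}. \<bar>\<Sum>j<m. d (q i + j) t / real (Suc (q i + j))\<bar>)" for i t
  have fdiff: "f m t - f k t = (\<Sum>j=k..<m. d j t / real (Suc j))" if "k \<le> m" for k m t
    using that by (simp add: f_def sum_diff_nat_ivl lessThan_atLeast0 del: of_nat_Suc)
  have Gf: "G i t = (MAX m\<in>{..q (Suc i) - q i}. \<bar>f (q i + m) t - f (q i) t\<bar>)" for i t
  proof -
    have "(\<Sum>j<m. d (q i + j) t / real (Suc (q i + j))) = f (q i + m) t - f (q i) t" for m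
      using fdiff[of "q i" "q i + m" t] sum.shift_bounds_nat_ivl[of "\<lambda>j. d j t / real (Suc j)" 0 "q i" m]
      by (simp add: lessThan_atLeast0 add.commute del: of_nat_Suc)
    then show ?thesis unfolding G_def by simp
  qed
  have Gge: "\<bar>f m t - f (q i) t\<bar> \<le> G i t" if "q i \<le> m" "m \<le> q (Suc i)" for i m t
    unfolding Gf by (rule Max_ge) (use that in \<open>auto intro!: image_eqI[of _ _ "m - q i"]\<close>)
  have G0: "0 \<le> G i t" for i t using Gge[of i "q i" t] q(2)[of i] by simp
  have NG: "N (G i) \<le> (1 / 2) ^ i" for i
  proof -
    let ?\<kappa> = "\<lambda>j. \<kappa> / real (Suc (q i + j))"
    have "dyadic_differences (a \<circ> (+) (q i)) (b \<circ> (+) (q i)) (\<lambda>j t. 1 / real (Suc (q i + j)) * d (q i + j) t)"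
      by (rule dyadic_differences_subseq[OF dd]) (simp add: strict_mono_def)
    moreover have "N (\<lambda>t. 1 / real (Suc (q i + j)) * d (q i + j) t) \<le> ?\<kappa> j" for j
      using norm_scale[OF dX, of "1 / real (Suc (q i + j))" "q i + j"] \<kappa>[of "q i + j"]
      by (simp add: divide_right_mono del: of_nat_Suc)
    ultimately have "N (G i) \<le> D * (\<Sum>j<q (Suc i) - q i. ?\<kappa> j powr p) powr (1 / p)"
      using mx[of _ _ "\<lambda>j t. 1 / real (Suc (q i + j)) * d (q i + j) t" ?\<kappa> "q (Suc i) - q i"]
      unfolding G_def[abs_def] by simp
    also have "(\<Sum>j<q (Suc i) - q i. ?\<kappa> j powr p) = sum s {q i..<q i + (q (Suc i) - q i)}"
      using sum.shift_bounds_nat_ivl[of s 0 "q i" "q (Suc i) - q i"]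
      by (simp add: s_def lessThan_atLeast0 add.commute del: of_nat_Suc)
    also have "\<dots> \<le> \<epsilon> i" using n0[OF q(1)] abs_ge_self less_imp_le order_trans by metis
    then have "D * (sum s {q i..<q i + (q (Suc i) - q i)}) powr (1 / p) \<le> D * \<epsilon> i powr (1 / p)"
      using D p by (intro mult_left_mono powr_mono2) (auto intro!: sum_nonneg simp: s_def)
    also have "D * \<epsilon> i powr (1 / p) = (1 / 2) ^ i" using D p by (simp add: \<epsilon>_def powr_powr)
    finally show ?thesis .
  qed
  have fX: "(\<lambda>t. f m t) \<in> X" for m
    unfolding f_def using sum_X[of "{..<m}" "\<lambda>j t. 1 / real (Suc j) * d j t", OF scale[OF dX]] by simp
  have GX: "G i \<in> X" for i
  proof (rule idealD[OF _ sum_X[of "{..q (Suc i) - q i}" "\<lambda>m t. \<bar>f (q i + m) t - f (q i) t\<bar>"]])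
    show "G i \<in> L0" unfolding Gf[abs_def]
      by (rule borel_measurable_Max) (use X_L0[OF diff_X[OF fX fX]] in auto)
    show "AE t in I01. \<bar>G i t\<bar> \<le> \<bar>\<Sum>m\<le>q (Suc i) - q i. \<bar>f (q i + m) t - f (q i) t\<bar>\<bar>"
    proof (rule AE_I2)
      fix t
      have "G i t \<le> (\<Sum>m\<le>q (Suc i) - q i. \<bar>f (q i + m) t - f (q i) t\<bar>)"
        unfolding Gf by (rule Max.boundedI) (auto intro!: member_le_sum)
      then show "\<bar>G i t\<bar> \<le> \<bar>\<Sum>m\<le>q (Suc i) - q i. \<bar>f (q i + m) t - f (q i) t\<bar>\<bar>" using G0[of i t] by simp
    qed
  qed (use abs_X[OF diff_X[OF fX fX]] in auto)
  have "summable (\<lambda>i. N (G i))"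
    by (rule summable_comparison_test'[of "\<lambda>i. (1 / 2) ^ i"]) (use NG norm_nonneg[OF GX] in auto)
  then obtain S where S: "S \<in> X" "\<And>n. AE t in I01. (\<Sum>i<n. \<bar>G i t\<bar>) \<le> S t"
    using riesz_fischer[of G, OF GX] by blast
  \<comment> \<open>The blocks begin at \<open>q 0\<close>; \<open>P\<close> majorizes the finitely
    many partial sums up to that index.\<close>
  define P where "P t = (\<Sum>m\<le>q 0. \<bar>f m t\<bar>)" for t
  have PX: "P \<in> X" unfolding P_def[abs_def] by (intro sum_X abs_X fX)
  have chain: "\<bar>f m t - f (q k) t\<bar> \<le> (\<Sum>i=k..<Suc m. G i t)" if km: "q k \<le> m" for k m t
  proof -
    have seg: "\<bar>f (q i) t - f (q k) t\<bar> \<le> (\<Sum>l=k..<i. G l t)" if "k \<le> i" for i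
      using that
    proof (induction i rule: dec_induct)
      case (step i)
      have "\<bar>f (q (Suc i)) t - f (q i) t\<bar> \<le> G i t" using Gge[of i "q (Suc i)"] q(2)[of i] by simp
      then show ?case using step by simp
    qed simp
    \<comment> \<open>The last block that starts no later than \<open>m\<close>. Since
      \<open>y \<le> q y\<close>, the index satisfies \<open>i \<le> m\<close>; hence the greatest
      one exists, and the block sums may be extended up to \<open>m\<close>.\<close>
    define i where "i = (GREATEST i. q i \<le> m)"
    have bound: "\<forall>y. q y \<le> m \<longrightarrow> y \<le> m" using strict_mono_imp_increasing[OF qm] order_trans by blast
    have qi: "q i \<le> m" unfolding i_def by (rule GreatestI_nat[of _ k m]) (use km bound in auto)
    have ki: "k \<le> i" unfolding i_def by (rule Greatest_le_nat[of _ k m]) (use km bound in auto)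
    have "m < q (Suc i)"
    proof (rule ccontr)
      assume "\<not> m < q (Suc i)"
      then have "Suc i \<le> i" unfolding i_def by (intro Greatest_le_nat[of _ _ m]) (use bound in \<open>auto simp: i_def\<close>)
      then show False by simp
    qed
    then have "\<bar>f m t - f (q i) t\<bar> \<le> G i t" using Gge[OF qi] by simp
    then have "\<bar>f m t - f (q k) t\<bar> \<le> (\<Sum>l=k..<Suc i. G l t)" using seg[OF ki] ki by simp
    also have "\<dots> \<le> (\<Sum>l=k..<Suc m. G l t)"
      by (rule sum_mono2) (use bound qi G0 in auto)
    finally show ?thesis .
  qed
  have "AE t in I01. \<forall>n. (\<Sum>i<n. \<bar>G i t\<bar>) \<le> S t" using S(2) by (simp add: AE_all_countable)
  then have "AE t in I01. (\<forall>m. \<bar>f m t\<bar> \<le> P t + S t) \<and> convergent (\<lambda>m. f m t)"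
  proof eventually_elim
    case (elim t)
    then have GS: "(\<Sum>i<n. G i t) \<le> S t" for n using G0 by simp
    have S0: "0 \<le> S t" using GS[of 0] by simp
    have "\<bar>f m t\<bar> \<le> P t + S t" for m
    proof (cases "m \<le> q 0")
      case True
      then have "\<bar>f m t\<bar> \<le> P t" unfolding P_def by (intro member_le_sum) auto
      then show ?thesis using S0 by simp
    next
      case False
      have "\<bar>f (q 0) t\<bar> \<le> P t" unfolding P_def by (intro member_le_sum) auto
      moreover have "\<bar>f m t - f (q 0) t\<bar> \<le> S t"
        using chain[of 0 m t] GS[of "Suc m"] False by (simp add: lessThan_atLeast0)
      ultimately show ?thesis by linarith
    qed
    moreover have "Cauchy (\<lambda>m. f m t)"
    proof (rule CauchyI')
      fix e :: real assume e: "0 < e"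
      have "summable (\<lambda>i. G i t)"
        by (rule summableI_nonneg_bounded[of _ "S t"]) (use G0 GS in auto)
      then have "\<exists>k. \<forall>m\<ge>k. \<forall>n. norm (\<Sum>i=m..<n. G i t) < e / 2"
        using e unfolding summable_Cauchy by (metis half_gt_zero)
      then obtain k where k: "\<And>n. \<bar>\<Sum>i=k..<n. G i t\<bar> < e / 2" by auto
      have near: "\<bar>f m t - f (q k) t\<bar> < e / 2" if "q k \<le> m" for m
        using chain[OF that, of t] k[of "Suc m"] by linarith
      have "dist (f m t) (f n t) < e" if "q k \<le> m" "m < n" for m n
        using near[of m] near[of n] that unfolding dist_real_def by linarith
      then show "\<exists>M. \<forall>m\<ge>M. \<forall>n>m. dist (f m t) (f n t) < e" by blast
    qed
    ultimately show ?case using Cauchy_convergent by blast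
  qed
  then show ?thesis by (intro bexI[OF _ add[OF PX S(1)]])
qed

text \<open>Kronecker's lemma with a majorant: the mean of \<open>d\<close> is
  \<open>f (Suc m)\<close> minus the mean of \<open>f 0\<close> to \<open>f m\<close>. The one
  function \<open>H\<close> gives the bound \<open>2 * H\<close>, and both terms converge to the
  same limit.\<close>

lemma order_null_cesaro_differences:
  assumes dd: "dyadic_differences a b d" and \<kappa>: "\<And>j. N (d j) \<le> \<kappa>"
  shows "order_null (cesaro d)"
proof -
  define f where "f m t = (\<Sum>j<m. d j t / real (Suc j))" for m t
  obtain H where H: "H \<in> X" "AE t in I01. (\<forall>m. \<bar>f m t\<bar> \<le> H t) \<and> convergent (\<lambda>m. f m t)"
    using weighted_martingale[OF dd \<kappa>] unfolding f_def by blast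
  have abel: "cesaro d m t = f (Suc m) t - (\<Sum>j\<le>m. f j t) / real (Suc m)" for m t
  proof -
    have "(\<Sum>j\<le>m. d j t) = real (Suc m) * f (Suc m) t - (\<Sum>j\<le>m. f j t)"
    proof (induction m)
      case (Suc m)
      have "real (Suc (Suc m)) * f (Suc (Suc m)) t = real (Suc (Suc m)) * f (Suc m) t + d (Suc m) t"
        by (simp add: f_def distrib_left del: of_nat_Suc)
      also have "real (Suc (Suc m)) * f (Suc m) t = real (Suc m) * f (Suc m) t + f (Suc m) t"
        by (simp add: algebra_simps)
      finally show ?case using Suc by simp
    qed (simp add: f_def)
    then show ?thesis by (simp add: cesaro_def diff_divide_distrib del: of_nat_Suc)
  qed
  have dX: "d j \<in> X" for j by (rule dyadic_X[OF dyadic_differencesD(3)[OF dd]])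
  have "AE t in I01. \<bar>cesaro d m t\<bar> \<le> 2 * H t" for m
    using H(2)
  proof eventually_elim
    case (elim t)
    have "\<bar>\<Sum>j\<le>m. f j t\<bar> \<le> (\<Sum>j\<le>m. H t)"
      by (rule order_trans[OF sum_abs sum_mono]) (use elim in auto)
    then have "\<bar>\<Sum>j\<le>m. f j t\<bar> \<le> H t * real (Suc m)" by (simp add: mult.commute)
    then have "\<bar>(\<Sum>j\<le>m. f j t) / real (Suc m)\<bar> \<le> H t"
      by (simp add: abs_divide pos_divide_le_eq del: of_nat_Suc)
    moreover have "\<bar>f (Suc m) t\<bar> \<le> H t" using elim by blast
    ultimately show ?case unfolding abel by linarith
  qed
  moreover have "AE t in I01. (\<lambda>m. cesaro d m t) \<longlonglongrightarrow> 0"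
    using H(2)
  proof eventually_elim
    case (elim t)
    then obtain l where l: "(\<lambda>m. f m t) \<longlonglongrightarrow> l" by (auto simp: convergent_def)
    have "(\<lambda>m. f (Suc m) t - (\<Sum>j\<le>m. f j t) / real (Suc m)) \<longlonglongrightarrow> l - l"
      by (intro tendsto_diff cesaro_tendsto[OF l] LIMSEQ_Suc[OF l])
    then show ?case by (simp add: abel)
  qed
  ultimately show ?thesis unfolding order_null_def
    by (intro conjI bexI[OF _ scale[OF H(1), of 2]] allI cesaro_X dX) auto
qed

end

section \<open>Extraction of martingale differences\<close>

definition excess :: "real \<Rightarrow> (real \<Rightarrow> real) \<Rightarrow> real \<Rightarrow> real" where
  "excess m f t = (if m < \<bar>f t\<bar> then f t else 0)"

lemma excess_L0:
  assumes [measurable]: "f \<in> L0"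
  shows "excess m f \<in> L0"
  unfolding excess_def[abs_def] by measurable

lemma excess_eventually_0: "\<forall>\<^sub>F m in sequentially. excess (real m) f t = 0"
proof -
  obtain m0 where "\<bar>f t\<bar> \<le> real m0" using real_arch_simple by blast
  then show ?thesis by (intro eventually_sequentiallyI[of m0]) (auto simp: excess_def)
qed

lemma integral_excess_tendsto_0:
  assumes f: "integrable I01 f"
  shows "(\<lambda>m. LINT t|I01. \<bar>excess (real m) f t\<bar>) \<longlonglongrightarrow> 0"
proof -
  have fL: "f \<in> L0" using f by auto
  have "(\<lambda>m. LINT t|I01. \<bar>excess (real m) f t\<bar>) \<longlonglongrightarrow> (LINT t|I01. 0)"
  proof (rule integral_dominated_convergence[where w="\<lambda>t. \<bar>f t\<bar>"])
    show "AE t in I01. (\<lambda>m. \<bar>excess (real m) f t\<bar>) \<longlonglongrightarrow> 0"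
    proof (rule AE_I2)
      fix t show "(\<lambda>m. \<bar>excess (real m) f t\<bar>) \<longlonglongrightarrow> 0"
        by (rule tendsto_eventually) (use excess_eventually_0[of f t] in \<open>auto elim: eventually_mono\<close>)
    qed
    show "(\<lambda>t. \<bar>excess (real m) f t\<bar>) \<in> L0" for m using excess_L0[OF fL] by measurable
  qed (use f in \<open>auto simp: excess_def\<close>)
  then show ?thesis by simp
qed

context banach_function_space
begin

lemma excess_X: "f \<in> X \<Longrightarrow> excess m f \<in> X"
  by (rule idealD[OF excess_L0[OF X_L0]]) (auto simp: excess_def)

lemma order_null_cesaro:
  assumes "order_null F" shows "order_null (cesaro F)"
proof -
  obtain H where H: "H \<in> X" "\<And>n. AE t in I01. \<bar>F n t\<bar> \<le> H t"
    using assms unfolding order_null_def by blast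
  have "AE t in I01. \<forall>n. \<bar>F n t\<bar> \<le> H t" using H(2) by (simp add: AE_all_countable)
  then have "AE t in I01. \<bar>cesaro F m t\<bar> \<le> H t" for m
  proof eventually_elim
    case (elim t)
    have "\<bar>\<Sum>j\<le>m. F j t\<bar> \<le> (\<Sum>j\<le>m. H t)"
      by (rule order_trans[OF sum_abs sum_mono]) (use elim in auto)
    then have "\<bar>\<Sum>j\<le>m. F j t\<bar> \<le> H t * real (Suc m)" by (simp add: mult.commute)
    then show ?case by (simp add: cesaro_def abs_divide pos_divide_le_eq del: of_nat_Suc)
  qed
  moreover have "AE t in I01. (\<lambda>n. F n t) \<longlonglongrightarrow> 0" using assms by (simp add: order_null_def)
  then have "AE t in I01. (\<lambda>n. cesaro F n t) \<longlonglongrightarrow> 0"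
    unfolding cesaro_def by eventually_elim (rule cesaro_tendsto_0)
  moreover have "\<forall>n. cesaro F n \<in> X" using assms cesaro_X unfolding order_null_def by blast
  ultimately show ?thesis unfolding order_null_def using H(1) by blast
qed

lemma order_continuous_excess:
  assumes "order_continuous X N" and f: "f \<in> X"
  shows "(\<lambda>m. N (excess (real m) f)) \<longlonglongrightarrow> 0"
proof -
  have "order_converges X (\<lambda>m. excess (real m) f) (\<lambda>t. 0)"
  proof (rule order_convergesI[OF excess_X[OF f] abs_X[OF f]])
    show "AE t in I01. (\<lambda>m. excess (real m) f t) \<longlonglongrightarrow> 0"
      by (intro AE_I2 tendsto_eventually excess_eventually_0)
  qed (auto simp: excess_def)
  then show ?thesis using assms(1) unfolding order_continuous_def by blast
qed

end

context boyd_convex_space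
begin

text \<open>The order of choices matters. The coarse level \<open>a\<close> is given, so only
  finitely many averages have to be small, which fixes \<open>n\<close>; the truncation level
  \<open>m\<close> depends on \<open>n\<close>, and the step function with its fine level
  \<open>b\<close> on both.\<close>

lemma selection_step:
  fixes h :: "nat \<Rightarrow> real \<Rightarrow> real"
  assumes h: "\<And>n. h n \<in> X"
    and null: "\<And>k t. 0 \<le> t \<Longrightarrow> t < 1 \<Longrightarrow> (\<lambda>n. avg k (h n) t) \<longlonglongrightarrow> 0"
    and Q: "\<And>n. \<forall>\<^sub>F m in sequentially. Q n m" and e: "0 < e"
  shows "\<exists>n>n0. \<exists>m::nat. \<exists>v b. Q n m \<and> a \<le> b \<and> dyadic b v \<and>
    (\<forall>t. 0 \<le> t \<longrightarrow> t < 1 \<longrightarrow> \<bar>avg a v t\<bar> \<le> e) \<and> N (\<lambda>t. h n t - excess (real m) (h n) t - v t) \<le> e"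
proof -
  \<comment> \<open>\<open>avg_abs_le\<close> loses the factor \<open>2 ^ a\<close>. With this
    choice the average of \<open>h n\<close>, the truncation and the approximation each contribute
    at most \<open>e / 3\<close> to the average of \<open>v\<close>.\<close>
  define \<eta> where "\<eta> = e / (3 * 2 ^ a)"
  have \<eta>: "0 < \<eta>" "2 ^ a * \<eta> = e / 3" using e by (auto simp: \<eta>_def)
  have "(1::real) \<le> 2 ^ a" by simp
  then have "1 \<le> 3 * (2::real) ^ a" by linarith
  then have \<eta>e: "\<eta> \<le> e" unfolding \<eta>_def using e by (simp add: field_simps)
  have "\<forall>i\<in>{..<2 ^ a}. \<forall>\<^sub>F n in sequentially. \<bar>avg a (h n) (real i / 2 ^ a)\<bar> < e / 3"
  proof
    fix i :: nat assume "i \<in> {..<2 ^ a}"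
    then have "real i < real (2 ^ a)" unfolding lessThan_iff by (simp only: of_nat_less_iff)
    then have "(\<lambda>n. avg a (h n) (real i / 2 ^ a)) \<longlonglongrightarrow> 0" by (intro null) (auto simp: field_simps)
    from tendstoD[OF this, of "e / 3"] e
    show "\<forall>\<^sub>F n in sequentially. \<bar>avg a (h n) (real i / 2 ^ a)\<bar> < e / 3" by (simp add: dist_real_def)
  qed
  then have "\<forall>\<^sub>F n in sequentially. \<forall>i\<in>{..<2 ^ a}. \<bar>avg a (h n) (real i / 2 ^ a)\<bar> < e / 3"
    by (subst eventually_ball_finite_distrib) auto
  then have "\<forall>\<^sub>F n in sequentially. n0 < n \<and> (\<forall>i\<in>{..<2 ^ a}. \<bar>avg a (h n) (real i / 2 ^ a)\<bar> < e / 3)"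
    using eventually_gt_at_top by (rule eventually_conj[rotated])
  then obtain n where n: "n0 < n" "\<And>i. i < 2 ^ a \<Longrightarrow> \<bar>avg a (h n) (real i / 2 ^ a)\<bar> < e / 3"
    using eventually_happens'[OF sequentially_bot] by blast
  have hL: "h n \<in> L0" by (rule X_L0[OF h])
  have hint: "integrable I01 (h n)" by (rule integrable_X[OF h])
  have "\<forall>\<^sub>F m in sequentially. (LINT t|I01. \<bar>excess (real m) (h n) t\<bar>) < \<eta>"
    using order_tendstoD(2)[OF integral_excess_tendsto_0[OF hint] \<eta>(1)] .
  with Q[of n] have "\<forall>\<^sub>F m in sequentially. Q n m \<and> (LINT t|I01. \<bar>excess (real m) (h n) t\<bar>) < \<eta>"
    by (rule eventually_conj)
  then obtain m where m: "Q n m" "(LINT t|I01. \<bar>excess (real m) (h n) t\<bar>) < \<eta>"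
    using eventually_happens'[OF sequentially_bot] by blast
  define u where "u t = h n t - excess (real m) (h n) t" for t
  have uL: "u \<in> L0" unfolding u_def[abs_def] using hL excess_L0[OF hL] by measurable
  have ub: "\<bar>u t\<bar> \<le> real m" for t by (auto simp: u_def excess_def)
  obtain b v where v: "a \<le> b" "dyadic b v" "N (\<lambda>t. u t - v t) < \<eta>" "(LINT t|I01. \<bar>u t - v t\<bar>) < \<eta>"
    using dyadic_density[OF uL ub \<eta>(1), of a] by blast
  have xint: "integrable I01 (excess (real m) (h n))" by (rule integrable_X[OF excess_X[OF h]])
  have uint: "integrable I01 u" by (rule integrable_bounded[OF uL ub])
  have vint: "integrable I01 v" by (rule dyadic_integrable[OF v(2)])
  have uvint: "integrable I01 (\<lambda>t. u t - v t)" using uint vint by simp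
  have "\<bar>avg a v t\<bar> \<le> e" if t: "0 \<le> t" "t < 1" for t
  proof -
    let ?i = "nat \<lfloor>2 ^ a * t\<rfloor>"
    have "avg a (h n) t = avg a (h n) (real ?i / 2 ^ a)"
      by (rule dyadic_eq[OF dyadic_avg grid_index(2)[OF t]])
    then have "\<bar>avg a (h n) t\<bar> < e / 3" using n(2)[OF grid_index(1)[OF t]] by simp
    moreover have "avg a u t = avg a (h n) t - avg a (excess (real m) (h n)) t"
      unfolding u_def[abs_def] by (rule avg_diff[OF hint xint])
    moreover have "avg a (\<lambda>t. u t - v t) t = avg a u t - avg a v t" by (rule avg_diff[OF uint vint])
    moreover have "\<bar>avg a (excess (real m) (h n)) t\<bar> \<le> e / 3"
    proof -
      have "2 ^ a * (LINT t|I01. \<bar>excess (real m) (h n) t\<bar>) \<le> 2 ^ a * \<eta>"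
        using m(2) by (intro mult_left_mono) auto
      then show ?thesis using avg_abs_le[OF xint, of a t] \<eta>(2) by linarith
    qed
    moreover have "\<bar>avg a (\<lambda>t. u t - v t) t\<bar> \<le> e / 3"
    proof -
      have "2 ^ a * (LINT t|I01. \<bar>u t - v t\<bar>) \<le> 2 ^ a * \<eta>"
        using v(4) by (intro mult_left_mono) auto
      then show ?thesis using avg_abs_le[OF uvint, of a t] \<eta>(2) by linarith
    qed
    ultimately show ?thesis by linarith
  qed
  moreover have "N (\<lambda>t. h n t - excess (real m) (h n) t - v t) \<le> e"
    using v(3) \<eta>e unfolding u_def by linarith
  ultimately show ?thesis using n(1) m(1) v(1,2) by blast
qed

text \<open>After truncation at level \<open>m j\<close>, a subsequence is a norm summable perturbation of dyadic
  martingale differences. The predicate \<open>Q\<close> records what is needed of the truncated part.\<close>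

lemma selection:
  fixes h :: "nat \<Rightarrow> real \<Rightarrow> real"
  assumes h: "\<And>n. h n \<in> X" and \<kappa>: "\<And>n. N (h n) \<le> \<kappa>"
    and null: "\<And>k t. 0 \<le> t \<Longrightarrow> t < 1 \<Longrightarrow> (\<lambda>n. avg k (h n) t) \<longlonglongrightarrow> 0"
    and Q: "\<And>j n. \<forall>\<^sub>F m in sequentially. Q j n m"
  shows "\<exists>r (m :: nat \<Rightarrow> nat) a b d. strict_mono r \<and> (\<forall>j. Q j (r j) (m j)) \<and> dyadic_differences a b d \<and>
    (\<forall>j. N (d j) \<le> \<kappa> + 1 + N (\<lambda>t. 1)) \<and>
    (\<forall>j. N (\<lambda>t. h (r j) t - excess (real (m j)) (h (r j)) t - d j t) \<le> (1 + N (\<lambda>t. 1)) * (1 / 2) ^ j)"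
proof -
  \<comment> \<open>A state holds the index, the truncation level, the step function and its coarse
    and fine levels; \<open>R\<close> makes the fine level of one stage the coarse level of the
    next.\<close>
  define P where "P j s \<longleftrightarrow> (case s of (n, m, v, a, b) \<Rightarrow> Q j n m \<and> a \<le> b \<and> dyadic b v \<and>
    (\<forall>t. 0 \<le> t \<longrightarrow> t < 1 \<longrightarrow> \<bar>avg a v t\<bar> \<le> (1 / 2) ^ j) \<and>
    N (\<lambda>t. h n t - excess (real m) (h n) t - v t) \<le> (1 / 2) ^ j)" for j and s :: "nat \<times> nat \<times> (real \<Rightarrow> real) \<times> nat \<times> nat"
  define R where "R s s' \<longleftrightarrow> (case s of (n, m, v, a, b) \<Rightarrow> case s' of (n', m', v', a', b') \<Rightarrow> n < n' \<and> a' = b)"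
    for s s' :: "nat \<times> nat \<times> (real \<Rightarrow> real) \<times> nat \<times> nat"
  have step: "\<exists>n>n0. \<exists>m v b. P j (n, m, v, a, b)" for j n0 a
    using selection_step[of h "Q j" "(1/2) ^ j" n0 a, OF h null Q] unfolding P_def by simp
  have "\<exists>s. \<forall>j. P j (s j) \<and> R (s j) (s (Suc j))"
  proof (rule dependent_nat_choice)
    show "\<exists>x. P 0 x" using step by blast
    fix x j assume "P j x"
    obtain n m v a b where x: "x = (n, m, v, a, b)" using prod_cases5 by blast
    show "\<exists>y. P (Suc j) y \<and> R x y" using step[of n "Suc j" b] unfolding x R_def by auto
  qed
  then obtain s where s: "\<And>j. P j (s j)" "\<And>j. R (s j) (s (Suc j))" by blast
  define r where "r j = fst (s j)" for j
  define m where "m j = fst (snd (s j))" for j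
  define v where "v j = fst (snd (snd (s j)))" for j
  define a where "a j = fst (snd (snd (snd (s j))))" for j
  define b where "b j = snd (snd (snd (snd (s j))))" for j
  have sj: "s j = (r j, m j, v j, a j, b j)" for j by (simp add: r_def m_def v_def a_def b_def)
  have Pj: "Q j (r j) (m j)" "a j \<le> b j" "dyadic (b j) (v j)"
    "\<And>t. 0 \<le> t \<Longrightarrow> t < 1 \<Longrightarrow> \<bar>avg (a j) (v j) t\<bar> \<le> (1 / 2) ^ j"
    "N (\<lambda>t. h (r j) t - excess (real (m j)) (h (r j)) t - v j t) \<le> (1 / 2) ^ j" for j
    using s(1)[of j] unfolding sj P_def by auto
  have Rj: "r j < r (Suc j)" "a (Suc j) = b j" for j
    using s(2)[of j] unfolding sj R_def by auto
  \<comment> \<open>Subtracting the conditional expectation makes the mean conditions exact. Its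
    modulus is at most \<open>(1 / 2) ^ j\<close> on \<open>[0,1)\<close>, so the correction is norm
    summable.\<close>
  define A where "A j = avg (a j) (v j)" for j
  define d where "d j t = v j t - A j t" for j t
  have Ad: "dyadic (b j) (A j)" for j unfolding A_def by (rule dyadic_mono[OF Pj(2) dyadic_avg])
  have AX: "A j \<in> X" and vX: "v j \<in> X" for j by (rule dyadic_X[OF Ad], rule dyadic_X[OF Pj(3)])
  have NA: "N (A j) \<le> (1 / 2) ^ j * N (\<lambda>t. 1)" for j
  proof -
    have "N (A j) \<le> N (\<lambda>t. (1 / 2) ^ j)"
      by (rule norm_mono[OF X_L0[OF AX] const_X], rule eventually_mono[OF AE_I01_less_1])
        (use Pj(4) in \<open>simp add: A_def\<close>)
    then show ?thesis using norm_const[of "(1 / 2) ^ j"] by simp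
  qed
  have le1: "(1 / 2) ^ j \<le> (1::real)" for j :: nat by (rule power_le_one) auto
  have N1: "0 \<le> N (\<lambda>t. 1)" using norm_one_pos by simp
  have NA1: "N (A j) \<le> N (\<lambda>t. 1)" for j using NA[of j] le1[of j] N1 mult_right_mono[of "(1/2)^j" 1 "N (\<lambda>t. 1)"] by linarith
  have uX: "(\<lambda>t. h n t - excess c (h n) t) \<in> X" for n c by (rule diff_X[OF h excess_X[OF h]])
  have "N (d j) \<le> \<kappa> + 1 + N (\<lambda>t. 1)" for j
  proof -
    let ?u = "\<lambda>t. h (r j) t - excess (real (m j)) (h (r j)) t"
    have "N (\<lambda>t. v j t - ?u t) = N (\<lambda>t. ?u t - v j t)"
      using norm_uminus[OF diff_X[OF uX vX], of "r j" "real (m j)" j] by simp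
    then have "N (v j) \<le> N ?u + 1" using norm_triangle_sub[OF vX uX, of j "r j" "real (m j)"] Pj(5)[of j] le1[of j] by linarith
    moreover have "N ?u \<le> N (h (r j))"
      by (rule norm_mono[OF X_L0[OF uX] h]) (auto simp: excess_def)
    moreover have "N (d j) \<le> N (v j) + N (A j)" unfolding d_def[abs_def] by (rule norm_diff[OF vX AX])
    ultimately show ?thesis using NA1[of j] \<kappa>[of "r j"] by linarith
  qed
  moreover have "N (\<lambda>t. h (r j) t - excess (real (m j)) (h (r j)) t - d j t) \<le> (1 + N (\<lambda>t. 1)) * (1 / 2) ^ j" for j
  proof -
    have "N (\<lambda>t. (h (r j) t - excess (real (m j)) (h (r j)) t - v j t) + A j t)
      \<le> N (\<lambda>t. h (r j) t - excess (real (m j)) (h (r j)) t - v j t) + N (A j)"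
      by (rule norm_triangle[OF diff_X[OF uX vX] AX])
    also have "\<dots> \<le> (1 / 2) ^ j + (1 / 2) ^ j * N (\<lambda>t. 1)" using Pj(5)[of j] NA[of j] by linarith
    finally show ?thesis by (simp add: d_def algebra_simps)
  qed
  moreover have "dyadic_differences a b d"
    unfolding dyadic_differences_def
  proof (intro allI conjI impI)
    fix j
    show "a j \<le> b j" by (rule Pj(2))
    show "b j \<le> a (Suc j)" using Rj(2) by simp
    show "dyadic (b j) (d j)" unfolding d_def[abs_def] by (rule dyadic_comp2[OF Pj(3) Ad])
    fix w assume w: "dyadic (a j) w"
    have wb: "dyadic (b j) w" by (rule dyadic_mono[OF Pj(2) w])
    have "(LINT t|I01. w t * d j t) = (LINT t|I01. w t * v j t - w t * A j t)"
      by (simp add: d_def right_diff_distrib)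
    also have "\<dots> = (LINT t|I01. w t * v j t) - (LINT t|I01. w t * A j t)"
      by (rule Bochner_Integration.integral_diff) (rule dyadic_integrable[OF dyadic_comp2[OF wb]], rule Pj(3) Ad)+
    also have "\<dots> = 0" unfolding A_def using integral_mult_avg[OF w dyadic_integrable[OF Pj(3)]] by simp
    finally show "(LINT t|I01. w t * d j t) = 0" .
  qed
  moreover have "strict_mono r" using Rj(1) by (simp add: strict_mono_Suc_iff)
  ultimately show ?thesis using Pj(1) by blast
qed

lemma order_null_cesaro_split:
  assumes dd: "dyadic_differences a b d" and \<kappa>: "\<And>j. N (d j) \<le> \<kappa>"
    and F: "\<And>j. F j \<in> X" and G: "order_null (cesaro G)" "\<And>j. G j \<in> X"
    and s: "\<And>j. N (\<lambda>t. F j t - G j t - d j t) \<le> c * (1 / 2) ^ j"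
  shows "order_null (cesaro F)"
proof -
  have dX: "d j \<in> X" for j by (rule dyadic_X[OF dyadic_differencesD(3)[OF dd]])
  define e where "e j t = F j t - G j t - d j t" for j t
  have eX: "e j \<in> X" for j unfolding e_def[abs_def] by (intro diff_X F G dX)
  have "summable (\<lambda>j. N (e j))"
    by (rule summable_comparison_test'[of "\<lambda>j. c * (1 / 2) ^ j"])
      (use s norm_nonneg[OF eX] in \<open>auto simp: e_def[abs_def] intro!: summable_mult\<close>)
  then have "order_null (cesaro e)" by (rule order_null_cesaro_summable[OF eX])
  then have "order_null (\<lambda>m t. cesaro G m t + (cesaro d m t + cesaro e m t))"
    by (intro order_null_add G order_null_cesaro_differences[OF dd \<kappa>])
  moreover have "cesaro G m t + (cesaro d m t + cesaro e m t) = cesaro F m t" for m t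
    unfolding cesaro_def add_divide_distrib[symmetric] sum.distrib[symmetric] by (simp add: e_def)
  ultimately show ?thesis by (simp add: fun_eq_iff[symmetric] ext)
qed

lemma order_null_cesaro_order_continuous:
  fixes h :: "nat \<Rightarrow> real \<Rightarrow> real"
  assumes oc: "order_continuous X N" and h: "\<And>n. h n \<in> X" and \<kappa>: "\<And>n. N (h n) \<le> \<kappa>"
    and null: "\<And>k t. 0 \<le> t \<Longrightarrow> t < 1 \<Longrightarrow> (\<lambda>n. avg k (h n) t) \<longlonglongrightarrow> 0"
  shows "\<exists>r. strict_mono r \<and> order_null (cesaro (h \<circ> r))"
proof -
  define Q where "Q j n m \<longleftrightarrow> N (excess (real m) (h n)) < (1 / 2) ^ j" for j n m :: nat
  have "\<forall>\<^sub>F m in sequentially. Q j n m" for j n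
    unfolding Q_def by (rule order_tendstoD(2)[OF order_continuous_excess[OF oc h]]) simp
  from selection[of h \<kappa> Q, OF h \<kappa> null this]
  obtain r m a b d where r: "strict_mono r" "\<And>j. Q j (r j) (m j)" "dyadic_differences a b d"
    "\<And>j. N (d j) \<le> \<kappa> + 1 + N (\<lambda>t. 1)"
    "\<And>j. N (\<lambda>t. h (r j) t - excess (real (m j)) (h (r j)) t - d j t) \<le> (1 + N (\<lambda>t. 1)) * (1 / 2) ^ j"
    by blast
  define G where "G j = excess (real (m j)) (h (r j))" for j
  have GX: "G j \<in> X" for j unfolding G_def by (rule excess_X[OF h])
  have "summable (\<lambda>j. N (G j))"
    by (rule summable_comparison_test'[of "\<lambda>j. (1 / 2) ^ j"])
      (use r(2) norm_nonneg[OF GX] in \<open>auto simp: Q_def G_def intro: less_imp_le\<close>)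
  then have G: "order_null (cesaro G)" by (rule order_null_cesaro_summable[OF GX])
  have "order_null (cesaro (h \<circ> r))"
    by (rule order_null_cesaro_split[OF r(3,4) _ G GX, of _ "1 + N (\<lambda>t. 1)"])
      (use h GX r(5) in \<open>auto simp: G_def\<close>)
  then show ?thesis using r(1) by blast
qed

text \<open>Here the truncated parts need not be small in norm, but their modulars tend to zero by
  (M3) and (M1). Summable modulars give a dominated subsequence by (M2). The bound 1 on the norms is
  what (M3) requires.\<close>

lemma order_null_cesaro_modular:
  fixes h :: "nat \<Rightarrow> real \<Rightarrow> real"
  assumes \<rho>: "special_modular X N \<rho>" and h: "\<And>n. h n \<in> X" and \<kappa>: "\<And>n. N (h n) \<le> 1"
    and null: "\<And>k t. 0 \<le> t \<Longrightarrow> t < 1 \<Longrightarrow> (\<lambda>n. avg k (h n) t) \<longlonglongrightarrow> 0"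
  shows "\<exists>r. strict_mono r \<and> order_null (cesaro (h \<circ> r))"
proof -
  have M1: "(\<lambda>n. \<rho> (F n)) \<longlonglongrightarrow> 0"
    if "f \<in> X" "(\<lambda>t. 0) \<le>\<^sub>a f" "\<rho> f < \<infinity>" "order_converges X F (\<lambda>t. 0)"
      "\<And>n. (\<lambda>t. 0) \<le>\<^sub>a F n" "\<And>n. F n \<le>\<^sub>a f" for f F
    using \<rho> that unfolding special_modular_def by blast
  have M2: "\<exists>r. strict_mono r \<and> dominated_in X (F \<circ> r)"
    if "\<And>n. F n \<in> X" "(\<Sum>n. \<rho> (F n)) < \<infinity>" for F
    using \<rho> that unfolding special_modular_def by blast
  have M3: "\<rho> f < \<infinity>" if "f \<in> X" "N f \<le> 1" for f
    using \<rho> that unfolding special_modular_def by blast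
  define E where "E n m t = \<bar>excess (real m) (h n) t\<bar>" for n m :: nat and t
  have EX: "E n m \<in> X" for n m unfolding E_def[abs_def] by (rule abs_X[OF excess_X[OF h]])
  \<comment> \<open>The modular is to provide domination, the distribution function almost
    everywhere convergence; both are made summable in \<open>j\<close>.\<close>
  define Q where "Q j n m \<longleftrightarrow> \<rho> (E n m) < ennreal ((1 / 2) ^ j) \<and> dist_fn (h n) (real m) < (1 / 2) ^ j" for j n m :: nat
  have "\<forall>\<^sub>F m in sequentially. Q j n m" for j n
    unfolding Q_def
  proof (rule eventually_conj)
    have "(\<lambda>m. \<rho> (E n m)) \<longlonglongrightarrow> 0"
    proof (rule M1[OF abs_X[OF h]])
      show "\<rho> (\<lambda>t. \<bar>h n t\<bar>) < \<infinity>" by (rule M3) (use abs_X[OF h] norm_abs[OF h] \<kappa> in auto)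
      show "order_converges X (E n) (\<lambda>t. 0)"
      proof (rule order_convergesI[OF EX abs_X[OF h]])
        show "AE t in I01. (\<lambda>m. E n m t) \<longlonglongrightarrow> 0"
          unfolding E_def by (intro AE_I2 tendsto_rabs_zero tendsto_eventually excess_eventually_0)
        show "AE t in I01. \<bar>E n m t\<bar> \<le> \<bar>h n t\<bar>" for m by (auto simp: E_def excess_def)
      qed simp
    qed (auto simp: E_def excess_def)
    then show "\<forall>\<^sub>F m in sequentially. \<rho> (E n m) < ennreal ((1 / 2) ^ j)" by (rule order_tendstoD) simp
    show "\<forall>\<^sub>F m in sequentially. dist_fn (h n) (real m) < (1 / 2) ^ j"
      by (rule order_tendstoD(2)[OF dist_fn_tendsto_0[OF X_L0[OF h]]]) simp
  qed
  from selection[of h 1 Q, OF h \<kappa> null this]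
  obtain r m a b d where r: "strict_mono r" "\<And>j. Q j (r j) (m j)" "dyadic_differences a b d"
    "\<And>j. N (d j) \<le> 1 + 1 + N (\<lambda>t. 1)"
    "\<And>j. N (\<lambda>t. h (r j) t - excess (real (m j)) (h (r j)) t - d j t) \<le> (1 + N (\<lambda>t. 1)) * (1 / 2) ^ j"
    by blast
  have "(\<Sum>j. \<rho> (E (r j) (m j))) \<le> (\<Sum>j. ennreal ((1 / 2) ^ j))"
    by (intro suminf_le) (use r(2) in \<open>auto simp: Q_def intro: less_imp_le\<close>)
  also have "\<dots> = ennreal (\<Sum>j. (1 / 2) ^ j)"
    by (rule suminf_ennreal2) auto
  also have "\<dots> < \<infinity>" by simp
  finally obtain s where s: "strict_mono s" "dominated_in X ((\<lambda>j. E (r j) (m j)) \<circ> s)"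
    using M2[of "\<lambda>j. E (r j) (m j)", OF EX] by blast
  define G where "G j = excess (real (m (s j))) (h (r (s j)))" for j
  have GX: "G j \<in> X" for j unfolding G_def by (rule excess_X[OF h])
  have js: "j \<le> s j" for j by (rule strict_mono_imp_increasing[OF s(1)])
  have half: "(1 / 2) ^ s j \<le> (1 / 2 :: real) ^ j" for j using js by (intro power_decreasing) auto
  have "order_null G"
    unfolding order_null_def
  proof (intro conjI)
    obtain H where H: "H \<in> X" "\<And>j. AE t in I01. \<bar>E (r (s j)) (m (s j)) t\<bar> \<le> H t"
      using s(2) unfolding dominated_in_def by auto
    show "\<exists>H\<in>X. \<forall>n. AE t in I01. \<bar>G n t\<bar> \<le> H t"
      using H by (intro bexI[OF _ H(1)]) (auto simp: E_def G_def)
    \<comment> \<open>By Borel-Cantelli almost every point lies in only finitely many of the sets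
      where truncation took effect, so \<open>G j t\<close> is eventually zero.\<close>
    have "AE t in I01. \<forall>\<^sub>F j in sequentially. t \<in> space I01 - {x \<in> {0..1}. real (m (s j)) < \<bar>h (r (s j)) x\<bar>}"
    proof (rule borel_cantelli_AE1)
      show "{x \<in> {0..1}. real (m (s j)) < \<bar>h (r (s j)) x\<bar>} \<in> sets I01" for j by (rule dist_fn_sets[OF X_L0[OF h]])
      have "dist_fn (h (r (s j))) (real (m (s j))) \<le> (1 / 2) ^ j" for j
        using r(2)[of "s j"] half[of j] unfolding Q_def by linarith
      then show "summable (\<lambda>j. measure I01 {x \<in> {0..1}. real (m (s j)) < \<bar>h (r (s j)) x\<bar>})"
        unfolding dist_fn_def[symmetric]
        by (intro summable_comparison_test'[OF summable_geometric[of "1 / 2 :: real"], of 0])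
          (simp_all add: dist_fn_nonneg)
      show "emeasure I01 {x \<in> {0..1}. real (m (s j)) < \<bar>h (r (s j)) x\<bar>} < \<infinity>" for j
        by (simp add: I01.emeasure_eq_measure)
    qed
    then show "AE t in I01. (\<lambda>n. G n t) \<longlonglongrightarrow> 0"
    proof eventually_elim
      case (elim t)
      then have "\<forall>\<^sub>F j in sequentially. G j t = 0"
        by (rule eventually_mono) (simp add: G_def excess_def)
      then show ?case by (rule tendsto_eventually)
    qed
  qed (use GX in blast)
  then have G: "order_null (cesaro G)" by (rule order_null_cesaro)
  have dd: "dyadic_differences (a \<circ> s) (b \<circ> s) (d \<circ> s)"
    using dyadic_differences_subseq[OF r(3) s(1), of "\<lambda>j. 1"] by (simp add: comp_def)
  have "order_null (cesaro (h \<circ> (r \<circ> s)))"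
  proof (rule order_null_cesaro_split[OF dd _ _ G GX, of "1 + 1 + N (\<lambda>t. 1)" _ "1 + N (\<lambda>t. 1)"])
    fix j
    show "N ((d \<circ> s) j) \<le> 1 + 1 + N (\<lambda>t. 1)" using r(4)[of "s j"] by simp
    show "(h \<circ> (r \<circ> s)) j \<in> X" using h by simp
    have "(1 + N (\<lambda>t. 1)) * (1 / 2) ^ s j \<le> (1 + N (\<lambda>t. 1)) * (1 / 2) ^ j"
      using half norm_one_pos by (intro mult_left_mono) auto
    then show "N (\<lambda>t. (h \<circ> (r \<circ> s)) j t - G j t - (d \<circ> s) j t) \<le> (1 + N (\<lambda>t. 1)) * (1 / 2) ^ j"
      using r(5)[of "s j"] by (simp add: G_def)
  qed
  moreover have "strict_mono (r \<circ> s)" using r(1) s(1) by (rule strict_mono_o)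
  ultimately show ?thesis by blast
qed

end

section \<open>Weakly null sequences\<close>

context banach_function_space
begin

definition sublinear :: "((real \<Rightarrow> real) \<Rightarrow> real) \<Rightarrow> bool" where
  "sublinear q \<longleftrightarrow> (\<forall>f\<in>X. \<forall>g\<in>X. q (\<lambda>t. f t + g t) \<le> q f + q g) \<and>
     (\<forall>f\<in>X. \<forall>c\<ge>0. q (\<lambda>t. c * f t) = c * q f)"

lemma sublinearD:
  assumes "sublinear q"
  shows "f \<in> X \<Longrightarrow> g \<in> X \<Longrightarrow> q (\<lambda>t. f t + g t) \<le> q f + q g"
    "f \<in> X \<Longrightarrow> 0 \<le> c \<Longrightarrow> q (\<lambda>t. c * f t) = c * q f"
  using assms unfolding sublinear_def by blast+

lemma sublinear_norm: "sublinear N"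
  unfolding sublinear_def using norm_triangle norm_scale by auto

lemma sublinear_zero: "sublinear q \<Longrightarrow> q (\<lambda>t. 0) = 0"
  using sublinearD(2)[OF _ zero, of q 0] by simp

lemma sublinear_minus: "sublinear q \<Longrightarrow> f \<in> X \<Longrightarrow> - q (\<lambda>t. - f t) \<le> q f"
  using sublinearD(1)[of q f "\<lambda>t. - f t"] uminus_X[of f] sublinear_zero[of q] by simp

text \<open>Lowering a sublinear functional in the direction \<open>- y\<close> as far as sublinearity permits.\<close>

definition lowered :: "((real \<Rightarrow> real) \<Rightarrow> real) \<Rightarrow> (real \<Rightarrow> real) \<Rightarrow> (real \<Rightarrow> real) \<Rightarrow> real" where
  "lowered q y f = (if f \<in> X then INF t\<in>{0..}. q (\<lambda>s. f s + t * y s) - t * q y else 0)"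

text \<open>Subadditivity bounds the expression under the infimum from below by
  \<open>- q (\<lambda>s. - f s)\<close>, so the infimum is finite. The parameter
  \<open>t = 0\<close> gives the comparison with \<open>q\<close>, and \<open>t = 1\<close> at
  \<open>- y\<close> gives \<open>- q y\<close>.\<close>

lemma lowered:
  assumes q: "sublinear q" and y: "y \<in> X"
  shows lowered_sublinear: "sublinear (lowered q y)"
    and lowered_le: "\<And>f. f \<in> X \<Longrightarrow> lowered q y f \<le> q f"
    and lowered_minus: "lowered q y (\<lambda>t. - y t) \<le> - q y"
proof -
  let ?F = "\<lambda>f t. q (\<lambda>s. f s + t * y s) - t * q y"
  have tX: "(\<lambda>s. f s + t * y s) \<in> X" if "f \<in> X" for f t by (intro add scale that y)
  have lb: "- q (\<lambda>s. - f s) \<le> ?F f t" if f: "f \<in> X" and t: "0 \<le> t" for f t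
  proof -
    have "t * q y = q (\<lambda>s. t * y s)" using sublinearD(2)[OF q y t] by simp
    also have "(\<lambda>s. t * y s) = (\<lambda>s. (f s + t * y s) + - f s)" by auto
    also have "q \<dots> \<le> q (\<lambda>s. f s + t * y s) + q (\<lambda>s. - f s)"
      by (rule sublinearD(1)[OF q tX[OF f] uminus_X[OF f]])
    finally show ?thesis by linarith
  qed
  have bdd: "bdd_below (?F f ` {0..})" if "f \<in> X" for f
    using lb[OF that] by (intro bdd_belowI2[of _ "- q (\<lambda>s. - f s)"]) auto
  have le: "lowered q y f \<le> ?F f t" if "f \<in> X" "0 \<le> t" for f t
    unfolding lowered_def using that by (auto intro: cINF_lower[OF bdd])
  have ge: "c \<le> lowered q y f" if "f \<in> X" "\<And>t. 0 \<le> t \<Longrightarrow> c \<le> ?F f t" for f c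
    unfolding lowered_def using that by (auto intro!: cINF_greatest)
  show "lowered q y f \<le> q f" if "f \<in> X" for f using le[OF that, of 0] by simp
  show "lowered q y (\<lambda>t. - y t) \<le> - q y"
    using le[OF uminus_X[OF y], of 1] sublinear_zero[OF q] by simp
  show "sublinear (lowered q y)"
    unfolding sublinear_def
  proof (intro conjI ballI allI impI)
    fix f g assume fg: "f \<in> X" "g \<in> X"
    have 1: "lowered q y (\<lambda>t. f t + g t) \<le> ?F f t1 + ?F g t2" if "0 \<le> t1" "0 \<le> t2" for t1 t2
    proof -
      have "lowered q y (\<lambda>t. f t + g t) \<le> ?F (\<lambda>t. f t + g t) (t1 + t2)"
        by (rule le) (use fg that add in auto)
      also have "q (\<lambda>s. (f s + g s) + (t1 + t2) * y s) = q (\<lambda>s. (f s + t1 * y s) + (g s + t2 * y s))"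
        by (simp add: algebra_simps)
      also have "\<dots> \<le> q (\<lambda>s. f s + t1 * y s) + q (\<lambda>s. g s + t2 * y s)"
        by (rule sublinearD(1)[OF q tX[OF fg(1)] tX[OF fg(2)]])
      finally show ?thesis by (simp add: algebra_simps)
    qed
    have "lowered q y (\<lambda>t. f t + g t) - ?F g t2 \<le> lowered q y f" if "0 \<le> t2" for t2
    proof (rule ge[OF fg(1)])
      fix t1 :: real assume "0 \<le> t1"
      then show "lowered q y (\<lambda>t. f t + g t) - ?F g t2 \<le> ?F f t1" using 1[of t1 t2] that by linarith
    qed
    then have "lowered q y (\<lambda>t. f t + g t) - lowered q y f \<le> lowered q y g"
      by (intro ge[OF fg(2)]) (simp add: algebra_simps)
    then show "lowered q y (\<lambda>t. f t + g t) \<le> lowered q y f + lowered q y g" by linarith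
  next
    have half: "lowered q y (\<lambda>t. c * f t) / c \<le> lowered q y f" if f: "f \<in> X" and c: "0 < c" for f c
    proof (rule ge[OF f])
      fix t :: real assume t: "0 \<le> t"
      have "lowered q y (\<lambda>t. c * f t) \<le> ?F (\<lambda>t. c * f t) (c * t)"
        by (rule le) (use c t scale[OF f] in auto)
      also have "q (\<lambda>s. c * f s + c * t * y s) = q (\<lambda>s. c * (f s + t * y s))" by (simp add: algebra_simps)
      also have "\<dots> = c * q (\<lambda>s. f s + t * y s)" by (rule sublinearD(2)[OF q tX[OF f]]) (use c in simp)
      finally have "lowered q y (\<lambda>t. c * f t) \<le> c * ?F f t" by (simp add: algebra_simps)
      then show "lowered q y (\<lambda>t. c * f t) / c \<le> ?F f t" using c by (simp add: pos_divide_le_eq mult.commute)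
    qed
    fix f and c :: real assume f: "f \<in> X" and c: "0 \<le> c"
    show "lowered q y (\<lambda>t. c * f t) = c * lowered q y f"
    proof (cases "c = 0")
      case True
      have "?F (\<lambda>t. 0) t = 0" if "0 \<le> t" for t using sublinearD(2)[OF q y that] by simp
      then have "lowered q y (\<lambda>t. 0) = 0"
        using le[OF zero, of 0] ge[OF zero, of 0] sublinear_zero[OF q] by (intro antisym) auto
      then show ?thesis using True by simp
    next
      case False
      then have c: "0 < c" using c by simp
      have "lowered q y (\<lambda>t. 1 / c * (c * f t)) / (1 / c) \<le> lowered q y (\<lambda>t. c * f t)"
        by (rule half[OF scale[OF f]]) (use c in simp)
      then have "c * lowered q y f \<le> lowered q y (\<lambda>t. c * f t)" using c by (simp add: mult.commute)
      moreover have "lowered q y (\<lambda>t. c * f t) \<le> c * lowered q y f"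
        using half[OF f c] c by (simp add: pos_divide_le_eq mult.commute)
      ultimately show ?thesis by simp
    qed
  qed
qed

text \<open>Hahn--Banach: a minimal sublinear functional is linear.\<close>

lemma norming_functional:
  assumes f0: "f0 \<in> X"
  shows "\<exists>\<phi>. (\<forall>f\<in>X. \<forall>g\<in>X. \<phi> (\<lambda>t. f t + g t) = \<phi> f + \<phi> g) \<and> (\<forall>f\<in>X. \<forall>c. \<phi> (\<lambda>t. c * f t) = c * \<phi> f) \<and>
    (\<forall>f\<in>X. \<bar>\<phi> f\<bar> \<le> N f) \<and> \<phi> f0 = N f0"
proof -
  \<comment> \<open>The clause at \<open>- f0\<close> forces the final functional to attain
    \<open>N f0\<close> at \<open>f0\<close>. Vanishing off \<open>X\<close> makes members that
    agree on \<open>X\<close> equal, as antisymmetry demands.\<close>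
  define A where "A = {q. sublinear q \<and> (\<forall>f\<in>X. q f \<le> N f) \<and> q (\<lambda>t. - f0 t) \<le> - N f0 \<and> (\<forall>f. f \<notin> X \<longrightarrow> q f = 0)}"
  define P where "P q q' \<longleftrightarrow> (\<forall>f\<in>X. q' f \<le> q f)" for q q' :: "(real \<Rightarrow> real) \<Rightarrow> real"
  \<comment> \<open>\<open>P\<close> is the reversed pointwise order on \<open>X\<close>, so the
    maximal element provided by Zorn's lemma is a minimal functional.\<close>
  have "\<exists>m\<in>A. \<forall>q\<in>A. P m q \<longrightarrow> q = m"
  proof (rule predicate_Zorn)
    show "partial_order_on A (relation_of P A)"
    proof (rule partial_order_on_relation_ofI)
      fix q q' assume "q \<in> A" "q' \<in> A" "P q q'" "P q' q"
      then have "q f = q' f" for f by (cases "f \<in> X") (auto simp: A_def P_def intro: antisym)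
      then show "q = q'" by (rule ext)
    qed (auto simp: P_def intro: order_trans)
    fix Ch assume Ch: "Ch \<in> Chains (relation_of P A)"
    show "\<exists>u\<in>A. \<forall>q\<in>Ch. P q u"
    proof (cases "Ch = {}")
      case True
      have "lowered N f0 \<in> A" unfolding A_def
        using lowered[OF sublinear_norm f0] by (auto simp: lowered_def)
      then show ?thesis using True by blast
    next
      case False
      have ChA: "q \<in> A" if "q \<in> Ch" for q using Ch that unfolding Chains_def relation_of_def by auto
      have total: "P q q' \<or> P q' q" if "q \<in> Ch" "q' \<in> Ch" for q q'
        using Ch that unfolding Chains_def relation_of_def by auto
      have qA: "sublinear q" "\<And>f. f \<in> X \<Longrightarrow> q f \<le> N f" "q (\<lambda>t. - f0 t) \<le> - N f0" if "q \<in> Ch" for q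
        using ChA[OF that] unfolding A_def by auto
      define u where "u f = (if f \<in> X then INF q\<in>Ch. q f else 0)" for f
      have bdd: "bdd_below ((\<lambda>q. q f) ` Ch)" if "f \<in> X" for f
      proof (rule bdd_belowI2[of _ "- N f"])
        fix q assume q: "q \<in> Ch"
        show "- N f \<le> q f"
          using sublinear_minus[OF qA(1)[OF q] that] qA(2)[OF q uminus_X[OF that]] norm_uminus[OF that] by linarith
      qed
      have le: "u f \<le> q f" if "f \<in> X" "q \<in> Ch" for f q
        unfolding u_def using that by (auto intro: cINF_lower[OF bdd])
      have ge: "c \<le> u f" if "f \<in> X" "\<And>q. q \<in> Ch \<Longrightarrow> c \<le> q f" for f c
        unfolding u_def using that False by (auto intro!: cINF_greatest)
      obtain q0 where q0: "q0 \<in> Ch" using False by blast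
      have "sublinear u"
        unfolding sublinear_def
      proof (intro conjI ballI allI impI)
        fix f g assume fg: "f \<in> X" "g \<in> X"
        \<comment> \<open>In a chain one of \<open>q\<close> and \<open>q'\<close> lies below the
          other, and its own subadditivity gives the bound for both.\<close>
        have 1: "u (\<lambda>t. f t + g t) \<le> q f + q' g" if q: "q \<in> Ch" "q' \<in> Ch" for q q'
        proof (cases "P q q'")
          case True
          then have "q' f \<le> q f" using fg by (simp add: P_def)
          then show ?thesis using le[OF add[OF fg] q(2)] sublinearD(1)[OF qA(1)[OF q(2)] fg] by linarith
        next
          case False
          then have "q g \<le> q' g" using fg total[OF q] by (auto simp: P_def)
          then show ?thesis using le[OF add[OF fg] q(1)] sublinearD(1)[OF qA(1)[OF q(1)] fg] by linarith
        qed
        have "u (\<lambda>t. f t + g t) - q' g \<le> u f" if "q' \<in> Ch" for q'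
          by (rule ge[OF fg(1)]) (use 1[OF _ that] in \<open>simp add: algebra_simps\<close>)
        then have "u (\<lambda>t. f t + g t) - u f \<le> u g"
          by (intro ge[OF fg(2)]) (simp add: algebra_simps)
        then show "u (\<lambda>t. f t + g t) \<le> u f + u g" by linarith
      next
        fix f and c :: real assume f: "f \<in> X" and c: "0 \<le> c"
        show "u (\<lambda>t. c * f t) = c * u f"
        proof (cases "c = 0")
          case True
          have "u (\<lambda>t. 0) = 0"
          proof (rule antisym)
            show "u (\<lambda>t. 0) \<le> 0" using le[OF zero q0] sublinear_zero[OF qA(1)[OF q0]] by simp
            show "0 \<le> u (\<lambda>t. 0)" 
            proof (rule ge[OF zero])
              fix q assume "q \<in> Ch"
              then show "0 \<le> q (\<lambda>t. 0)" using sublinear_zero[OF qA(1)[of q]] by simp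
            qed
          qed
          then show ?thesis using True by simp
        next
          case False
          then have c0: "0 < c" using c by simp
          show ?thesis
          proof (rule antisym)
            have "u (\<lambda>t. c * f t) / c \<le> u f"
            proof (rule ge[OF f])
              fix q assume q: "q \<in> Ch"
              show "u (\<lambda>t. c * f t) / c \<le> q f"
                using le[OF scale[OF f, of c] q] sublinearD(2)[OF qA(1)[OF q] f c] c0
                by (simp add: pos_divide_le_eq mult.commute)
            qed
            then show "u (\<lambda>t. c * f t) \<le> c * u f" using c0 by (simp add: pos_divide_le_eq mult.commute)
            show "c * u f \<le> u (\<lambda>t. c * f t)"
            proof (rule ge[OF scale[OF f]])
              fix q assume q: "q \<in> Ch"
              show "c * u f \<le> q (\<lambda>t. c * f t)"
                unfolding sublinearD(2)[OF qA(1)[OF q] f c] by (rule mult_left_mono[OF le[OF f q] c])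
            qed
          qed
        qed
      qed
      moreover have "u f \<le> N f" if "f \<in> X" for f using le[OF that q0] qA(2)[OF q0 that] by linarith
      moreover have "u (\<lambda>t. - f0 t) \<le> - N f0" using le[OF uminus_X[OF f0] q0] qA(3)[OF q0] by linarith
      ultimately have "u \<in> A" unfolding A_def by (simp add: u_def)
      then show ?thesis using le unfolding P_def by blast
    qed
  qed
  then obtain m where m: "m \<in> A" "\<And>q. q \<in> A \<Longrightarrow> P m q \<Longrightarrow> q = m" by blast
  have sm: "sublinear m" and mN: "\<And>f. f \<in> X \<Longrightarrow> m f \<le> N f" and mf: "m (\<lambda>t. - f0 t) \<le> - N f0"
    using m(1) unfolding A_def by auto
  \<comment> \<open>\<open>lowered m y\<close> is again in \<open>A\<close> and lies below
    \<open>m\<close>, so minimality makes them equal; the value at \<open>- y\<close> then shows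
    that \<open>m\<close> is odd.\<close>
  have neg: "m (\<lambda>t. - y t) \<le> - m y" if y: "y \<in> X" for y
  proof -
    note L = lowered[OF sm y]
    have "lowered m y \<in> A" unfolding A_def
      using L(1) L(2) mN L(2)[OF uminus_X[OF f0]] mf by (auto simp: lowered_def intro: order_trans)
    moreover have "P m (lowered m y)" unfolding P_def using L(2) by blast
    ultimately have "lowered m y = m" by (rule m(2))
    then show ?thesis using L(3) by simp
  qed
  have odd: "m (\<lambda>t. - f t) = - m f" if "f \<in> X" for f
  proof (rule antisym[OF neg[OF that]])
    show "- m f \<le> m (\<lambda>t. - f t)" using sublinear_minus[OF sm that] by linarith
  qed
  have addm: "m (\<lambda>t. f t + g t) = m f + m g" if fg: "f \<in> X" "g \<in> X" for f g
  proof (rule antisym)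
    show "m (\<lambda>t. f t + g t) \<le> m f + m g" by (rule sublinearD(1)[OF sm fg])
    have "m (\<lambda>t. - f t + - g t) \<le> m (\<lambda>t. - f t) + m (\<lambda>t. - g t)"
      by (rule sublinearD(1)[OF sm uminus_X[OF fg(1)] uminus_X[OF fg(2)]])
    moreover have "(\<lambda>t. - f t + - g t) = (\<lambda>t. - (f t + g t))" by auto
    ultimately show "m f + m g \<le> m (\<lambda>t. f t + g t)" using odd[OF fg(1)] odd[OF fg(2)] odd[OF add[OF fg]] by simp
  qed
  have scm: "m (\<lambda>t. c * f t) = c * m f" if f: "f \<in> X" for f c
  proof (cases "0 \<le> c")
    case True
    then show ?thesis by (rule sublinearD(2)[OF sm f])
  next
    case False
    have "m (\<lambda>t. c * f t) = m (\<lambda>t. (- c) * (- f t))" by simp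
    also have "\<dots> = (- c) * m (\<lambda>t. - f t)" by (rule sublinearD(2)[OF sm uminus_X[OF f]]) (use False in simp)
    finally show ?thesis using odd[OF f] by simp
  qed
  have "\<bar>m f\<bar> \<le> N f" if f: "f \<in> X" for f
    using mN[OF f] mN[OF uminus_X[OF f]] odd[OF f] norm_uminus[OF f] by linarith
  moreover have "m f0 = N f0" using mN[OF f0] mf odd[OF f0] by linarith
  ultimately show ?thesis using addm scm by (intro exI[of _ m]) auto
qed

lemma dual_functionalI:
  assumes "\<And>f g. f \<in> X \<Longrightarrow> g \<in> X \<Longrightarrow> \<phi> (\<lambda>t. f t + g t) = \<phi> f + \<phi> g"
    "\<And>f c. f \<in> X \<Longrightarrow> \<phi> (\<lambda>t. c * f t) = c * \<phi> f" "\<And>f. f \<in> X \<Longrightarrow> \<bar>\<phi> f\<bar> \<le> C * N f"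
  shows "dual_functional X N \<phi>"
  using assms unfolding dual_functional_def by blast

text \<open>Uniform boundedness by a gliding hump: the signs are chosen so that the \<open>j\<close>-th partial sum is
  at least \<open>N (x j) / 3 ^ j\<close> in modulus at \<open>x j\<close>, and the remaining terms contribute at most half of that.\<close>

lemma gliding_hump:
  fixes x :: "nat \<Rightarrow> real \<Rightarrow> real"
  assumes x: "\<And>j. x j \<in> X"
  shows "\<exists>\<phi>. dual_functional X N \<phi> \<and> (\<forall>j. N (x j) / (2 * 3 ^ j) \<le> \<bar>\<phi> (x j)\<bar>)"
proof -
  have "\<forall>j. \<exists>\<phi>. (\<forall>f\<in>X. \<forall>g\<in>X. \<phi> (\<lambda>t. f t + g t) = \<phi> f + \<phi> g) \<and> (\<forall>f\<in>X. \<forall>c. \<phi> (\<lambda>t. c * f t) = c * \<phi> f) \<and>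
    (\<forall>f\<in>X. \<bar>\<phi> f\<bar> \<le> N f) \<and> \<phi> (x j) = N (x j)"
    using norming_functional[OF x] by blast
  then obtain \<psi> where \<psi>: "\<And>j f g. f \<in> X \<Longrightarrow> g \<in> X \<Longrightarrow> \<psi> j (\<lambda>t. f t + g t) = \<psi> j f + \<psi> j g"
    "\<And>j f c. f \<in> X \<Longrightarrow> \<psi> j (\<lambda>t. c * f t) = c * \<psi> j f" "\<And>j f. f \<in> X \<Longrightarrow> \<bar>\<psi> j f\<bar> \<le> N f"
    "\<And>j. \<psi> j (x j) = N (x j)"
    by (drule_tac choice) blast
  \<comment> \<open>With ratio \<open>1 / 3\<close> the tail after stage \<open>j\<close> is at most
    \<open>3 / 2 * c (Suc j) = c j / 2\<close> times the norm, which leaves half of the hump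
    \<open>c j * N (x j)\<close>.\<close>
  define c where "c j = (1 / 3 :: real) ^ j" for j :: nat
  have c0: "0 < c j" for j by (simp add: c_def)
  define \<Phi> where "\<Phi> = rec_nat (\<lambda>f. 0) (\<lambda>j A f. A f + (if 0 \<le> A (x j) then c j else - c j) * \<psi> j f)"
  have \<Phi>0: "\<Phi> 0 f = 0" for f by (simp add: \<Phi>_def)
  have \<Phi>S: "\<Phi> (Suc j) f = \<Phi> j f + (if 0 \<le> \<Phi> j (x j) then c j else - c j) * \<psi> j f" for j f
    by (simp add: \<Phi>_def)
  have lin: "\<Phi> n (\<lambda>t. f t + g t) = \<Phi> n f + \<Phi> n g" if "f \<in> X" "g \<in> X" for n f g
    by (induction n) (simp_all add: \<Phi>0 \<Phi>S \<psi>(1)[OF that] algebra_simps)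
  have hom: "\<Phi> n (\<lambda>t. a * f t) = a * \<Phi> n f" if "f \<in> X" for n f a
    by (induction n) (simp_all add: \<Phi>0 \<Phi>S \<psi>(2)[OF that] algebra_simps)
  have stp: "\<bar>\<Phi> (Suc j) f - \<Phi> j f\<bar> \<le> c j * N f" if "f \<in> X" for j f
    using \<psi>(3)[OF that, of j] c0[of j] by (auto simp: \<Phi>S abs_mult intro!: mult_left_mono)
  have big: "c j * N (x j) \<le> \<bar>\<Phi> (Suc j) (x j)\<bar>" for j
  proof -
    have "0 \<le> c j * N (x j)" using c0[of j] norm_nonneg[OF x] by simp
    then show ?thesis by (auto simp: \<Phi>S \<psi>(4))
  qed
  have diff: "\<bar>\<Phi> n f - \<Phi> m f\<bar> \<le> 3 / 2 * (c m - c n) * N f" if "f \<in> X" "m \<le> n" for m n f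
    using that(2)
  proof (induction n rule: dec_induct)
    case (step n)
    have "c n = 3 * c (Suc n)" by (simp add: c_def)
    then have "3 / 2 * (c m - c (Suc n)) = 3 / 2 * (c m - c n) + c n"
      by (simp add: algebra_simps diff_divide_distrib)
    then have "3 / 2 * (c m - c (Suc n)) * N f = 3 / 2 * (c m - c n) * N f + c n * N f"
      by (simp only: distrib_right)
    then show ?case using step stp[OF that(1), of n] by linarith
  qed simp
  have diff': "\<bar>\<Phi> n f - \<Phi> m f\<bar> \<le> 3 / 2 * c m * N f" if "f \<in> X" "m \<le> n" for m n f
  proof -
    have "0 \<le> 3 / 2 * c n * N f" using c0[of n] norm_nonneg[OF that(1)] by simp
    then show ?thesis using diff[OF that] by (simp add: algebra_simps)
  qed
  have conv: "convergent (\<lambda>n. \<Phi> n f)" if f: "f \<in> X" for f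
  proof -
    have "summable (\<lambda>j. c j * N f)" unfolding c_def by (intro summable_mult2 summable_geometric) simp
    then have "summable (\<lambda>j. \<Phi> (Suc j) f - \<Phi> j f)"
      by (rule summable_comparison_test'[of _ 0]) (use stp[OF f] in auto)
    then have "convergent (\<lambda>n. \<Sum>j<n. \<Phi> (Suc j) f - \<Phi> j f)" by (simp add: summable_iff_convergent)
    then show ?thesis using sum_lessThan_telescope[of "\<lambda>j. \<Phi> j f"] by (simp add: \<Phi>0)
  qed
  define \<phi> where "\<phi> f = lim (\<lambda>n. \<Phi> n f)" for f
  have lim: "(\<lambda>n. \<Phi> n f) \<longlonglongrightarrow> \<phi> f" if "f \<in> X" for f
    unfolding \<phi>_def using conv[OF that] by (simp add: convergent_LIMSEQ_iff)
  have tail: "\<bar>\<phi> f - \<Phi> m f\<bar> \<le> 3 / 2 * c m * N f" if f: "f \<in> X" for f m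
    by (rule LIMSEQ_le_const2[OF tendsto_rabs[OF tendsto_diff[OF lim[OF f] tendsto_const]]])
      (use diff'[OF f] in blast)
  have "dual_functional X N \<phi>"
  proof (rule dual_functionalI)
    fix f g assume fg: "f \<in> X" "g \<in> X"
    show "\<phi> (\<lambda>t. f t + g t) = \<phi> f + \<phi> g"
      by (rule LIMSEQ_unique[OF lim[OF add[OF fg]]]) (use tendsto_add[OF lim[OF fg(1)] lim[OF fg(2)]] lin[OF fg] in simp)
  next
    fix f a assume f: "f \<in> X"
    show "\<phi> (\<lambda>t. a * f t) = a * \<phi> f"
      by (rule LIMSEQ_unique[OF lim[OF scale[OF f]]]) (use tendsto_mult_left[OF lim[OF f], of a] hom[OF f] in simp)
    show "\<bar>\<phi> f\<bar> \<le> 3 / 2 * N f" using tail[OF f, of 0] by (simp add: \<Phi>0 c_def)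
  qed
  moreover have "N (x j) / (2 * 3 ^ j) \<le> \<bar>\<phi> (x j)\<bar>" for j
  proof -
    have "3 / 2 * c (Suc j) * N (x j) = c j * N (x j) / 2" by (simp add: c_def)
    then have "c j * N (x j) / 2 \<le> \<bar>\<phi> (x j)\<bar>" using tail[OF x, of j "Suc j"] big[of j] by linarith
    then show ?thesis by (simp add: c_def power_divide)
  qed
  ultimately show ?thesis by blast
qed

text \<open>Terms with norms above \<open>4 ^ j\<close> outgrow the losses \<open>2 * 3 ^ j\<close>
  of the gliding hump, so one functional would be unbounded on the sequence. The indices
  \<open>n j\<close> need not increase, as only boundedness is contradicted.\<close>

lemma weakly_null_bounded:
  assumes f: "weakly_null X N f"
  shows "\<exists>C. \<forall>n. N (f n) \<le> C"
proof (rule ccontr)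
  assume "\<not> (\<exists>C. \<forall>n. N (f n) \<le> C)"
  then have "\<exists>n. 4 ^ j < N (f n)" for j :: nat by (meson not_le)
  then obtain n where n: "\<And>j::nat. 4 ^ j < N (f (n j))" by metis
  have fX: "f n \<in> X" for n using f by (simp add: weakly_null_def)
  obtain \<phi> where \<phi>: "dual_functional X N \<phi>" "\<And>j. N (f (n j)) / (2 * 3 ^ j) \<le> \<bar>\<phi> (f (n j))\<bar>"
    using gliding_hump[of "\<lambda>j. f (n j)", OF fX] by blast
  have "(\<lambda>k. \<phi> (f k)) \<longlonglongrightarrow> 0" using f \<phi>(1) by (simp add: weakly_null_def)
  then have "Bseq (\<lambda>k. \<phi> (f k))" by (rule convergentI[THEN convergent_imp_Bseq])
  then obtain K where K: "\<And>k. \<bar>\<phi> (f k)\<bar> \<le> K" unfolding Bseq_def by auto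
  obtain j :: nat where j: "2 * K < (4 / 3) ^ j" using real_arch_pow[of "4 / 3" "2 * K"] by auto
  have "(4 / 3 :: real) ^ j / 2 = 4 ^ j / (2 * 3 ^ j)" by (simp add: power_divide)
  also have "\<dots> \<le> N (f (n j)) / (2 * 3 ^ j)" using n[of j] by (intro divide_right_mono) auto
  also have "\<dots> \<le> K" using \<phi>(2)[of j] K[of "n j"] by linarith
  finally show False using j by linarith
qed

end

section \<open>The order continuous case\<close>

context boyd_convex_space
begin

text \<open>The embedding into L1 makes these functionals bounded. Apart from norm boundedness,
  convergence of the averages to zero is all that is extracted from weak nullity.\<close>

lemma avg_dual_functional: "dual_functional X N (\<lambda>f. avg k f t)"
proof -
  obtain L where L: "0 < L" "\<And>f. f \<in> X \<Longrightarrow> (LINT t|I01. \<bar>f t\<bar>) \<le> L * N f" using integral_abs_le by blast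
  show ?thesis
  proof (rule dual_functionalI[of _ "2 ^ k * L"])
    fix f g assume fg: "f \<in> X" "g \<in> X"
    have "avg k (\<lambda>t. f t - (- g t)) t = avg k f t - avg k (\<lambda>t. - g t) t"
      by (rule avg_diff[OF integrable_X[OF fg(1)] integrable_X[OF uminus_X[OF fg(2)]]])
    then show "avg k (\<lambda>t. f t + g t) t = avg k f t + avg k g t" by (simp add: avg_def)
  next
    fix f and c :: real assume f: "f \<in> X"
    show "avg k (\<lambda>t. c * f t) t = c * avg k f t" by (simp add: avg_def mult.left_commute[of _ c])
    have "2 ^ k * (LINT t|I01. \<bar>f t\<bar>) \<le> 2 ^ k * (L * N f)" using L(2)[OF f] by (intro mult_left_mono) auto
    then show "\<bar>avg k f t\<bar> \<le> 2 ^ k * L * N f" using avg_abs_le[OF integrable_X[OF f], of k t]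
      unfolding mult.assoc by (rule order_trans[rotated])
  qed
qed

lemma order_continuous_imp_weak_order_Banach_Saks:
  assumes oc: "order_continuous X N"
  shows "weak_order_Banach_Saks X N"
  unfolding weak_order_Banach_Saks_def
proof (intro allI impI)
  fix f assume f: "weakly_null X N f"
  have fX: "f n \<in> X" for n using f by (simp add: weakly_null_def)
  obtain \<kappa> where \<kappa>: "\<And>n. N (f n) \<le> \<kappa>" using weakly_null_bounded[OF f] by blast
  have "(\<lambda>n. avg k (f n) t) \<longlonglongrightarrow> 0" for k t
    using f avg_dual_functional unfolding weakly_null_def by blast
  then obtain r where r: "strict_mono r" "order_null (cesaro (f \<circ> r))"
    using order_null_cesaro_order_continuous[of f \<kappa>, OF oc fX \<kappa>] by blast
  have "order_converges X (\<lambda>n t. 1 * cesaro (f \<circ> r) n t + 0) (\<lambda>t. 0)"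
    by (rule order_converges_order_null_add[OF r(2) zero])
  then show "\<exists>r l. strict_mono r \<and> order_converges X (cesaro (f \<circ> r)) l"
    using r(1) by (auto simp: fun_eq_iff)
qed

end

section \<open>Weak limits of bounded sequences\<close>

lemma diagonal_convergent_subsequence:
  fixes V :: "nat \<Rightarrow> 'a::countable \<Rightarrow> real"
  assumes V: "\<And>n x. \<bar>V n x\<bar> \<le> B"
  shows "\<exists>r. strict_mono r \<and> (\<forall>x. convergent (\<lambda>n. V (r n) x))"
proof -
  define P where "P k s \<longleftrightarrow> convergent (\<lambda>n. V (s n) (from_nat k))" for k and s :: "nat \<Rightarrow> nat"
  interpret subseqs P
  proof
    fix k and s :: "nat \<Rightarrow> nat"
    have "bounded (range (\<lambda>n. V (s n) (from_nat k)))"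
      by (rule boundedI[of _ B]) (use V in auto)
    then obtain l r where "strict_mono r" "((\<lambda>n. V (s n) (from_nat k)) \<circ> r) \<longlonglongrightarrow> l"
      using bounded_imp_convergent_subsequence by blast
    then show "\<exists>r'. strict_mono r' \<and> P k (s \<circ> r')"
      unfolding P_def convergent_def by (auto simp: comp_def)
  qed
  have "P k (diagseq \<circ> (+) (Suc k))" for k
  proof (rule diagseq_holds)
    fix r s :: "nat \<Rightarrow> nat" and n assume "strict_mono r" "P n s"
    then show "P n (s \<circ> r)"
      using convergent_subseq_convergent[of "\<lambda>i. V (s i) (from_nat n)" r] by (simp add: P_def comp_def)
  qed
  from this[of "to_nat x" for x :: 'a] have "convergent (\<lambda>n. V (diagseq (n + Suc (to_nat x))) x)" for x
    by (simp add: P_def comp_def add.commute)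
  then have "convergent (\<lambda>n. V (diagseq n) x)" for x
    using convergent_ignore_initial_segment[of "\<lambda>n. V (diagseq n) x" "Suc (to_nat x)"] by simp
  then show ?thesis using subseq_diagseq by blast
qed

lemma avg_const: "0 \<le> t \<Longrightarrow> t < 1 \<Longrightarrow> avg k (\<lambda>s. c) t = c"
  using avg_shift[of k "\<lambda>s. c" k t "\<lambda>x. x"] dyadicI[of k "\<lambda>s. c"] by (simp add: shift_def)

lemma avg_mono:
  assumes "integrable I01 f" "integrable I01 g" "AE s in I01. f s \<le> g s"
  shows "avg k f t \<le> avg k g t"
  unfolding avg_def
proof (rule mult_left_mono)
  show "(LINT s|I01. of_bool (\<lfloor>2 ^ k * s\<rfloor> = \<lfloor>2 ^ k * t\<rfloor>) * f s)
      \<le> (LINT s|I01. of_bool (\<lfloor>2 ^ k * s\<rfloor> = \<lfloor>2 ^ k * t\<rfloor>) * g s)"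
    by (rule integral_mono_AE[OF integrable_avg_one_interval[OF assms(1)] integrable_avg_one_interval[OF assms(2)]])
      (use assms(3) in \<open>auto elim!: eventually_mono intro!: mult_left_mono\<close>)
qed simp

lemma avg_tower:
  assumes u: "integrable I01 u" and jk: "j \<le> k"
  shows "avg j (avg k u) t = avg j u t"
proof -
  have "dyadic k (\<lambda>s. of_bool (\<lfloor>2 ^ j * s\<rfloor> = \<lfloor>2 ^ j * t\<rfloor>))"
    by (rule dyadic_mono[OF jk], rule dyadicI) simp
  from integral_mult_avg[OF this u] show ?thesis by (simp add: avg_def[of j])
qed

lemma avg_cong:
  assumes "f \<in> L0" "g \<in> L0" "\<And>s. 0 \<le> s \<Longrightarrow> s < 1 \<Longrightarrow> f s = g s"
  shows "avg k f t = avg k g t"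
proof -
  have ind: "(\<lambda>s. of_bool (\<lfloor>2 ^ k * s\<rfloor> = \<lfloor>2 ^ k * t\<rfloor>) :: real) \<in> L0"
    by (rule dyadic_L0[of k], rule dyadicI) simp
  show ?thesis unfolding avg_def
    by (intro arg_cong[of _ _ "\<lambda>x. 2 ^ k * x"] integral_cong_AE borel_measurable_times ind assms(1,2)
        eventually_mono[OF AE_I01_less_1]) (use assms(3) in simp)
qed

lemma avg_tendsto:
  assumes g: "\<And>n. g n \<in> L0" "h \<in> L0" and w: "integrable I01 w"
    and B: "\<And>n. AE t in I01. \<bar>g n t\<bar> \<le> w t"
    and lim: "AE t in I01. (\<lambda>n. g n t) \<longlonglongrightarrow> h t"
  shows "(\<lambda>n. avg k (g n) t) \<longlonglongrightarrow> avg k h t"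
proof -
  let ?i = "\<lambda>s. of_bool (\<lfloor>2 ^ k * s\<rfloor> = \<lfloor>2 ^ k * t\<rfloor>) :: real"
  have ind: "?i \<in> L0" by (rule dyadic_L0[of k], rule dyadicI) simp
  have "(\<lambda>n. LINT s|I01. ?i s * g n s) \<longlonglongrightarrow> (LINT s|I01. ?i s * h s)"
  proof (rule integral_dominated_convergence[OF _ _ w])
    show "AE s in I01. (\<lambda>n. ?i s * g n s) \<longlonglongrightarrow> ?i s * h s"
      using lim by eventually_elim (rule tendsto_mult_left)
    show "AE s in I01. norm (?i s * g n s) \<le> w s" for n
      using B[of n] by eventually_elim (auto simp: abs_mult intro: order_trans[OF abs_ge_zero])
  qed (use ind g in \<open>auto intro: borel_measurable_times\<close>)
  then show ?thesis unfolding avg_def by (rule tendsto_mult_left)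
qed

text \<open>The function is tested against the indicator of \<open>{w < 0}\<close>, approximated by
  step functions. Their absolute values are nonnegative, so each test integral can be computed from
  the averages and is nonnegative; in the limit the integral of \<open>- |min 0 (w t)|\<close> is
  nonnegative.\<close>

lemma AE_nonneg_if_avg_nonneg:
  assumes w: "w \<in> L0" "\<And>t. 0 \<le> t \<Longrightarrow> t \<le> 1 \<Longrightarrow> \<bar>w t\<bar> \<le> B"
    and avg: "\<And>k t. 0 \<le> t \<Longrightarrow> t < 1 \<Longrightarrow> 0 \<le> avg k w t"
  shows "AE t in I01. 0 \<le> w t"
proof -
  have wint: "integrable I01 w" by (rule integrable_bounded[OF w])
  have B0: "0 \<le> B" using w(2)[of 0] by auto
  define u :: "real \<Rightarrow> real" where "u t = of_bool (w t < 0)" for t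
  have uL: "u \<in> L0" unfolding u_def[abs_def] using w(1) by measurable
  obtain v K where v: "\<And>n. dyadic (K n) (v n)" "\<And>n t. 0 \<le> t \<Longrightarrow> t \<le> 1 \<Longrightarrow> \<bar>v n t\<bar> \<le> 1"
    "AE t in I01. (\<lambda>n. v n t) \<longlonglongrightarrow> u t"
    using dyadic_approximation[OF uL, of 1] by (auto simp: u_def)
  have av: "dyadic (K n) (\<lambda>t. \<bar>v n t\<bar>)" for n by (rule dyadic_comp[OF v(1)])
  have "0 \<le> (LINT t|I01. \<bar>v n t\<bar> * w t)" for n
  proof -
    have "0 \<le> (LINT t|I01. \<bar>v n t\<bar> * avg (K n) w t)"
      by (rule integral_nonneg_AE, rule eventually_mono[OF AE_I01_less_1]) (use avg in auto)
    then show ?thesis using integral_mult_avg[OF av wint] by simp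
  qed
  moreover have "(\<lambda>n. LINT t|I01. \<bar>v n t\<bar> * w t) \<longlonglongrightarrow> (LINT t|I01. \<bar>u t\<bar> * w t)"
  proof (rule integral_dominated_convergence[where w="\<lambda>t. B"])
    show "AE t in I01. (\<lambda>n. \<bar>v n t\<bar> * w t) \<longlonglongrightarrow> \<bar>u t\<bar> * w t"
      using v(3) by eventually_elim (intro tendsto_intros)
    show "AE t in I01. norm (\<bar>v n t\<bar> * w t) \<le> B" for n
    proof (rule AE_I2)
      fix t assume "t \<in> space I01"
      then have "\<bar>v n t\<bar> * \<bar>w t\<bar> \<le> 1 * B" using v(2)[of t n] w(2)[of t] by (intro mult_mono) auto
      then show "norm (\<bar>v n t\<bar> * w t) \<le> B" by (simp add: abs_mult)
    qed
    show "(\<lambda>t. \<bar>v n t\<bar> * w t) \<in> L0" for n using dyadic_L0[OF av] w(1) by (rule borel_measurable_times)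
    show "(\<lambda>t. \<bar>u t\<bar> * w t) \<in> L0" using uL w(1) by measurable
  qed simp
  ultimately have ge: "0 \<le> (LINT t|I01. \<bar>u t\<bar> * w t)" by (intro LIMSEQ_le_const) auto
  have neg: "\<bar>u t\<bar> * w t = - \<bar>min 0 (w t)\<bar>" for t by (auto simp: u_def min_def)
  have mint: "integrable I01 (\<lambda>t. \<bar>min 0 (w t)\<bar>)"
  proof (rule integrable_bounded[of _ B])
    show "\<bar>\<bar>min 0 (w t)\<bar>\<bar> \<le> B" if "0 \<le> t" "t \<le> 1" for t using w(2)[OF that] B0
      by (auto simp: min_def abs_le_iff)
  qed (use w(1) in measurable)
  have "(LINT t|I01. \<bar>min 0 (w t)\<bar>) \<le> 0" using ge unfolding neg by simp
  moreover have "0 \<le> (LINT t|I01. \<bar>min 0 (w t)\<bar>)" by (rule integral_nonneg_AE) simp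
  ultimately have "(LINT t|I01. \<bar>min 0 (w t)\<bar>) = 0" by linarith
  then have "AE t in I01. \<bar>min 0 (w t)\<bar> = 0"
    by (subst (asm) integral_nonneg_eq_0_iff_AE[OF mint]) auto
  then show ?thesis by eventually_elim (auto simp: min_def split: if_splits)
qed

text \<open>Integrating \<open>|f| \<le> f^2 / (2 * e) + e / 2\<close> gives the strict bound
  directly.\<close>

lemma L1_le_L2:
  assumes f: "f \<in> L0" "\<And>t. 0 \<le> t \<Longrightarrow> t \<le> 1 \<Longrightarrow> \<bar>f t\<bar> \<le> B" and e: "0 < e"
    and le: "(LINT t|I01. (f t)\<^sup>2) < e\<^sup>2"
  shows "(LINT t|I01. \<bar>f t\<bar>) < e"
proof -
  have i2: "integrable I01 (\<lambda>t. (f t)\<^sup>2)"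
  proof (rule integrable_bounded[of _ "B\<^sup>2"])
    show "\<bar>(f t)\<^sup>2\<bar> \<le> B\<^sup>2" if "0 \<le> t" "t \<le> 1" for t
      using power_mono[OF f(2)[OF that], of 2] by simp
  qed (use f(1) in measurable)
  have "(LINT t|I01. \<bar>f t\<bar>) \<le> (LINT t|I01. (1 / (2 * e)) * (f t)\<^sup>2 + e / 2)"
  proof (rule integral_mono)
    show "integrable I01 (\<lambda>t. (1 / (2 * e)) * (f t)\<^sup>2 + e / 2)" using i2 by simp
    fix t
    have "0 \<le> (\<bar>f t\<bar> - e)\<^sup>2" by simp
    then have "2 * e * \<bar>f t\<bar> \<le> (f t)\<^sup>2 + e\<^sup>2" by (simp add: power2_diff algebra_simps)
    then have "2 * e * \<bar>f t\<bar> \<le> 2 * e * ((1 / (2 * e)) * (f t)\<^sup>2 + e / 2)"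
      using e by (simp add: algebra_simps power2_eq_square)
    then show "\<bar>f t\<bar> \<le> (1 / (2 * e)) * (f t)\<^sup>2 + e / 2" using e by (subst (asm) mult_le_cancel_left_pos) auto
  qed (use integrable_bounded[OF f] in simp)
  also have "\<dots> = (1 / (2 * e)) * (LINT t|I01. (f t)\<^sup>2) + e / 2"
    using i2 by (subst Bochner_Integration.integral_add) auto
  also have "(1 / (2 * e)) * (LINT t|I01. (f t)\<^sup>2) < (1 / (2 * e)) * e\<^sup>2"
    using le e by (intro mult_strict_left_mono) auto
  also have "(1 / (2 * e)) * e\<^sup>2 = e / 2" using e by (simp add: power2_eq_square)
  finally show ?thesis by simp
qed

text \<open>The increments are orthogonal in \<open>L\<^sup>2\<close>, so the martingale is Cauchy there.\<close>

lemma bounded_martingale_limit: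
  fixes g :: "nat \<Rightarrow> real \<Rightarrow> real"
  assumes g: "\<And>k. dyadic k (g k)" and B: "\<And>k t. 0 \<le> g k t \<and> g k t \<le> B"
    and tower: "\<And>j k t. j \<le> k \<Longrightarrow> 0 \<le> t \<Longrightarrow> t < 1 \<Longrightarrow> avg j (g k) t = g j t"
  shows "\<exists>w r. w \<in> L0 \<and> (\<forall>t. 0 \<le> w t \<and> w t \<le> B) \<and> strict_mono r \<and> (AE t in I01. (\<lambda>i. g (r i) t) \<longlonglongrightarrow> w t) \<and>
    (\<forall>k t. 0 \<le> t \<longrightarrow> t < 1 \<longrightarrow> avg k w t = g k t)"
proof -
  have B0: "0 \<le> B" using B[of 0 0] by linarith
  have gL: "g k \<in> L0" for k by (rule dyadic_L0[OF g])
  have abs: "\<bar>g k t\<bar> \<le> B" for k t using B[of k t] by auto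
  define a where "a k = (LINT t|I01. (g k t)\<^sup>2)" for k
  have sq: "integrable I01 (\<lambda>t. g j t * g k t)" for j k
  proof (rule integrable_bounded[of _ "B * B"])
    show "\<bar>g j t * g k t\<bar> \<le> B * B" for t unfolding abs_mult by (intro mult_mono abs B0 abs_ge_zero)
  qed (use gL in measurable)
  have orth: "(LINT t|I01. (g k t - g j t)\<^sup>2) = a k - a j" if jk: "j \<le> k" for j k
  proof -
    have "(LINT t|I01. g j t * g k t) = (LINT t|I01. g j t * avg j (g k) t)"
      using integral_mult_avg[OF g dyadic_integrable[OF g]] by simp
    also have "\<dots> = a j" unfolding a_def
      by (intro integral_cong_AE eventually_mono[OF AE_I01_less_1])
        (use tower[OF jk] gL dyadic_L0[OF dyadic_avg] in \<open>auto simp: power2_eq_square intro!: borel_measurable_times\<close>)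
    finally have 1: "(LINT t|I01. g j t * g k t) = a j" .
    have "(LINT t|I01. (g k t - g j t)\<^sup>2) = (LINT t|I01. (g k t * g k t + g j t * g j t) - 2 * (g j t * g k t))"
      by (simp add: power2_eq_square algebra_simps)
    also have "\<dots> = (LINT t|I01. g k t * g k t) + (LINT t|I01. g j t * g j t) - 2 * (LINT t|I01. g j t * g k t)"
      using sq by (subst Bochner_Integration.integral_diff, simp, simp, subst Bochner_Integration.integral_add) auto
    finally show ?thesis using 1 by (simp add: a_def power2_eq_square)
  qed
  have "incseq a"
  proof (rule incseq_SucI)
    fix k
    have "0 \<le> (LINT t|I01. (g (Suc k) t - g k t)\<^sup>2)" by (rule integral_nonneg_AE) simp
    then show "a k \<le> a (Suc k)" using orth[of k "Suc k"] by simp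
  qed
  moreover have "a k \<le> B * B" for k
  proof -
    have "a k \<le> (LINT t|I01. B * B)" unfolding a_def power2_eq_square
      by (rule integral_mono[OF sq]) (use B[of k] B0 in \<open>auto intro!: mult_mono\<close>)
    then show ?thesis by simp
  qed
  ultimately obtain L where "a \<longlonglongrightarrow> L" using incseq_convergent by blast
  then have Ca: "Cauchy a" by (simp add: LIMSEQ_imp_Cauchy)
  have "\<exists>n0. \<forall>i\<ge>n0. \<forall>j\<ge>n0. (LINT t|I01. norm (g i t - g j t)) < e" if e: "0 < e" for e
  proof -
    obtain n0 where n0: "\<And>i j. n0 \<le> i \<Longrightarrow> n0 \<le> j \<Longrightarrow> \<bar>a i - a j\<bar> < e\<^sup>2"
      using CauchyD[OF Ca, of "e\<^sup>2"] e by auto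
    have dB: "\<bar>g i t - g j t\<bar> \<le> 2 * B" for i j t using abs[of i t] abs[of j t] by linarith
    have dL: "(\<lambda>t. g i t - g j t) \<in> L0" for i j using gL by measurable
    have "(LINT t|I01. \<bar>g i t - g j t\<bar>) < e" if "n0 \<le> i" "n0 \<le> j" for i j
    proof (rule L1_le_L2[OF dL dB e])
      have "(LINT t|I01. (g i t - g j t)\<^sup>2) = \<bar>a i - a j\<bar>"
      proof (cases "j \<le> i")
        case True
        have "0 \<le> (LINT t|I01. (g i t - g j t)\<^sup>2)" by (rule integral_nonneg_AE) simp
        then show ?thesis using orth[OF True] by simp
      next
        case False
        have "0 \<le> (LINT t|I01. (g j t - g i t)\<^sup>2)" by (rule integral_nonneg_AE) simp
        moreover have "(LINT t|I01. (g i t - g j t)\<^sup>2) = (LINT t|I01. (g j t - g i t)\<^sup>2)"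
          by (rule Bochner_Integration.integral_cong) (auto simp: power2_commute)
        ultimately show ?thesis using orth[of i j] False by linarith
      qed
      then show "(LINT t|I01. (g i t - g j t)\<^sup>2) < e\<^sup>2" using n0[OF that] by simp
    qed
    then show ?thesis by auto
  qed
  then obtain r where r: "strict_mono r" "AE t in I01. Cauchy (\<lambda>i. g (r i) t)"
    using cauchy_L1_AE_cauchy_subseq[where s=g and M=I01, OF dyadic_integrable[OF g]] by blast
  \<comment> \<open>Clipping gives the bounds at every point, including those where the subsequence
    does not converge and \<open>lim\<close> is unspecified.\<close>
  define w where "w t = max 0 (min B (lim (\<lambda>i. g (r i) t)))" for t
  have wL: "w \<in> L0"
  proof -
    have "(\<lambda>t. lim (\<lambda>i. g (r i) t)) \<in> L0" by (rule borel_measurable_lim_metric) (rule gL)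
    then show ?thesis unfolding w_def[abs_def] by measurable
  qed
  have wB: "0 \<le> w t \<and> w t \<le> B" for t using B0 by (auto simp: w_def)
  have lim: "AE t in I01. (\<lambda>i. g (r i) t) \<longlonglongrightarrow> w t"
    using r(2)
  proof eventually_elim
    case (elim t)
    then have l: "(\<lambda>i. g (r i) t) \<longlonglongrightarrow> lim (\<lambda>i. g (r i) t)"
      by (simp add: Cauchy_convergent convergent_LIMSEQ_iff[symmetric])
    have "0 \<le> lim (\<lambda>i. g (r i) t)" "lim (\<lambda>i. g (r i) t) \<le> B"
      using LIMSEQ_le_const[OF l] LIMSEQ_le_const2[OF l] B by blast+
    then show ?case using l by (simp add: w_def)
  qed
  have "avg k w t = g k t" if t: "0 \<le> t" "t < 1" for k t
  proof (rule LIMSEQ_unique)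
    show "(\<lambda>i. avg k (g (r i)) t) \<longlonglongrightarrow> avg k w t"
      by (rule avg_tendsto[OF gL wL _ _ lim, of "\<lambda>t. B"]) (use abs in auto)
    have "avg k (g (r i)) t = g k t" if "k \<le> i" for i
      by (rule tower[OF _ t]) (use strict_mono_imp_increasing[OF r(1), of i] that in linarith)
    then show "(\<lambda>i. avg k (g (r i)) t) \<longlonglongrightarrow> g k t"
      by (intro tendsto_eventually eventually_sequentiallyI[of k])
  qed
  then show ?thesis using wL wB r(1) lim by blast
qed

section \<open>Norm bounds for weak limits, and the case of a special modular\<close>

context boyd_convex_space
begin

lemma norm_avg_bounded:
  assumes u: "u \<in> L0" and B: "\<And>t. 0 \<le> t \<Longrightarrow> t \<le> 1 \<Longrightarrow> \<bar>u t\<bar> \<le> B"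
  shows "N (avg k u) \<le> N u"
proof (rule field_le_epsilon)
  fix e :: real assume e: "0 < e"
  \<comment> \<open>With an accuracy of \<open>e / c\<close> the norm error of \<open>v\<close> and
    the error of the averages, \<open>2 ^ k\<close> times larger and measured by the norm of the
    constant one, add up to \<open>e\<close>.\<close>
  define c where "c = 1 + 2 ^ k * N (\<lambda>t. 1)"
  have c: "0 < c" unfolding c_def using norm_one_pos by (intro add_pos_pos mult_pos_pos) auto
  obtain K v where v: "k \<le> K" "dyadic K v" "N (\<lambda>t. u t - v t) < e / c" "(LINT t|I01. \<bar>u t - v t\<bar>) < e / c"
    using dyadic_density[OF u B, of "e / c" k] e c by auto
  have uX: "u \<in> X" using bounded_X[OF u B] by blast
  have vX: "v \<in> X" by (rule dyadic_X[OF v(2)])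
  have aX: "avg k f \<in> X" for f by (rule dyadic_X[OF dyadic_avg])
  have uint: "integrable I01 u" by (rule integrable_X[OF uX])
  have vint: "integrable I01 v" by (rule integrable_X[OF vX])
  have 1: "\<bar>avg k u t - avg k v t\<bar> \<le> 2 ^ k * (e / c)" for t
  proof -
    have "\<bar>avg k (\<lambda>t. u t - v t) t\<bar> \<le> 2 ^ k * (LINT t|I01. \<bar>u t - v t\<bar>)"
      by (rule avg_abs_le) (use uint vint in simp)
    also have "\<dots> \<le> 2 ^ k * (e / c)" using v(4) by (intro mult_left_mono) auto
    finally show ?thesis using avg_diff[OF uint vint] by simp
  qed
  have "N (avg k u) \<le> N (avg k v) + N (\<lambda>t. avg k u t - avg k v t)" by (rule norm_triangle_sub[OF aX aX])
  moreover have "N (\<lambda>t. avg k u t - avg k v t) \<le> 2 ^ k * (e / c) * N (\<lambda>t. 1)"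
    using bounded_X[OF X_L0[OF diff_X[OF aX aX]] 1] by blast
  moreover have "N (avg k v) \<le> N v" by (rule norm_avg_dyadic[OF v(2,1)])
  moreover have "N v \<le> N u + e / c"
  proof -
    have "N (\<lambda>t. v t - u t) = N (\<lambda>t. u t - v t)" using norm_uminus[OF diff_X[OF uX vX]] by simp
    then show ?thesis using norm_triangle_sub[OF vX uX] v(3) by linarith
  qed
  ultimately have "N (avg k u) \<le> N u + (e / c + 2 ^ k * (e / c) * N (\<lambda>t. 1))" by linarith
  also have "e / c + 2 ^ k * (e / c) * N (\<lambda>t. 1) = e"
  proof -
    have "d + 2 ^ k * d * N (\<lambda>t. 1) = d * c" for d by (simp add: c_def algebra_simps)
    from this[of "e / c"] show ?thesis using c by simp
  qed
  finally show "N (avg k u) \<le> N u + e" .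
qed

text \<open>This plays the role of the Fatou property for uniformly bounded sequences, on which
  almost everywhere convergence implies norm convergence.\<close>

lemma norm_le_of_bounded_limit:
  assumes g: "\<And>n. g n \<in> L0" "w \<in> L0" and B: "\<And>n t. \<bar>g n t\<bar> \<le> B" "\<And>t. \<bar>w t\<bar> \<le> B"
    and lim: "AE t in I01. (\<lambda>n. g n t) \<longlonglongrightarrow> w t" and \<kappa>: "\<And>n. N (g n) \<le> \<kappa>"
  shows "N w \<le> \<kappa>"
proof -
  have gX: "g n \<in> X" for n using bounded_X[OF g(1) B(1)] by blast
  have wX: "w \<in> X" using bounded_X[OF g(2) B(2)] by blast
  have "(\<lambda>n. N (\<lambda>t. w t - g n t)) \<longlonglongrightarrow> 0"
  proof (rule norm_bounded_tendsto_0[OF X_L0[OF diff_X[OF wX gX]]])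
    show "\<bar>w t - g n t\<bar> \<le> 2 * B" for n t using B(1)[of n t] B(2)[of t] by linarith
    show "AE t in I01. (\<lambda>n. w t - g n t) \<longlonglongrightarrow> 0"
      using lim by eventually_elim (auto intro!: tendsto_eq_intros)
  qed
  then have "(\<lambda>n. \<kappa> + N (\<lambda>t. w t - g n t)) \<longlonglongrightarrow> \<kappa> + 0" by (intro tendsto_intros)
  then have "N w \<le> \<kappa> + 0"
  proof (rule LIMSEQ_le_const, intro exI allI impI)
    fix n show "N w \<le> \<kappa> + N (\<lambda>t. w t - g n t)"
      using norm_triangle_sub[OF wX gX, of n] \<kappa>[of n] by linarith
  qed
  then show ?thesis by simp
qed

text \<open>The limits of the averages of level \<open>k\<close> form a bounded martingale by
  \<open>avg_tower\<close>, and \<open>w\<close> is its limit. The norm bound passes from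
  \<open>u n\<close> to its averages, to their limits \<open>g k\<close>, and finally to
  \<open>w\<close>.\<close>

lemma bounded_weak_limit:
  fixes u :: "nat \<Rightarrow> real \<Rightarrow> real"
  assumes u: "\<And>n. u n \<in> L0" and B: "\<And>n t. 0 \<le> u n t \<and> u n t \<le> B"
    and conv: "\<And>k t. 0 \<le> t \<Longrightarrow> t < 1 \<Longrightarrow> convergent (\<lambda>n. avg k (u n) t)" and \<kappa>: "\<And>n. N (u n) \<le> \<kappa>"
  shows "\<exists>w. w \<in> L0 \<and> (\<forall>t. 0 \<le> w t \<and> w t \<le> B) \<and> N w \<le> \<kappa> \<and>
    (\<forall>k t. 0 \<le> t \<longrightarrow> t < 1 \<longrightarrow> (\<lambda>n. avg k (u n) t) \<longlonglongrightarrow> avg k w t)"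
proof -
  have B0: "0 \<le> B" using B[of 0 0] by linarith
  have uB: "\<bar>u n t\<bar> \<le> B" for n t using B[of n t] by auto
  have uint: "integrable I01 (u n)" for n by (rule integrable_bounded[OF u uB])
  have avgB: "0 \<le> avg k (u n) t \<and> avg k (u n) t \<le> B" if "0 \<le> t" "t < 1" for k n t
    using avg_mono[of "\<lambda>s. 0" "u n" k t] avg_mono[of "u n" "\<lambda>s. B" k t] avg_const[OF that, of k] uint B by simp
  \<comment> \<open>\<open>bounded_martingale_limit\<close> asks for bounds on the whole line, while
    the averages are controlled only on \<open>[0,1)\<close>; clipping changes nothing
    there.\<close>
  define A where "A k n t = max 0 (min B (avg k (u n) t))" for k n t
  define g where "g k t = max 0 (min B (lim (\<lambda>n. avg k (u n) t)))" for k t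
  have Ad: "dyadic k (A k n)" for k n unfolding A_def[abs_def] by (rule dyadic_comp[OF dyadic_avg])
  have A_eq: "A k n t = avg k (u n) t" if "0 \<le> t" "t < 1" for k n t
    using avgB[OF that, of k n] by (simp add: A_def)
  have AB: "0 \<le> A k n t \<and> A k n t \<le> B" for k n t using B0 by (auto simp: A_def)
  have gd: "dyadic k (g k)" for k
  proof (rule dyadicI)
    fix s t :: real assume "\<lfloor>2 ^ k * s\<rfloor> = \<lfloor>2 ^ k * t\<rfloor>"
    then have "avg k (u n) s = avg k (u n) t" for n by (rule dyadic_eq[OF dyadic_avg])
    then show "g k s = g k t" by (simp add: g_def)
  qed
  have gB: "0 \<le> g k t \<and> g k t \<le> B" for k t using B0 by (auto simp: g_def)
  have glim: "(\<lambda>n. avg k (u n) t) \<longlonglongrightarrow> g k t" if t: "0 \<le> t" "t < 1" for k t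
  proof -
    have l: "(\<lambda>n. avg k (u n) t) \<longlonglongrightarrow> lim (\<lambda>n. avg k (u n) t)"
      using conv[OF t] by (simp add: convergent_LIMSEQ_iff)
    have "0 \<le> lim (\<lambda>n. avg k (u n) t)" "lim (\<lambda>n. avg k (u n) t) \<le> B"
      using LIMSEQ_le_const[OF l] LIMSEQ_le_const2[OF l] avgB[OF t] by blast+
    then show ?thesis using l by (simp add: g_def)
  qed
  have Alim: "AE t in I01. (\<lambda>n. A k n t) \<longlonglongrightarrow> g k t" for k
    by (rule eventually_mono[OF AE_I01_less_1]) (use glim A_eq in simp)
  have AL: "A k n \<in> L0" and gL: "g k \<in> L0" for k n using dyadic_L0 Ad gd by blast+
  have tower: "avg j (g k) t = g j t" if jk: "j \<le> k" and t: "0 \<le> t" "t < 1" for j k t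
  proof (rule LIMSEQ_unique)
    show "(\<lambda>n. avg j (A k n) t) \<longlonglongrightarrow> avg j (g k) t"
      by (rule avg_tendsto[OF AL gL _ _ Alim, of "\<lambda>t. B"]) (use AB in \<open>auto intro: AE_I2\<close>)
    have "avg j (A k n) t = avg j (u n) t" for n
    proof -
      have "avg j (A k n) t = avg j (avg k (u n)) t"
        by (rule avg_cong[OF AL dyadic_L0[OF dyadic_avg]]) (rule A_eq)
      then show ?thesis using avg_tower[OF uint jk] by simp
    qed
    then show "(\<lambda>n. avg j (A k n) t) \<longlonglongrightarrow> g j t" using glim[OF t] by simp
  qed
  have Ng: "N (g k) \<le> \<kappa>" for k
  proof (rule norm_le_of_bounded_limit[OF AL gL _ _ Alim])
    show "\<bar>A k n t\<bar> \<le> B" for n t using AB[of k n t] by auto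
    show "\<bar>g k t\<bar> \<le> B" for t using gB[of k t] by auto
    have "N (A k n) = N (avg k (u n))" for n
      by (rule norm_cong_01[OF dyadic_X[OF dyadic_avg] AL]) (rule A_eq[symmetric])
    from this[of n for n] show "N (A k n) \<le> \<kappa>" for n using norm_avg_bounded[OF u uB, of k n] \<kappa>[of n] by (rule ord_eq_le_trans[OF _ order_trans])
  qed
  obtain w r where w: "w \<in> L0" "\<And>t. 0 \<le> w t \<and> w t \<le> B" "AE t in I01. (\<lambda>i. g (r i) t) \<longlonglongrightarrow> w t"
    "\<And>k t. 0 \<le> t \<Longrightarrow> t < 1 \<Longrightarrow> avg k w t = g k t"
    using bounded_martingale_limit[OF gd gB tower] by blast
  have "N w \<le> \<kappa>"
  proof (rule norm_le_of_bounded_limit[OF gL w(1) _ _ w(3) Ng])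
    show "\<bar>g (r n) t\<bar> \<le> B" for n t using gB[of "r n" t] by auto
    show "\<bar>w t\<bar> \<le> B" for t using w(2)[of t] by auto
  qed
  then show ?thesis using w(1,2) w(4) glim by auto
qed

text \<open>The truncations at \<open>B\<close> have weak limits \<open>w B\<close> that increase
  with \<open>B\<close> and keep the norm bound, so monotone completeness puts their supremum into
  \<open>X\<close>. Uniform integrability makes the truncation error small uniformly in
  \<open>n\<close>, so that the limits in \<open>n\<close> and \<open>B\<close> may be
  interchanged.\<close>

lemma nonneg_weak_limit:
  fixes f :: "nat \<Rightarrow> real \<Rightarrow> real"
  assumes mc: "monotonically_complete X N" and f: "\<And>n. f n \<in> X" "\<And>n t. 0 \<le> f n t"
    and \<kappa>: "\<And>n. N (f n) \<le> \<kappa>"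
    and conv: "\<And>(B::nat) k t. 0 \<le> t \<Longrightarrow> t < 1 \<Longrightarrow> convergent (\<lambda>n. avg k (\<lambda>s. min (f n s) (real B)) t)"
  shows "\<exists>g\<in>X. \<forall>k t. 0 \<le> t \<longrightarrow> t < 1 \<longrightarrow> (\<lambda>n. avg k (f n) t) \<longlonglongrightarrow> avg k g t"
proof -
  define u where "u B n s = min (f n s) (real B)" for B n s
  have fL: "f n \<in> L0" for n by (rule X_L0[OF f(1)])
  have uL: "u B n \<in> L0" for B n unfolding u_def[abs_def] using fL by measurable
  have uB: "0 \<le> u B n t \<and> u B n t \<le> real B" for B n t using f(2)[of n t] by (auto simp: u_def)
  have uN: "N (u B n) \<le> \<kappa>" for B n
    by (rule order_trans[OF norm_mono[OF uL f(1)[of n]] \<kappa>]) (use f(2) in \<open>auto simp: u_def\<close>)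
  have "\<forall>B. \<exists>w. w \<in> L0 \<and> (\<forall>t. 0 \<le> w t \<and> w t \<le> real B) \<and> N w \<le> \<kappa> \<and>
    (\<forall>k t. 0 \<le> t \<longrightarrow> t < 1 \<longrightarrow> (\<lambda>n. avg k (u B n) t) \<longlonglongrightarrow> avg k w t)"
  proof
    fix B show "\<exists>w. w \<in> L0 \<and> (\<forall>t. 0 \<le> w t \<and> w t \<le> real B) \<and> N w \<le> \<kappa> \<and>
      (\<forall>k t. 0 \<le> t \<longrightarrow> t < 1 \<longrightarrow> (\<lambda>n. avg k (u B n) t) \<longlonglongrightarrow> avg k w t)"
      by (rule bounded_weak_limit[OF uL uB _ uN]) (simp add: u_def[abs_def] conv)
  qed
  then obtain w where "\<forall>B. w B \<in> L0 \<and> (\<forall>t. 0 \<le> w B t \<and> w B t \<le> real B) \<and> N (w B) \<le> \<kappa> \<and>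
    (\<forall>k t. 0 \<le> t \<longrightarrow> t < 1 \<longrightarrow> (\<lambda>n. avg k (u B n) t) \<longlonglongrightarrow> avg k (w B) t)" by (drule_tac choice) blast
  then have w: "w B \<in> L0" "0 \<le> w B t" "w B t \<le> real B" "N (w B) \<le> \<kappa>"
    "0 \<le> t \<Longrightarrow> t < 1 \<Longrightarrow> (\<lambda>n. avg k (u B n) t) \<longlonglongrightarrow> avg k (w B) t" for B k t by blast+
  have wX: "w B \<in> X" for B using bounded_X[OF w(1), of B "real B"] w(2,3)[of B] by auto
  have uint: "integrable I01 (u B n)" for B n by (rule integrable_bounded[OF uL, of _ _ "real B"]) (use uB in auto)
  have wint: "integrable I01 (w B)" for B by (rule integrable_X[OF wX])
  have wmono: "AE t in I01. w B t \<le> w (Suc B) t" for B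
  proof -
    have "AE t in I01. 0 \<le> w (Suc B) t - w B t"
    proof (rule AE_nonneg_if_avg_nonneg[of _ "2 * real B + 1"])
      show "(\<lambda>t. w (Suc B) t - w B t) \<in> L0" by (rule X_L0[OF diff_X[OF wX wX]])
      show "\<bar>w (Suc B) t - w B t\<bar> \<le> 2 * real B + 1" for t
        using w(2,3)[of B t] w(2,3)[of "Suc B" t] by simp
      fix k and t :: real assume t: "0 \<le> t" "t < 1"
      have "avg k (w B) t \<le> avg k (w (Suc B)) t"
      proof (rule LIMSEQ_le[OF w(5)[OF t] w(5)[OF t]], intro exI allI impI)
        fix n show "avg k (u B n) t \<le> avg k (u (Suc B) n) t"
          by (rule avg_mono[OF uint uint]) (auto simp: u_def)
      qed
      then show "0 \<le> avg k (\<lambda>t. w (Suc B) t - w B t) t" using avg_diff[OF wint wint] by simp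
    qed
    then show ?thesis by eventually_elim simp
  qed
  obtain g where g: "g \<in> X" "AE t in I01. (SUP n. ereal (w n t)) = ereal (g t)"
    using mc[unfolded monotonically_complete_def, rule_format, of w] wX w(2,4) wmono by auto
  have wmono': "AE t in I01. \<forall>B. w B t \<le> w (Suc B) t" using wmono by (simp add: AE_all_countable)
  have wlim: "AE t in I01. (\<lambda>B. w B t) \<longlonglongrightarrow> g t \<and> (\<forall>B. w B t \<le> g t)"
    using wmono' g(2)
  proof eventually_elim
    case (elim t)
    have "incseq (\<lambda>B. ereal (w B t))" by (rule incseq_SucI) (use elim(1) in simp)
    then have "(\<lambda>B. ereal (w B t)) \<longlonglongrightarrow> ereal (g t)" using LIMSEQ_SUP[of "\<lambda>B. ereal (w B t)"] elim(2) by simp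
    moreover have "ereal (w B t) \<le> ereal (g t)" for B unfolding elim(2)[symmetric] by (rule SUP_upper) simp
    ultimately show ?case by simp
  qed
  have gint: "integrable I01 g" by (rule integrable_X[OF g(1)])
  have "(\<lambda>n. avg k (f n) t) \<longlonglongrightarrow> avg k g t" if t: "0 \<le> t" "t < 1" for k t
  proof (rule LIMSEQ_I)
    fix e :: real assume e: "0 < e"
    have lim1: "(\<lambda>B. avg k (w B) t) \<longlonglongrightarrow> avg k g t"
    proof (rule avg_tendsto[OF w(1) X_L0[OF g(1)] gint])
      show "AE t in I01. \<bar>w B t\<bar> \<le> g t" for B using wlim by eventually_elim (use w(2) in auto)
      show "AE t in I01. (\<lambda>B. w B t) \<longlonglongrightarrow> g t" using wlim by eventually_elim simp
    qed
    have "(\<lambda>B. real B powr (1 - p)) \<longlonglongrightarrow> 0"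
      by (rule tendsto_neg_powr) (use p in \<open>auto intro: filterlim_real_sequentially\<close>)
    then have lim2: "(\<lambda>B. 2 ^ k * (real B powr (1 - p) * (Lp_const * \<kappa>) powr p)) \<longlonglongrightarrow> 0"
      by (intro tendsto_mult_right_zero tendsto_mult_left_zero)
    have "\<forall>\<^sub>F B in sequentially. \<bar>avg k (w B) t - avg k g t\<bar> < e / 3"
      using tendstoD[OF lim1, of "e / 3"] e by (simp add: dist_real_def)
    moreover have "\<forall>\<^sub>F B in sequentially. 2 ^ k * (real B powr (1 - p) * (Lp_const * \<kappa>) powr p) < e / 3"
      using order_tendstoD(2)[OF lim2, of "e / 3"] e by simp
    ultimately have "\<forall>\<^sub>F B in sequentially. 0 < B \<and> \<bar>avg k (w B) t - avg k g t\<bar> < e / 3 \<and>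
      2 ^ k * (real B powr (1 - p) * (Lp_const * \<kappa>) powr p) < e / 3"
      by (intro eventually_conj eventually_gt_at_top)
    then obtain B where B: "0 < B" "\<bar>avg k (w B) t - avg k g t\<bar> < e / 3"
      "2 ^ k * (real B powr (1 - p) * (Lp_const * \<kappa>) powr p) < e / 3"
      using eventually_happens'[OF sequentially_bot] by blast
    obtain n0 where n0: "\<And>n. n0 \<le> n \<Longrightarrow> \<bar>avg k (u B n) t - avg k (w B) t\<bar> < e / 3"
      using LIMSEQ_D[OF w(5)[OF t, of k B], of "e / 3"] e by auto
    have near: "\<bar>avg k (f n) t - avg k (u B n) t\<bar> < e / 3" for n
    proof -
      have fint: "integrable I01 (f n)" for n by (rule integrable_X[OF f(1)])
      have "\<bar>avg k (\<lambda>t. f n t - u B n t) t\<bar> \<le> 2 ^ k * (LINT t|I01. \<bar>f n t - u B n t\<bar>)"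
        by (rule avg_abs_le) (use fint uint in simp)
      also have "(LINT t|I01. \<bar>f n t - u B n t\<bar>) \<le> (LINT t|I01. \<bar>f n t\<bar> * of_bool (real B < \<bar>f n t\<bar>))"
      proof (rule integral_mono)
        show "integrable I01 (\<lambda>t. \<bar>f n t\<bar> * of_bool (real B < \<bar>f n t\<bar>))"
        proof (rule Bochner_Integration.integrable_bound[OF fint])
          have [measurable]: "f n \<in> L0" by (rule fL)
          show "(\<lambda>t. \<bar>f n t\<bar> * of_bool (real B < \<bar>f n t\<bar>)) \<in> L0" by measurable
        qed auto
        show "\<bar>f n t - u B n t\<bar> \<le> \<bar>f n t\<bar> * of_bool (real B < \<bar>f n t\<bar>)" for t
          using f(2)[of n t] by (auto simp: u_def min_def)
      qed (use fint uint in simp)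
      also have "\<dots> \<le> real B powr (1 - p) * (Lp_const * \<kappa>) powr p"
        by (rule uniformly_integrable[OF f(1) \<kappa>]) (use B(1) in simp)
      finally show ?thesis using B(3) avg_diff[OF fint[of n] uint[of B n], of k t] by simp
    qed
    have "norm (avg k (f n) t - avg k g t) < e" if "n0 \<le> n" for n
      using near[of n] n0[OF that] B(2) unfolding real_norm_def by linarith
    then show "\<exists>no. \<forall>n\<ge>no. norm (avg k (f n) t - avg k g t) < e" by blast
  qed
  then show ?thesis using g(1) by blast
qed

text \<open>Positive and negative parts are treated separately, because truncations of a nonnegative
  function increase with the level. Convergence of all truncated averages amounts to countably many
  conditions, one for each sign, truncation level and dyadic cell.\<close>

lemma weak_limit:
  fixes f :: "nat \<Rightarrow> real \<Rightarrow> real"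
  assumes mc: "monotonically_complete X N" and f: "\<And>n. f n \<in> X" and \<kappa>: "\<And>n. N (f n) \<le> \<kappa>"
  shows "\<exists>r. strict_mono r \<and> (\<exists>g\<in>X. \<forall>k t. 0 \<le> t \<longrightarrow> t < 1 \<longrightarrow> (\<lambda>n. avg k (f (r n)) t) \<longlonglongrightarrow> avg k g t)"
proof -
  define F where "F b n s = (if b then max 0 (f n s) else max 0 (- f n s))" for b :: bool and n s
  have FX: "F b n \<in> X" and FN: "N (F b n) \<le> \<kappa>" for b n
  proof -
    have L: "F b n \<in> L0" unfolding F_def[abs_def] using X_L0[OF f, of n] by measurable
    have le: "AE t in I01. \<bar>F b n t\<bar> \<le> \<bar>f n t\<bar>" by (auto simp: F_def)
    show "F b n \<in> X" by (rule idealD[OF L f le])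
    show "N (F b n) \<le> \<kappa>" using norm_mono[OF L f le] \<kappa>[of n] by linarith
  qed
  \<comment> \<open>Dividing by \<open>real B + 1\<close> brings the coordinates of all truncation
    levels, zero included, under the common bound 1.\<close>
  define V where "V n x = (case x of (b, B, k, i) \<Rightarrow>
      if i < 2 ^ k then avg k (\<lambda>s. min (F b n s) (real B)) (real i / 2 ^ k) / (real B + 1) else 0)"
    for n and x :: "bool \<times> nat \<times> nat \<times> nat"
  have mint: "integrable I01 (\<lambda>s. min (F b n s) (real B))" for b n B
  proof (rule integrable_bounded[of _ "real B"])
    show "(\<lambda>s. min (F b n s) (real B)) \<in> L0" using X_L0[OF FX, of b n] by measurable
  qed (auto simp: F_def)
  have V1: "\<bar>V n x\<bar> \<le> 1" for n x
  proof -
    obtain b B k i where x: "x = (b, B, k, i)" using prod_cases4 by blast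
    show ?thesis
    proof (cases "i < 2 ^ k")
      case True
      then have "real i < real (2 ^ k)" by (simp only: of_nat_less_iff)
      then have t: "0 \<le> real i / 2 ^ k" "real i / 2 ^ k < 1" by (auto simp: field_simps)
      have "0 \<le> avg k (\<lambda>s. min (F b n s) (real B)) (real i / 2 ^ k)"
        using avg_mono[of "\<lambda>s. 0" "\<lambda>s. min (F b n s) (real B)" k "real i / 2 ^ k"] avg_const[OF t, of k 0] mint
        by (auto simp: F_def)
      moreover have "avg k (\<lambda>s. min (F b n s) (real B)) (real i / 2 ^ k) \<le> real B"
        using avg_mono[of "\<lambda>s. min (F b n s) (real B)" "\<lambda>s. real B" k "real i / 2 ^ k"] avg_const[OF t, of k "real B"] mint
        by auto
      ultimately show ?thesis by (simp add: V_def x field_simps)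
    qed (simp add: V_def x)
  qed
  obtain r where r: "strict_mono r" "\<And>x. convergent (\<lambda>n. V (r n) x)"
    using diagonal_convergent_subsequence[of V 1, OF V1] by blast
  have conv: "convergent (\<lambda>n. avg k (\<lambda>s. min (F b (r n) s) (real B)) t)" if t: "0 \<le> t" "t < 1" for b B k t
  proof -
    let ?i = "nat \<lfloor>2 ^ k * t\<rfloor>"
    obtain l where l: "(\<lambda>n. V (r n) (b, B, k, ?i)) \<longlonglongrightarrow> l" using r(2) unfolding convergent_def by blast
    have "avg k (\<lambda>s. min (F b (r n) s) (real B)) t = (real B + 1) * V (r n) (b, B, k, ?i)" for n
      using dyadic_eq[OF dyadic_avg grid_index(2)[OF t, of k], of "\<lambda>s. min (F b (r n) s) (real B)"]
        grid_index(1)[OF t, of k] by (simp add: V_def)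
    then show ?thesis unfolding convergent_def using tendsto_mult_left[OF l, of "real B + 1"]
      by (intro exI[of _ "(real B + 1) * l"]) simp
  qed
  have "\<exists>g\<in>X. \<forall>k t. 0 \<le> t \<longrightarrow> t < 1 \<longrightarrow> (\<lambda>n. avg k (F b (r n)) t) \<longlonglongrightarrow> avg k g t" for b
    by (rule nonneg_weak_limit[OF mc FX _ FN conv]) (auto simp: F_def)
  then obtain g1 g2 where g: "g1 \<in> X" "g2 \<in> X"
    "\<And>k t. 0 \<le> t \<Longrightarrow> t < 1 \<Longrightarrow> (\<lambda>n. avg k (F True (r n)) t) \<longlonglongrightarrow> avg k g1 t"
    "\<And>k t. 0 \<le> t \<Longrightarrow> t < 1 \<Longrightarrow> (\<lambda>n. avg k (F False (r n)) t) \<longlonglongrightarrow> avg k g2 t" by metis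
  have "(\<lambda>n. avg k (f (r n)) t) \<longlonglongrightarrow> avg k (\<lambda>t. g1 t - g2 t) t" if t: "0 \<le> t" "t < 1" for k t
  proof -
    have "f n = (\<lambda>s. F True n s - F False n s)" for n by (auto simp: F_def)
    then have "avg k (f n) t = avg k (F True n) t - avg k (F False n) t" for n
      using avg_diff[OF integrable_X[OF FX] integrable_X[OF FX], of k True n False n t] by simp
    then show ?thesis
      using tendsto_diff[OF g(3)[OF t] g(4)[OF t]] avg_diff[OF integrable_X[OF g(1)] integrable_X[OF g(2)]] by simp
  qed
  then show ?thesis using r(1) diff_X[OF g(1,2)] by blast
qed

lemma special_modular_imp_order_Banach_Saks:
  assumes mc: "monotonically_complete X N" and \<rho>: "special_modular X N \<rho>"
  shows "order_Banach_Saks X N"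
  unfolding order_Banach_Saks_def
proof (intro allI impI, elim conjE exE)
  fix f :: "nat \<Rightarrow> real \<Rightarrow> real" and \<kappa> assume f': "\<forall>n. f n \<in> X" and \<kappa>': "\<forall>n. N (f n) \<le> \<kappa>"
  have f: "f n \<in> X" and \<kappa>: "N (f n) \<le> \<kappa>" for n using f' \<kappa>' by auto
  obtain r where r: "strict_mono r"
    and "\<exists>g\<in>X. \<forall>k t. 0 \<le> t \<longrightarrow> t < 1 \<longrightarrow> (\<lambda>n. avg k (f (r n)) t) \<longlonglongrightarrow> avg k g t"
    using weak_limit[of f \<kappa>, OF mc f \<kappa>] by (elim exE conjE)
  then obtain g where g: "g \<in> X"
    and lim: "\<And>k t. 0 \<le> t \<Longrightarrow> t < 1 \<Longrightarrow> (\<lambda>n. avg k (f (r n)) t) \<longlonglongrightarrow> avg k g t"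
    by (elim bexE) simp
  have "0 \<le> \<kappa>" using \<kappa>[of 0] norm_nonneg[OF f[of 0]] by linarith
  \<comment> \<open>The scaling moves \<open>h n\<close> into the unit ball, where (M3) applies; the
    added 1 keeps \<open>c\<close> positive.\<close>
  define c where "c = \<kappa> + N g + 1"
  have c: "0 < c" using \<open>0 \<le> \<kappa>\<close> norm_nonneg[OF g] by (simp add: c_def)
  define h where "h n t = (1 / c) * (f (r n) t - g t)" for n t
  have dX: "(\<lambda>t. f (r n) t - g t) \<in> X" for n by (rule diff_X[OF f g])
  have hX: "h n \<in> X" for n unfolding h_def[abs_def] by (rule scale[OF dX])
  have hN: "N (h n) \<le> 1" for n
  proof -
    have "N (\<lambda>t. f (r n) t - g t) \<le> c" using norm_diff[OF f g, of "r n"] \<kappa>[of "r n"] by (simp add: c_def)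
    then show ?thesis unfolding h_def[abs_def] norm_scale[OF dX] using c by simp
  qed
  have hlim: "(\<lambda>n. avg k (h n) t) \<longlonglongrightarrow> 0" if t: "0 \<le> t" "t < 1" for k t
  proof -
    have "avg k (h n) t = (1 / c) * (avg k (f (r n)) t - avg k g t)" for n
      unfolding avg_diff[OF integrable_X[OF f] integrable_X[OF g], symmetric]
      by (simp add: h_def avg_def)
    moreover have "(\<lambda>n. (1 / c) * (avg k (f (r n)) t - avg k g t)) \<longlonglongrightarrow> (1 / c) * (avg k g t - avg k g t)"
      by (intro tendsto_intros lim[OF t])
    ultimately show ?thesis by simp
  qed
  obtain s where s: "strict_mono s" "order_null (cesaro (h \<circ> s))"
    using order_null_cesaro_modular[of \<rho> h, OF \<rho> hX hN hlim] by blast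
  have "order_converges X (\<lambda>n t. c * cesaro (h \<circ> s) n t + g t) g"
    by (rule order_converges_order_null_add[OF s(2) g])
  moreover have "(\<lambda>n t. c * cesaro (h \<circ> s) n t + g t) = cesaro (f \<circ> (r \<circ> s))"
  proof (intro ext)
    fix n t
    have "(\<Sum>j\<le>n. f (r (s j)) t) = (\<Sum>j\<le>n. c * (h \<circ> s) j t + g t)" using c by (simp add: h_def)
    also have "\<dots> = c * (\<Sum>j\<le>n. (h \<circ> s) j t) + real (Suc n) * g t" by (simp add: sum.distrib sum_distrib_left)
    finally show "c * cesaro (h \<circ> s) n t + g t = cesaro (f \<circ> (r \<circ> s)) n t"
      by (simp add: cesaro_def add_divide_distrib del: of_nat_Suc)
  qed
  ultimately have "order_converges X (cesaro (f \<circ> (r \<circ> s))) g" by simp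
  then show "\<exists>r l. strict_mono r \<and> order_converges X (cesaro (f \<circ> r)) l"
    using strict_mono_o[OF r s(1)] by blast
qed

end

section \<open>The theorem\<close>

text \<open>Jensen's inequality for the power \<open>p / q\<close>, applied at the positive points
  \<open>a i powr q + e\<close>; then \<open>e\<close> tends to zero.\<close>

lemma power_mean_le:
  fixes w a :: "'a \<Rightarrow> real" and p q :: real
  assumes A: "finite A" "A \<noteq> {}" and w: "\<And>i. i \<in> A \<Longrightarrow> 0 < w i" "(\<Sum>i\<in>A. w i) = 1"
    and a: "\<And>i. i \<in> A \<Longrightarrow> 0 \<le> a i" and q: "0 < q" "q \<le> p"
  shows "(\<Sum>i\<in>A. w i * a i powr q) powr (1 / q) \<le> (\<Sum>i\<in>A. w i * a i powr p) powr (1 / p)"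
proof -
  define r where "r = p / q"
  have r: "1 \<le> r" using q by (simp add: r_def)
  let ?s = "\<lambda>e. (\<Sum>i\<in>A. w i * (a i powr q + e))"
  have conv: "(?s e) powr r \<le> (\<Sum>i\<in>A. w i * (a i powr q + e) powr r)" if e: "0 < e" for e
    using convex_on_sum[OF A powr_convex[OF r] w(2), of "\<lambda>i. a i powr q + e"] w(1) e
    by (auto simp: add_nonneg_pos intro: less_imp_le)
  have "(?s 0) powr r \<le> (\<Sum>i\<in>A. w i * (a i powr q + 0) powr r)"
  proof (rule LIMSEQ_le)
    let ?e = "\<lambda>n. 1 / real (Suc n)"
    have e: "?e \<longlonglongrightarrow> 0" by (rule LIMSEQ_Suc[OF lim_1_over_n])
    show "(\<lambda>n. (?s (?e n)) powr r) \<longlonglongrightarrow> (?s 0) powr r"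
      using r w(1) by (intro tendsto_powr2 tendsto_intros e always_eventually allI sum_nonneg mult_nonneg_nonneg add_nonneg_nonneg)
        (auto intro: less_imp_le)
    show "(\<lambda>n. \<Sum>i\<in>A. w i * (a i powr q + ?e n) powr r) \<longlonglongrightarrow> (\<Sum>i\<in>A. w i * (a i powr q + 0) powr r)"
      using r by (intro tendsto_sum tendsto_mult tendsto_powr2 tendsto_add tendsto_const e always_eventually allI add_nonneg_nonneg) auto
    show "\<exists>n0. \<forall>n\<ge>n0. (?s (?e n)) powr r \<le> (\<Sum>i\<in>A. w i * (a i powr q + ?e n) powr r)"
      using conv[of "?e n" for n] by (intro exI allI impI) simp
  qed
  moreover have "(a i powr q) powr r = a i powr p" for i using q by (simp add: r_def powr_powr)
  ultimately have "(\<Sum>i\<in>A. w i * a i powr q) powr r \<le> (\<Sum>i\<in>A. w i * a i powr p)" by simp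
  then have "((\<Sum>i\<in>A. w i * a i powr q) powr r) powr (1 / p) \<le> (\<Sum>i\<in>A. w i * a i powr p) powr (1 / p)"
    using q by (intro powr_mono2) auto
  moreover have "((\<Sum>i\<in>A. w i * a i powr q) powr r) powr (1 / p) = (\<Sum>i\<in>A. w i * a i powr q) powr (1 / q)"
    using q by (simp add: r_def powr_powr)
  ultimately show ?thesis by simp
qed

text \<open>The power mean inequality is applied with weights proportional to \<open>(N (f i) + e) powr q\<close>;
  the \<open>e > 0\<close> keeps them positive.\<close>

lemma p_convex_mono:
  assumes ri: "ri_space X N" and q: "1 \<le> q" "q \<le> p" and pc: "p_convex p X N"
  shows "p_convex q X N"
proof -
  interpret ri_space X N by (rule ri)
  obtain C where C: "0 < C" and pcv: "\<And>(n::nat) f. (\<And>i. i < n \<Longrightarrow> f i \<in> X) \<Longrightarrow>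
      N (\<lambda>t. (\<Sum>i<n. \<bar>f i t\<bar> powr p) powr (1 / p)) \<le> C * (\<Sum>i<n. N (f i) powr p) powr (1 / p)"
    using pc unfolding p_convex_def by blast
  show ?thesis
    unfolding p_convex_def
  proof (intro exI[of _ C] conjI C allI impI)
    fix n :: nat and f assume f': "\<forall>i<n. f i \<in> X"
    have f: "f i \<in> X" if "i < n" for i using f' that by blast
    have Nf: "0 \<le> N (f i)" if "i < n" for i by (rule norm_nonneg[OF f[OF that]])
    let ?F = "\<lambda>t. (\<Sum>i<n. \<bar>f i t\<bar> powr q) powr (1 / q)"
    show "N ?F \<le> C * (\<Sum>i<n. N (f i) powr q) powr (1 / q)"
    proof (cases "n = 0")
      case True
      then show ?thesis by (simp add: norm_zero)
    next
      case False
      have FX: "?F \<in> X" by (rule p_function_X[OF q(1) f])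
      have main: "N ?F \<le> C * (\<Sum>i<n. (N (f i) + e) powr q) powr (1 / q)" if e: "0 < e" for e
      proof -
        define M where "M i = N (f i) + e" for i
        define T where "T = (\<Sum>i<n. M i powr q)"
        define w where "w i = M i powr q / T" for i
        have M: "0 < M i" if "i < n" for i using Nf[OF that] e by (simp add: M_def)
        have "0 < M i powr q" if "i < n" for i using M[OF that] by simp
        then have T: "0 < T" unfolding T_def by (intro sum_pos) (use False in auto)
        have w: "0 < w i" if "i < n" for i using M[OF that] T by (simp add: w_def)
        have w1: "(\<Sum>i<n. w i) = 1" using T by (simp add: w_def sum_divide_distrib[symmetric] T_def[symmetric])
        let ?g = "\<lambda>i t. (w i powr (1 / p - 1 / q)) * f i t"
        have gX: "?g i \<in> X" if "i < n" for i by (rule scale[OF f[OF that]])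
        have le: "?F t \<le> (\<Sum>i<n. \<bar>?g i t\<bar> powr p) powr (1 / p)" for t
        proof -
          \<comment> \<open>The exponents are chosen so that, with weights \<open>w i\<close>, the
            \<open>q\<close>-mean of \<open>?a\<close> is the \<open>q\<close>-function of
            \<open>f\<close> and the \<open>p\<close>-mean is the \<open>p\<close>-function of
            \<open>?g\<close>.\<close>
          let ?a = "\<lambda>i. w i powr (- (1 / q)) * \<bar>f i t\<bar>"
          have 1: "w i * ?a i powr q = \<bar>f i t\<bar> powr q" if "i < n" for i
            using w[OF that] q by (simp add: powr_mult powr_powr powr_neg_one)
          have 2: "w i * ?a i powr p = \<bar>?g i t\<bar> powr p" if "i < n" for i
          proof -
            have "w i * ?a i powr p = w i powr 1 * w i powr (- (1 / q) * p) * \<bar>f i t\<bar> powr p"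
              using w[OF that] by (simp add: powr_mult powr_powr)
            also have "w i powr 1 * w i powr (- (1 / q) * p) = w i powr ((1 / p - 1 / q) * p)"
            proof -
              have "1 + - (1 / q) * p = (1 / p - 1 / q) * p" using q by (simp add: field_simps)
              then show ?thesis by (simp only: powr_add[symmetric])
            qed
            also have "\<dots> * \<bar>f i t\<bar> powr p = \<bar>?g i t\<bar> powr p"
              by (simp add: abs_mult powr_mult powr_powr)
            finally show ?thesis .
          qed
          have "(\<Sum>i<n. w i * ?a i powr q) powr (1 / q) \<le> (\<Sum>i<n. w i * ?a i powr p) powr (1 / p)"
            by (rule power_mean_le) (use w w1 q False in auto)
          then show ?thesis using 1 2 by simp
        qed
        have "N ?F \<le> N (\<lambda>t. (\<Sum>i<n. \<bar>?g i t\<bar> powr p) powr (1 / p))"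
          by (rule norm_mono[OF X_L0[OF FX] p_function_X[OF _ gX]]) (use le q in auto)
        also have "\<dots> \<le> C * (\<Sum>i<n. N (?g i) powr p) powr (1 / p)" by (rule pcv[OF gX])
        also have "\<dots> \<le> C * (T powr (p / q)) powr (1 / p)"
        proof (intro mult_left_mono powr_mono2)
          have "N (?g i) powr p \<le> w i * T powr (p / q)" if i: "i < n" for i
          proof -
            \<comment> \<open>Expressing \<open>M i\<close> through its weight shows that
              \<open>N (?g i)\<close> is at most \<open>w i powr (1 / p) * T powr (1 / q)\<close>;
              as the weights sum to one, only \<open>T\<close> survives the summation.\<close>
            have wT: "M i = w i powr (1 / q) * T powr (1 / q)"
              using M[OF i] T q by (simp add: w_def powr_mult[symmetric] powr_powr)
            have "N (?g i) = w i powr (1 / p - 1 / q) * N (f i)" using norm_scale[OF f[OF i]] by simp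
            also have "\<dots> \<le> w i powr (1 / p - 1 / q) * M i"
              using e by (intro mult_left_mono) (auto simp: M_def)
            also have "\<dots> = (w i powr (1 / p - 1 / q) * w i powr (1 / q)) * T powr (1 / q)" by (simp add: wT)
            also have "w i powr (1 / p - 1 / q) * w i powr (1 / q) = w i powr (1 / p)"
              by (simp add: powr_add[symmetric])
            finally have "N (?g i) powr p \<le> (w i powr (1 / p) * T powr (1 / q)) powr p"
              using q norm_nonneg[OF gX[OF i]] by (intro powr_mono2) auto
            also have "\<dots> = w i * T powr (p / q)" using q w[OF i] by (simp add: powr_mult powr_powr)
            finally show ?thesis .
          qed
          then have "(\<Sum>i<n. N (?g i) powr p) \<le> (\<Sum>i<n. w i * T powr (p / q))" by (intro sum_mono) auto
          then show "(\<Sum>i<n. N (?g i) powr p) \<le> T powr (p / q)" using w1 by (simp add: sum_distrib_right[symmetric])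
        qed (use C q in \<open>auto intro: sum_nonneg\<close>)
        also have "(T powr (p / q)) powr (1 / p) = T powr (1 / q)" using q by (simp add: powr_powr)
        finally show ?thesis unfolding T_def M_def .
      qed
      let ?e = "\<lambda>n. 1 / real (Suc n)"
      have e0: "?e \<longlonglongrightarrow> 0" by (rule LIMSEQ_Suc[OF lim_1_over_n])
      have "(\<lambda>m. C * (\<Sum>i<n. (N (f i) + ?e m) powr q) powr (1 / q)) \<longlonglongrightarrow> C * (\<Sum>i<n. (N (f i) + 0) powr q) powr (1 / q)"
        using q Nf by (intro tendsto_mult tendsto_const tendsto_powr2 tendsto_sum tendsto_add e0
            always_eventually allI add_nonneg_nonneg sum_nonneg) auto
      then have "N ?F \<le> C * (\<Sum>i<n. (N (f i) + 0) powr q) powr (1 / q)"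
        by (rule LIMSEQ_le_const) (use main in auto)
      then show ?thesis by simp
    qed
  qed
qed

theorem theorem2p7:
  fixes X :: "(real \<Rightarrow> real) set" and N :: "(real \<Rightarrow> real) \<Rightarrow> real" and p :: real
  assumes "ri_space X N"
    and "1 < p" and "p_convex p X N"
    and "upper_boyd_index X N < \<infinity>"
  shows "(order_continuous X N \<longrightarrow> weak_order_Banach_Saks X N) \<and>
         (monotonically_complete X N \<and> (\<exists>\<rho>. special_modular X N \<rho>) \<longrightarrow> order_Banach_Saks X N)"
proof -
  interpret ri_space X N by (rule assms(1))
  define q where "q = min p 2"
  have q: "1 < q" "q \<le> 2" "q \<le> p" using assms(2) by (auto simp: q_def)
  have "p_convex q X N" by (rule p_convex_mono[OF assms(1) _ q(3) assms(3)]) (use q in simp)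
  then obtain C where C: "0 < C" "\<And>(n::nat) f. (\<And>i. i < n \<Longrightarrow> f i \<in> X) \<Longrightarrow>
      N (\<lambda>t. (\<Sum>i<n. \<bar>f i t\<bar> powr q) powr (1 / q)) \<le> C * (\<Sum>i<n. N (f i) powr q) powr (1 / q)"
    unfolding p_convex_def by blast
  interpret boyd_convex_space X N q C
    by unfold_locales (use q C dilation_small[OF assms(4)] in auto)
  show ?thesis
    using order_continuous_imp_weak_order_Banach_Saks special_modular_imp_order_Banach_Saks by blast
qed

end
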